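(* Let $k,k',l,l'\ge0$, $1\le p\le2$ and $p^{-1}+p'^{-1}=1$. For any $-\pi/2\le\alpha<\beta\le\pi/2$ and any $\mu\in\mathfrak{W}_{\alpha,\beta}(k,k',l,l')$, the Laplace transform $\mathcal{L}$ is a bounded operator from $L^p(\mathbb{R}_+)$ to $L^{p'}(d\mu)$. Moreover, the norm bound is uniform for all measures with given projection constants: $$K_5(p;k,k',l,l'):=\sup_{-\frac{\pi}{2}\le\alpha<\beta\le\frac{\pi}{2}}\ \sup_{\mu\in\mathfrak{W}_{\alpha,\beta}(k,k',l,l')}\|\mathcal{L}\|_{L^p(\mathbb{R}_+)\to L^{p'}(d\mu)}\le(8\pi)^{1/p'}\left(\sqrt{6k+k'}+\sqrt{6l+l'}\right)^{2/p'}.$$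
   Context: $\mathbb{R}_+=(0,\infty)$. The Laplace transform is $\mathcal{L}f(z)=\int_0^\infty f(t)e^{-zt}\,dt$, $\mathrm{Re}\,z\ge0$; as an operator on $L^p(\mathbb{R}_+)$ it is understood as the extension by continuity from $L^1(\mathbb{R}_+)\cap L^p(\mathbb{R}_+)$. For an angle $\alpha$ put $\xi=x\cos\alpha+y\sin\alpha$, $\eta=-x\sin\alpha+y\cos\alpha$ (where $z=x+iy$). For $A\subset\mathbb{C}$ let $A_\xi$, $A_\eta$ be the projections of $A$ on the $\xi$- and $\eta$-axes (the images of $A$ under $\xi$ and $\eta$), and $|\cdot|$ Lebesgue measure. A Borel measure $\mu$ on $\mathbb{C}$ belongs to $\mathfrak{W}_\alpha(k_\xi,k_\eta)$ ($k_\xi,k_\eta\ge0$) if $\mu(A)\le k_\xi|A_\xi|+k_\eta|A_\eta|$ for every Borel set $A\subset\mathbb{C}$ for which the right-hand side is finite. For $-\pi/2\le\alpha<\beta\le\pi/2$, $\mathfrak{W}_{\alpha,\beta}(k,k',l,l')$ is the class of Borel measures $\mu$ supported on the sector $\{\alpha\le\arg z\le\beta\}$ such that $\mu\in\mathfrak{W}_\alpha(k,k')$ and $\mu\in\mathfrak{W}_\beta(l,l')$. *)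

theory Defs
  imports "HOL-Probability.Essential_Supremum"
begin

section \<open>Lebesgue spaces of complex-valued functions\<close>

text \<open>The exponent \<open>p\<close> is an extended number in \<open>[1, \<infinity>]\<close>, so that the conjugate
  exponent of \<open>1\<close> is available. Elements of \<open>Lspace p M\<close> are functions, not
  classes modulo equality almost everywhere.\<close>

definition Lnorm :: "ennreal \<Rightarrow> 'a measure \<Rightarrow> ('a \<Rightarrow> complex) \<Rightarrow> ennreal" where
  "Lnorm p M f =
     (if p = \<infinity> then esssup M (\<lambda>x. ennreal (norm (f x)))
      else let I = (\<integral>\<^sup>+x. ennreal (norm (f x) powr enn2real p) \<partial>M)
           in if I = \<infinity> then \<infinity> else ennreal (enn2real I powr (1 / enn2real p)))"

definition Lspace :: "ennreal \<Rightarrow> 'a measure \<Rightarrow> ('a \<Rightarrow> complex) set" where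
  "Lspace p M = {f \<in> borel_measurable M. Lnorm p M f < \<infinity>}"

text \<open>Additivity and homogeneity can only be required almost everywhere. Together with the
  bound they force \<open>T\<close> to respect equality almost everywhere.\<close>

definition bounded_Lp_operator ::
    "ennreal \<Rightarrow> 'a measure \<Rightarrow> ennreal \<Rightarrow> 'b measure \<Rightarrow>
     (('a \<Rightarrow> complex) \<Rightarrow> ('b \<Rightarrow> complex)) \<Rightarrow> bool" where
  "bounded_Lp_operator p M q N T \<longleftrightarrow>
     (\<forall>f\<in>Lspace p M. T f \<in> Lspace q N) \<and>
     (\<forall>f\<in>Lspace p M. \<forall>g\<in>Lspace p M. \<forall>a b.
        AE z in N. T (\<lambda>t. a * f t + b * g t) z = a * T f z + b * T g z) \<and>
     (\<exists>C::real. \<forall>f\<in>Lspace p M. Lnorm q N (T f) \<le> ennreal C * Lnorm p M f)"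

definition Lp_operator_norm ::
    "ennreal \<Rightarrow> 'a measure \<Rightarrow> ennreal \<Rightarrow> 'b measure \<Rightarrow>
     (('a \<Rightarrow> complex) \<Rightarrow> ('b \<Rightarrow> complex)) \<Rightarrow> ennreal" where
  "Lp_operator_norm p M q N T = (SUP f \<in> {f \<in> Lspace p M. Lnorm p M f \<le> 1}. Lnorm q N (T f))"


section \<open>The Laplace transform\<close>

definition Rplus :: "real measure" where
  "Rplus = restrict_space lborel {0<..}"

text \<open>Only the values with \<open>Re z \<ge> 0\<close> matter below: the measures considered vanish on the
  rest of the plane.\<close>

definition laplace :: "(real \<Rightarrow> complex) \<Rightarrow> complex \<Rightarrow> complex" where
  "laplace f z = (\<integral>t. f t * exp (- (z * complex_of_real t)) \<partial>Rplus)"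

text \<open>\<open>g\<close> is the value at \<open>f \<in> L\<^sup>p\<close> of the extension by continuity of \<^const>\<open>laplace\<close> from
  \<open>L\<^sup>1 \<inter> L\<^sup>p\<close>: the transforms of all approximating sequences converge to \<open>g\<close> in
  \<open>L\<^sup>q(\<mu>)\<close>.\<close>

definition is_laplace_ext ::
    "ennreal \<Rightarrow> ennreal \<Rightarrow> complex measure \<Rightarrow> (real \<Rightarrow> complex) \<Rightarrow> (complex \<Rightarrow> complex) \<Rightarrow> bool" where
  "is_laplace_ext p q \<mu> f g \<longleftrightarrow>
     g \<in> Lspace q \<mu> \<and>
     (\<forall>\<phi>::nat \<Rightarrow> real \<Rightarrow> complex.
        (\<forall>n. \<phi> n \<in> Lspace 1 Rplus \<inter> Lspace p Rplus) \<longrightarrow>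
        (\<lambda>n. Lnorm p Rplus (\<lambda>t. \<phi> n t - f t)) \<longlonglongrightarrow> 0 \<longrightarrow>
        (\<lambda>n. Lnorm q \<mu> (\<lambda>z. laplace (\<phi> n) z - g z)) \<longlonglongrightarrow> 0)"

definition laplace_ext ::
    "ennreal \<Rightarrow> ennreal \<Rightarrow> complex measure \<Rightarrow> (real \<Rightarrow> complex) \<Rightarrow> complex \<Rightarrow> complex" where
  "laplace_ext p q \<mu> f = (SOME g. is_laplace_ext p q \<mu> f g)"

text \<open>The first conjunct says that the extension exists, so that \<^const>\<open>laplace_ext\<close> is not
  an arbitrary value of the choice operator.\<close>

definition laplace_bounded :: "ennreal \<Rightarrow> ennreal \<Rightarrow> complex measure \<Rightarrow> bool" where
  "laplace_bounded p q \<mu> \<longleftrightarrow>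
     (\<forall>f\<in>Lspace p Rplus. is_laplace_ext p q \<mu> f (laplace_ext p q \<mu> f)) \<and>
     bounded_Lp_operator p Rplus q \<mu> (laplace_ext p q \<mu>)"

definition laplace_norm :: "ennreal \<Rightarrow> ennreal \<Rightarrow> complex measure \<Rightarrow> ennreal" where
  "laplace_norm p q \<mu> = Lp_operator_norm p Rplus q \<mu> (laplace_ext p q \<mu>)"


section \<open>Measures controlled by projections\<close>

definition xi :: "real \<Rightarrow> complex \<Rightarrow> real" where
  "xi \<alpha> z = Re z * cos \<alpha> + Im z * sin \<alpha>"

definition eta :: "real \<Rightarrow> complex \<Rightarrow> real" where
  "eta \<alpha> z = - Re z * sin \<alpha> + Im z * cos \<alpha>"

text \<open>The projection of a Borel set is analytic, hence Lebesgue measurable, but in general not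
  Borel; so its length is measured by \<^const>\<open>lebesgue\<close> and not by \<^const>\<open>lborel\<close>.
  As usual in measure theory, \<open>0 \<cdot> \<infinity> = 0\<close> on the right-hand side.\<close>

definition W1 :: "real \<Rightarrow> real \<Rightarrow> real \<Rightarrow> complex measure set" where
  "W1 \<alpha> k\<xi> k\<eta> =
     {\<mu>. sets \<mu> = sets borel \<and>
         (\<forall>A\<in>sets borel.
            ennreal k\<xi> * emeasure lebesgue (xi \<alpha> ` A) +
              ennreal k\<eta> * emeasure lebesgue (eta \<alpha> ` A) < \<infinity> \<longrightarrow>
            emeasure \<mu> A \<le>
              ennreal k\<xi> * emeasure lebesgue (xi \<alpha> ` A) +
              ennreal k\<eta> * emeasure lebesgue (eta \<alpha> ` A))}"

text \<open>The sector is closed, with its vertex.\<close>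

definition sector :: "real \<Rightarrow> real \<Rightarrow> complex set" where
  "sector \<alpha> \<beta> = {z. z = 0 \<or> \<alpha> \<le> Arg z \<and> Arg z \<le> \<beta>}"

definition W2 :: "real \<Rightarrow> real \<Rightarrow> real \<Rightarrow> real \<Rightarrow> real \<Rightarrow> real \<Rightarrow> complex measure set" where
  "W2 \<alpha> \<beta> k k' l l' =
     {\<mu>. \<mu> \<in> W1 \<alpha> k k' \<and> \<mu> \<in> W1 \<beta> l l' \<and> emeasure \<mu> (- sector \<alpha> \<beta>) = 0}"

definition K5 :: "ennreal \<Rightarrow> ennreal \<Rightarrow> real \<Rightarrow> real \<Rightarrow> real \<Rightarrow> real \<Rightarrow> ennreal" where
  "K5 p q k k' l l' =
     (SUP (\<alpha>, \<beta>) \<in> {(\<alpha>, \<beta>). - pi / 2 \<le> \<alpha> \<and> \<alpha> < \<beta> \<and> \<beta> \<le> pi / 2}.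
        SUP \<mu> \<in> W2 \<alpha> \<beta> k k' l l'. laplace_norm p q \<mu>)"

text \<open>Real powers with \<open>0\<^sup>0 = 1\<close>, whereas \<open>0 powr 0 = 0\<close>.\<close>

definition rpow :: "real \<Rightarrow> real \<Rightarrow> real" where
  "rpow x a = (if a = 0 then 1 else x powr a)"

end

theory Submission
  imports Defs "HOL-Probability.Probability" "HOL-Complex_Analysis.Complex_Analysis"
begin

text \<open>For \<open>p = 1\<close> the bound \<open>|\<L>f| \<le> \<parallel>f\<parallel>\<^sub>1\<close> on \<open>Re z \<ge> 0\<close> is trivial, and \<open>1 < p < 2\<close> follows from the
  case \<open>p = 2\<close> by the Riesz--Thorin theorem, which reproduces the constant exactly.

  For \<open>p = 2\<close> cut the sector along the real axis and use the projections for \<open>\<beta>\<close> above it and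
  those for \<open>\<alpha>\<close> below it. By the layer-cake formula it is enough to bound
  \<open>\<integral> sup |\<L>f|\<^sup>2\<close>, the supremum being taken over the points of the half-sector with a given \<open>\<xi>\<close>,
  respectively \<open>\<eta>\<close>. In the upper half \<open>|\<eta>| \<le> Re z\<close>, so that the supremum for given \<open>\<eta>\<close> is at most
  \<open>\<L>|f|(|\<eta>|)\<close>, and \<open>\<L>\<close> is bounded on \<open>L\<^sup>2(0,\<infinity>)\<close> with norm \<open>\<surd>\<pi>\<close>. The same argument works for given \<open>\<xi>\<close>
  unless \<open>\<beta>\<close> is close to \<open>\<pi>/2\<close>. In that case \<open>\<L>f\<close> is the Poisson integral of its values on the
  imaginary axis, whose \<open>L\<^sup>2\<close> norm is at most \<open>\<surd>(2\<pi>) \<parallel>f\<parallel>\<^sub>2\<close> by Plancherel, and the supremum is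
  dominated by the Hardy--Littlewood maximal function, which is bounded on \<open>L\<^sup>2\<close> with norm 4.\<close>

section \<open>The maximal function\<close>

text \<open>A measure of the given class sees a set only through its two projections, so an estimate
  must hold uniformly along lines: for each value of \<xi>, and likewise of \<eta>, the transform is
  replaced by its supremum over that line within the half-sector. Absolute values under the integral
  suffice while the line keeps a distance of at least \<xi> cos \<beta> from the imaginary axis. The
  price 2 pi / cos \<beta> explodes at \<beta> = pi / 2, where the boundary values are a Fourier
  transform and its cancellation has to be used; this is what forces the maximal function into the
  proof.

  The switch at cos \<beta> = 1 / 24 balances the two methods. Absolute values give 24 * 2 pi = 48
  pi. On the other side the tilt of the lines costs 6/5, the maximal function 4^2 = 16, the boundary
  values themselves 1, and Plancherel 2 pi, which makes 6/5 * 17 * 2 pi < 48 pi. Since 48 pi = 8 pi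
  * 6 and the \<eta>-part costs at most 8 pi, each half contributes 8 pi times a bracket of the form
  6 k + k'. Interpolation between norm 1 at p = 1 and norm sqrt C at p = 2 gives C^(1/p'), so the
  power 2 / p' of the sum of roots comes from its square in C.\<close>

definition window :: "real \<Rightarrow> real \<Rightarrow> real \<Rightarrow> ennreal" where
  "window r y s = ennreal (1 / (2 * r)) * indicator {- r..r} (y - s)"

definition window_avg :: "real \<Rightarrow> (real \<Rightarrow> ennreal) \<Rightarrow> real \<Rightarrow> ennreal" where
  "window_avg r h y = (\<integral>\<^sup>+s. window r y s * h s \<partial>lborel)"

lemma window_commute: "window r y s = window r s y"
  by (auto simp: window_def indicator_def)

text \<open>All three arguments vary jointly, because the radius later depends measurably on the
  point. A case distinction replaces the indicator of a moving interval.\<close>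

lemma measurable_window [measurable (raw)]:
  assumes [measurable]: "r \<in> borel_measurable M" "y \<in> borel_measurable M" "s \<in> borel_measurable M"
  shows "(\<lambda>x. window (r x) (y x) (s x)) \<in> borel_measurable M"
proof -
  have "(\<lambda>x. window (r x) (y x) (s x)) = (\<lambda>x. if - r x \<le> y x - s x \<and> y x - s x \<le> r x
          then ennreal (1 / (2 * r x)) else 0)"
    by (auto simp: window_def indicator_def)
  then show ?thesis by simp
qed

lemma measurable_window_avg [measurable (raw)]:
  assumes [measurable]: "r \<in> borel_measurable M" "y \<in> borel_measurable M" "h \<in> borel_measurable borel"
  shows "(\<lambda>x. window_avg (r x) h (y x)) \<in> borel_measurable M"
  unfolding window_avg_def by measurable

lemma nn_integral_window:
  assumes "r > 0"
  shows "(\<integral>\<^sup>+s. window r y s \<partial>lborel) = 1"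
proof -
  have "(\<integral>\<^sup>+s. window r y s \<partial>lborel) = (\<integral>\<^sup>+s. ennreal (1 / (2 * r)) * indicator {y - r..y + r} s \<partial>lborel)"
    by (intro nn_integral_cong) (auto simp: window_def indicator_def)
  also have "\<dots> = ennreal (1 / (2 * r)) * ennreal (2 * r)"
    using assms by (subst nn_integral_cmult_indicator) auto
  also have "\<dots> = 1"
    using assms by (simp flip: ennreal_mult')
  finally show ?thesis .
qed

text \<open>The wider window is at most its height 1 / (2 r), the narrower one integrates to 1, and
  the product vanishes unless |y - y'| \<le> r + r' \<le> 2 r. A window of radius 2 r has height 1 /
  (4 r), hence the factor 2.\<close>

lemma nn_integral_window_window_le:
  assumes "0 < r'" "r' \<le> r"
  shows "(\<integral>\<^sup>+s. window r y s * window r' y' s \<partial>lborel) \<le> 2 * window (2 * r) y y'"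
proof (cases "\<bar>y - y'\<bar> \<le> 2 * r")
  case True
  have "(\<integral>\<^sup>+s. window r y s * window r' y' s \<partial>lborel) \<le> (\<integral>\<^sup>+s. ennreal (1 / (2 * r)) * window r' y' s \<partial>lborel)"
    by (intro nn_integral_mono mult_right_mono) (auto simp: window_def indicator_def)
  also have "\<dots> = ennreal (1 / (2 * r))"
    using assms by (subst nn_integral_cmult) (auto simp: nn_integral_window)
  also have "\<dots> = 2 * ennreal (1 / (4 * r))"
    using assms by (simp add: ennreal_mult'[symmetric] flip: ennreal_numeral)
  also have "\<dots> = 2 * window (2 * r) y y'"
    using True by (auto simp: window_def indicator_def abs_le_iff)
  finally show ?thesis .
next
  case False
  have "window r y s * window r' y' s = 0" for s
    using False assms by (auto simp: window_def indicator_def)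
  then have "(\<integral>\<^sup>+s. window r y s * window r' y' s \<partial>lborel) = (\<integral>\<^sup>+s. 0 \<partial>(lborel :: real measure))"
    by (intro nn_integral_cong)
  then show ?thesis by simp
qed

text \<open>Jensen's inequality for the probability density \<open>window r y\<close>, then Fubini
  and the symmetry of the window in its two points.\<close>

lemma window_avg_square_le:
  assumes [measurable]: "h \<in> borel_measurable borel" and "r > 0"
  shows "(\<integral>\<^sup>+y. (window_avg r h y)\<^sup>2 \<partial>lborel) \<le> (\<integral>\<^sup>+s. (h s)\<^sup>2 \<partial>lborel)"
proof -
  \<comment> \<open>The root of the height: since the indicator is idempotent, the window is the
    square of \<open>q * i\<close>, and Cauchy-Schwarz applies with \<open>q * i\<close> as one
    factor.\<close>
  define q where "q = ennreal (sqrt (1 / (2 * r)))"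
  have q: "q * q = ennreal (1 / (2 * r))"
    using assms by (simp add: q_def flip: ennreal_mult')
  define i where "i y s = (indicator {- r..r} (y - s) :: ennreal)" for y s :: real
  have i[measurable]: "(\<lambda>x. i (f x) (g x)) \<in> borel_measurable M"
    if [measurable]: "f \<in> borel_measurable M" "g \<in> borel_measurable M" for f g :: "'a \<Rightarrow> real" and M :: "'a measure"
    unfolding i_def by measurable
  have ii: "i y s * i y s = i y s" for y s by (auto simp: i_def indicator_def)
  have b: "window r y s = (q * i y s) * (q * i y s)" for y s
    unfolding window_def i_def[symmetric] q[symmetric] using ii by (simp add: mult_ac)
  have "(window_avg r h y)\<^sup>2 \<le> (\<integral>\<^sup>+s. window r y s * (h s)\<^sup>2 \<partial>lborel)" for y
  proof -
    have "(window_avg r h y)\<^sup>2 = (\<integral>\<^sup>+s. (q * i y s) * ((q * i y s) * h s) \<partial>lborel)\<^sup>2"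
      by (simp add: window_avg_def b mult.assoc)
    also have "\<dots> \<le> (\<integral>\<^sup>+s. (q * i y s)\<^sup>2 \<partial>lborel) * (\<integral>\<^sup>+s. ((q * i y s) * h s)\<^sup>2 \<partial>lborel)"
      by (rule Cauchy_Schwarz_nn_integral) auto
    also have "(\<integral>\<^sup>+s. (q * i y s)\<^sup>2 \<partial>lborel) = 1"
      using nn_integral_window[OF \<open>r > 0\<close>, of y] by (simp add: b power2_eq_square)
    also have "(\<integral>\<^sup>+s. ((q * i y s) * h s)\<^sup>2 \<partial>lborel) = (\<integral>\<^sup>+s. window r y s * (h s)\<^sup>2 \<partial>lborel)"
      by (simp add: b power2_eq_square mult_ac)
    finally show ?thesis by simp
  qed
  then have "(\<integral>\<^sup>+y. (window_avg r h y)\<^sup>2 \<partial>lborel) \<le> (\<integral>\<^sup>+y. \<integral>\<^sup>+s. window r y s * (h s)\<^sup>2 \<partial>lborel \<partial>lborel)"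
    by (intro nn_integral_mono)
  also have "\<dots> = (\<integral>\<^sup>+s. \<integral>\<^sup>+y. window r y s * (h s)\<^sup>2 \<partial>lborel \<partial>lborel)"
    by (rule lborel_pair.Fubini') measurable
  also have "\<dots> = (\<integral>\<^sup>+s. (\<integral>\<^sup>+y. window r s y \<partial>lborel) * (h s)\<^sup>2 \<partial>lborel)"
    by (subst nn_integral_multc[symmetric]) (auto simp: window_commute)
  finally show ?thesis using \<open>r > 0\<close> by (simp add: nn_integral_window)
qed

text \<open>Finiteness makes the supremum a maximum, and comparing with one further radius at a time
  keeps the maximising radius measurable. With \<open>\<rho>\<close> fixed, the sublinear operator
  becomes a linear one that has an adjoint.\<close>

lemma finite_maximal_selection:
  assumes "finite X" "X \<noteq> {}" and [measurable]: "h \<in> borel_measurable borel"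
  shows "\<exists>\<rho>\<in>borel_measurable borel. \<forall>y. \<rho> y \<in> X \<and> (SUP r\<in>X. window_avg r h y) = window_avg (\<rho> y) h y"
  using assms(1,2)
proof (induction X rule: finite_ne_induct)
  case (singleton a)
  show ?case by (rule bexI[of _ "\<lambda>_. a"]) auto
next
  case (insert a X)
  then obtain \<rho> where [measurable]: "\<rho> \<in> borel_measurable borel"
    and \<rho>: "\<And>y. \<rho> y \<in> X" "\<And>y. (SUP r\<in>X. window_avg r h y) = window_avg (\<rho> y) h y" by blast
  show ?case
  proof (rule bexI[of _ "\<lambda>y. if window_avg (\<rho> y) h y \<le> window_avg a h y then a else \<rho> y"])
    show "\<forall>y. (if window_avg (\<rho> y) h y \<le> window_avg a h y then a else \<rho> y) \<in> insert a X \<and>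
      (SUP r\<in>insert a X. window_avg r h y) =
        window_avg (if window_avg (\<rho> y) h y \<le> window_avg a h y then a else \<rho> y) h y"
      using \<rho> by (auto simp: sup_absorb1 sup_absorb2)
  qed measurable
qed

text \<open>Quantified over all sets of at most \<open>n\<close> radii and over all
  \<open>h\<close>: the bootstrap uses the hypothesis for the doubled radii and with the maximal
  function itself in place of \<open>h\<close>.\<close>

definition window_maximal_bound :: "nat \<Rightarrow> real \<Rightarrow> bool" where
  "window_maximal_bound n c \<longleftrightarrow> (\<forall>X h. finite X \<longrightarrow> card X \<le> n \<longrightarrow> X \<noteq> {} \<longrightarrow> X \<subseteq> {0<..} \<longrightarrow>
     h \<in> borel_measurable borel \<longrightarrow>
     (\<integral>\<^sup>+y. (SUP r\<in>X. window_avg r h y)\<^sup>2 \<partial>lborel) \<le> ennreal (c\<^sup>2) * (\<integral>\<^sup>+s. (h s)\<^sup>2 \<partial>lborel))"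

text \<open>The squared maximum is at most the sum of the squares. The growth in \<open>n\<close> is
  harmless, since this only provides a finite start for the iteration.\<close>

lemma window_maximal_bound_card: "window_maximal_bound n (sqrt n)"
  unfolding window_maximal_bound_def
proof (intro allI impI)
  fix X :: "real set" and h :: "real \<Rightarrow> ennreal"
  assume X: "finite X" "card X \<le> n" "X \<noteq> {}" "X \<subseteq> {0<..}" and [measurable]: "h \<in> borel_measurable borel"
  have "(SUP r\<in>X. window_avg r h y)\<^sup>2 \<le> (\<Sum>r\<in>X. (window_avg r h y)\<^sup>2)" for y
  proof -
    obtain r where r: "r \<in> X" "(SUP r\<in>X. window_avg r h y) = window_avg r h y"
      using finite_maximal_selection[OF X(1,3), of h] by auto
    then show ?thesis using member_le_sum[of r X "\<lambda>r. (window_avg r h y)\<^sup>2"] X by auto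
  qed
  then have "(\<integral>\<^sup>+y. (SUP r\<in>X. window_avg r h y)\<^sup>2 \<partial>lborel) \<le> (\<integral>\<^sup>+y. (\<Sum>r\<in>X. (window_avg r h y)\<^sup>2) \<partial>lborel)"
    by (intro nn_integral_mono)
  also have "\<dots> = (\<Sum>r\<in>X. \<integral>\<^sup>+y. (window_avg r h y)\<^sup>2 \<partial>lborel)"
    by (intro nn_integral_sum) measurable
  also have "\<dots> \<le> (\<Sum>r\<in>X. \<integral>\<^sup>+s. (h s)\<^sup>2 \<partial>lborel)"
    using X by (intro sum_mono window_avg_square_le) auto
  also have "\<dots> \<le> ennreal (real n) * (\<integral>\<^sup>+s. (h s)\<^sup>2 \<partial>lborel)"
    using X by (auto simp: ennreal_of_nat_eq_real_of_nat intro!: mult_right_mono)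
  finally show "(\<integral>\<^sup>+y. (SUP r\<in>X. window_avg r h y)\<^sup>2 \<partial>lborel) \<le> ennreal ((sqrt n)\<^sup>2) * (\<integral>\<^sup>+s. (h s)\<^sup>2 \<partial>lborel)"
    by simp
qed

text \<open>The bootstrap is a \<open>TT\<^sup>*\<close> argument: \<open>h \<mapsto> window_avg (\<rho> y) h y\<close> linearises the maximal operator,
  and since the product of two windows integrates to at most twice a window of doubled radius, \<open>TT\<^sup>*\<close>
  is dominated by the maximal operator with doubled radii and its transpose. Iterating
  \<open>c \<mapsto> 2 \<surd>c\<close> from the trivial bound \<open>\<surd>n\<close> leads to the constant 4, whatever the
  number \<open>n\<close> of radii.\<close>

lemma window_maximal_bound_step:
  assumes bd: "window_maximal_bound n c" and "c \<ge> 0"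
  shows "window_maximal_bound n (2 * sqrt c)"
  unfolding window_maximal_bound_def
proof (intro allI impI)
  fix X :: "real set" and h :: "real \<Rightarrow> ennreal"
  assume X: "finite X" "card X \<le> n" "X \<noteq> {}" "X \<subseteq> {0<..}" and [measurable]: "h \<in> borel_measurable borel"
  define N where "N = (\<integral>\<^sup>+s. (h s)\<^sup>2 \<partial>lborel)"
  obtain \<rho> where [measurable]: "\<rho> \<in> borel_measurable borel"
    and \<rho>: "\<And>y. \<rho> y \<in> X" "\<And>y. (SUP r\<in>X. window_avg r h y) = window_avg (\<rho> y) h y"
    using finite_maximal_selection[OF X(1,3), of h] by auto
  have \<rho>0: "\<rho> y > 0" for y using \<rho>(1)[of y] X by auto
  define m where "m y = window_avg (\<rho> y) h y" for y
  have [measurable]: "m \<in> borel_measurable borel" unfolding m_def by measurable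
  define S where "S = (\<integral>\<^sup>+y. (m y)\<^sup>2 \<partial>lborel)"
  \<comment> \<open>\<open>w\<close> is the adjoint of the linearised operator applied to
    \<open>m\<close>, so that \<open>S\<close> becomes the pairing of \<open>w\<close> with
    \<open>h\<close>.\<close>
  define w where "w s = (\<integral>\<^sup>+y. m y * window (\<rho> y) y s \<partial>lborel)" for s
  have [measurable]: "w \<in> borel_measurable borel" unfolding w_def by measurable
  have S_le: "S \<le> ennreal (c\<^sup>2) * N"
    using bd[unfolded window_maximal_bound_def, rule_format, OF X, of h] by (simp add: S_def N_def \<rho> m_def)
  have "S = (\<integral>\<^sup>+y. \<integral>\<^sup>+s. m y * (window (\<rho> y) y s * h s) \<partial>lborel \<partial>lborel)"
    unfolding S_def power2_eq_square
    by (subst (2) m_def) (simp add: window_avg_def nn_integral_cmult)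
  also have "\<dots> = (\<integral>\<^sup>+s. \<integral>\<^sup>+y. m y * (window (\<rho> y) y s * h s) \<partial>lborel \<partial>lborel)"
    by (rule lborel_pair.Fubini') measurable
  also have "\<dots> = (\<integral>\<^sup>+s. w s * h s \<partial>lborel)"
    unfolding w_def by (subst nn_integral_multc[symmetric]) (auto simp: mult_ac)
  finally have "S\<^sup>2 = (\<integral>\<^sup>+s. w s * h s \<partial>lborel)\<^sup>2" by simp
  then have S2: "S\<^sup>2 \<le> (\<integral>\<^sup>+s. (w s)\<^sup>2 \<partial>lborel) * N"
    unfolding N_def using Cauchy_Schwarz_nn_integral[of w lborel h] by simp
  \<comment> \<open>The squared norm of \<open>w\<close> pairs \<open>m\<close> with the operator
    times its adjoint. \<open>B\<close> carries the kernel that is valid where the first radius is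
    the larger one; the other case is the transpose and has the same integral.\<close>
  define B where "B = (\<integral>\<^sup>+y. \<integral>\<^sup>+y'. m y * m y' * window (2 * \<rho> y) y y' \<partial>lborel \<partial>lborel)"
  have "(\<integral>\<^sup>+s. (w s)\<^sup>2 \<partial>lborel) =
      (\<integral>\<^sup>+s. \<integral>\<^sup>+y. \<integral>\<^sup>+y'. m y * m y' * (window (\<rho> y) y s * window (\<rho> y') y' s) \<partial>lborel \<partial>lborel \<partial>lborel)"
  proof (rule nn_integral_cong)
    fix s
    have "(w s)\<^sup>2 = (\<integral>\<^sup>+y. m y * window (\<rho> y) y s * w s \<partial>lborel)"
      by (subst nn_integral_multc) (auto simp: w_def power2_eq_square)
    also have "\<dots> = (\<integral>\<^sup>+y. \<integral>\<^sup>+y'. m y * m y' * (window (\<rho> y) y s * window (\<rho> y') y' s) \<partial>lborel \<partial>lborel)"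
      unfolding w_def by (subst nn_integral_cmult[symmetric]) (auto simp: mult_ac)
    finally show "(w s)\<^sup>2 = \<dots>" .
  qed
  also have "\<dots> = (\<integral>\<^sup>+y. \<integral>\<^sup>+s. \<integral>\<^sup>+y'. m y * m y' * (window (\<rho> y) y s * window (\<rho> y') y' s) \<partial>lborel \<partial>lborel \<partial>lborel)"
    by (rule lborel_pair.Fubini') measurable
  also have "\<dots> = (\<integral>\<^sup>+y. \<integral>\<^sup>+y'. \<integral>\<^sup>+s. m y * m y' * (window (\<rho> y) y s * window (\<rho> y') y' s) \<partial>lborel \<partial>lborel \<partial>lborel)"
    by (intro nn_integral_cong lborel_pair.Fubini') measurable
  also have "\<dots> \<le> (\<integral>\<^sup>+y. \<integral>\<^sup>+y'. 2 * (m y * m y' * window (2 * \<rho> y) y y') +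
      2 * (m y' * m y * window (2 * \<rho> y') y' y) \<partial>lborel \<partial>lborel)"
  proof (intro nn_integral_mono)
    fix y y'
    have "(\<integral>\<^sup>+s. window (\<rho> y) y s * window (\<rho> y') y' s \<partial>lborel) \<le> 2 * window (2 * \<rho> y) y y' + 2 * window (2 * \<rho> y') y' y"
    proof (cases "\<rho> y' \<le> \<rho> y")
      case True
      then show ?thesis using nn_integral_window_window_le[OF \<rho>0 True, of y y'] by (rule_tac order_trans) (auto simp: add_increasing2)
    next
      case False
      then show ?thesis using nn_integral_window_window_le[OF \<rho>0, of y "\<rho> y'" y' y]
        by (rule_tac order_trans) (auto simp: add_increasing mult.commute)
    qed
    then have "(\<integral>\<^sup>+s. m y * m y' * (window (\<rho> y) y s * window (\<rho> y') y' s) \<partial>lborel)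
       \<le> m y * m y' * (2 * window (2 * \<rho> y) y y' + 2 * window (2 * \<rho> y') y' y)"
      by (subst nn_integral_cmult) (auto intro: mult_left_mono)
    then show "(\<integral>\<^sup>+s. m y * m y' * (window (\<rho> y) y s * window (\<rho> y') y' s) \<partial>lborel)
       \<le> 2 * (m y * m y' * window (2 * \<rho> y) y y') + 2 * (m y' * m y * window (2 * \<rho> y') y' y)"
      by (simp add: algebra_simps)
  qed
  also have "\<dots> = 2 * B + 2 * (\<integral>\<^sup>+y. \<integral>\<^sup>+y'. m y' * m y * window (2 * \<rho> y') y' y \<partial>lborel \<partial>lborel)"
    unfolding B_def by (simp add: nn_integral_add nn_integral_cmult)
  also have "(\<integral>\<^sup>+y. \<integral>\<^sup>+y'. m y' * m y * window (2 * \<rho> y') y' y \<partial>lborel \<partial>lborel) = B"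
    unfolding B_def by (rule lborel_pair.Fubini') measurable
  also have "2 * B + 2 * B = 4 * B"
    by (simp flip: distrib_right)
  finally have w_le: "(\<integral>\<^sup>+s. (w s)\<^sup>2 \<partial>lborel) \<le> 4 * B" .
  define X2 where "X2 = (\<lambda>r. 2 * r) ` X"
  have X2: "finite X2" "card X2 \<le> n" "X2 \<noteq> {}" "X2 \<subseteq> {0<..}"
    using X card_image_le[OF X(1), of "\<lambda>r. 2 * r"] by (auto simp: X2_def)
  define m2 where "m2 y = (SUP r\<in>X2. window_avg r m y)" for y
  have [measurable]: "m2 \<in> borel_measurable borel"
    unfolding m2_def using X2(1) by (intro borel_measurable_SUP) (auto intro: countable_finite)
  have "B \<le> (\<integral>\<^sup>+y. m y * m2 y \<partial>lborel)"
  proof -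
    have "B = (\<integral>\<^sup>+y. m y * window_avg (2 * \<rho> y) m y \<partial>lborel)"
      unfolding B_def window_avg_def by (subst nn_integral_cmult[symmetric]) (auto simp: mult_ac)
    also have "\<dots> \<le> (\<integral>\<^sup>+y. m y * m2 y \<partial>lborel)"
      unfolding m2_def by (intro nn_integral_mono mult_left_mono SUP_upper) (auto simp: X2_def \<rho>)
    finally show ?thesis .
  qed
  then have "B\<^sup>2 \<le> (\<integral>\<^sup>+y. m y * m2 y \<partial>lborel)\<^sup>2"
    by (intro power_mono) auto
  also have "\<dots> \<le> S * (\<integral>\<^sup>+y. (m2 y)\<^sup>2 \<partial>lborel)"
    unfolding S_def by (rule Cauchy_Schwarz_nn_integral) auto
  also have "(\<integral>\<^sup>+y. (m2 y)\<^sup>2 \<partial>lborel) \<le> ennreal (c\<^sup>2) * S"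
    unfolding m2_def S_def by (rule bd[unfolded window_maximal_bound_def, rule_format, OF X2]) auto
  finally have B2: "B\<^sup>2 \<le> S * (ennreal (c\<^sup>2) * S)" by (simp add: mult_left_mono)
  have "(\<integral>\<^sup>+y. (SUP r\<in>X. window_avg r h y)\<^sup>2 \<partial>lborel) = S" by (simp add: S_def \<rho> m_def)
  also have "S \<le> ennreal ((2 * sqrt c)\<^sup>2) * N"
  proof (cases "N = \<infinity>")
    case True
    show ?thesis
    proof (cases "c = 0")
      case True
      then show ?thesis using S_le by simp
    next
      case False
      then show ?thesis using True \<open>c \<ge> 0\<close> by (simp add: ennreal_mult_top)
    qed
  next
    case False
    then obtain N' where N': "N = ennreal N'" "N' \<ge> 0" by (cases N) auto
    \<comment> \<open>The a priori bound matters here: \<open>S\<close> must be finite to be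
      cancelled from S * S \<le> 4 c N * S.\<close>
    have "S \<noteq> \<infinity>" using S_le N' by (auto simp: top_unique simp flip: ennreal_mult)
    then obtain S' where S': "S = ennreal S'" "S' \<ge> 0" by (cases S) auto
    have "B\<^sup>2 \<noteq> \<infinity>" using B2 S' by (auto simp: top_unique simp flip: ennreal_mult)
    then obtain B' where B': "B = ennreal B'" "B' \<ge> 0" by (cases B) auto
    have "B'\<^sup>2 \<le> (c * S')\<^sup>2"
      using B2 B' S' by (simp add: ennreal_power power2_eq_square mult_ac flip: ennreal_mult)
    then have "B' \<le> c * S'"
      using S' \<open>c \<ge> 0\<close> by (intro power2_le_imp_le[of B' "c * S'"]) auto
    have "S\<^sup>2 \<le> 4 * B * N" using S2 w_le by (meson order_trans mult_right_mono zero_le)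
    then have "S'\<^sup>2 \<le> 4 * B' * N'"
      using B' S' N' by (simp add: ennreal_power flip: ennreal_mult ennreal_numeral)
    also have "\<dots> \<le> 4 * (c * S') * N'"
      using \<open>B' \<le> c * S'\<close> N' by (simp add: mult_right_mono)
    finally have "S' * S' \<le> (4 * c * N') * S'" by (simp add: power2_eq_square mult_ac)
    then have "S' \<le> 4 * c * N'"
      using S' N' \<open>c \<ge> 0\<close> by (cases "S' = 0") auto
    then show ?thesis
      using \<open>c \<ge> 0\<close> N' S' by (simp add: power_mult_distrib flip: ennreal_mult)
  qed
  finally show "(\<integral>\<^sup>+y. (SUP r\<in>X. window_avg r h y)\<^sup>2 \<partial>lborel) \<le> ennreal ((2 * sqrt c)\<^sup>2) * (\<integral>\<^sup>+s. (h s)\<^sup>2 \<partial>lborel)"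
    by (simp add: N_def)
qed

lemma window_maximal_bound_mono:
  assumes "window_maximal_bound n c" "0 \<le> c" "c \<le> c'"
  shows "window_maximal_bound n c'"
proof -
  have "ennreal (c\<^sup>2) \<le> ennreal (c'\<^sup>2)" using assms by (intro ennreal_leI power_mono) auto
  then show ?thesis
    using assms(1) unfolding window_maximal_bound_def by (meson order_trans mult_right_mono zero_le)
qed

lemma finite_window_maximal_le:
  assumes X: "finite X" "X \<noteq> {}" "X \<subseteq> {0<..}" and h: "h \<in> borel_measurable borel"
  shows "(\<integral>\<^sup>+y. (SUP r\<in>X. window_avg r h y)\<^sup>2 \<partial>lborel) \<le> 16 * (\<integral>\<^sup>+s. (h s)\<^sup>2 \<partial>lborel)"
proof -
  define n where "n = card X"
  \<comment> \<open>4 is the fixed point of c \<mapsto> 2 sqrt c, and sqrt (1 + d) \<le> 1 + d / 2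
    halves the relative excess d at every step, starting from d = sqrt n.\<close>
  have bd: "window_maximal_bound n (4 * (1 + sqrt n / 2 ^ j))" for j
  proof (induction j)
    case 0
    show ?case by (rule window_maximal_bound_mono[OF window_maximal_bound_card]) auto
  next
    case (Suc j)
    show ?case
    proof (rule window_maximal_bound_mono[OF window_maximal_bound_step[OF Suc]])
      define d where "d = sqrt n / 2 ^ j"
      have "sqrt (4 * (1 + d)) \<le> 2 * (1 + d / 2)"
        by (rule real_le_lsqrt) (auto simp: d_def power2_eq_square algebra_simps)
      then show "2 * sqrt (4 * (1 + sqrt (real n) / 2 ^ j)) \<le> 4 * (1 + sqrt (real n) / 2 ^ Suc j)"
        by (simp add: d_def)
    qed auto
  qed
  have "(\<lambda>j. 1 / 2 ^ j :: real) \<longlonglongrightarrow> 0"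
    using LIMSEQ_realpow_zero[of "1/2 :: real"] by (simp add: power_one_over)
  from tendsto_mult_right[OF this, of "sqrt n"]
  have "(\<lambda>j. sqrt n / 2 ^ j) \<longlonglongrightarrow> 0" by (simp add: mult.commute)
  then have "(\<lambda>j. (4 * (1 + sqrt n / 2 ^ j))\<^sup>2) \<longlonglongrightarrow> (4 * (1 + 0))\<^sup>2"
    by (intro tendsto_intros)
  then have lim: "(\<lambda>j. ennreal ((4 * (1 + sqrt n / 2 ^ j))\<^sup>2)) \<longlonglongrightarrow> ennreal 16"
    by (intro tendsto_ennrealI) simp
  define N where "N = (\<integral>\<^sup>+s. (h s)\<^sup>2 \<partial>lborel)"
  show ?thesis
  proof (cases "N = \<infinity>")
    case True
    then show ?thesis by (simp add: N_def[symmetric] ennreal_mult_top)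
  next
    case False
    have "(\<lambda>j. ennreal ((4 * (1 + sqrt n / 2 ^ j))\<^sup>2) * N) \<longlonglongrightarrow> ennreal 16 * N"
      using lim False by (intro tendsto_mult_ennreal tendsto_const) auto
    moreover have "(\<integral>\<^sup>+y. (SUP r\<in>X. window_avg r h y)\<^sup>2 \<partial>lborel)
        \<le> ennreal ((4 * (1 + sqrt n / 2 ^ j))\<^sup>2) * N" for j
      using bd[of j, unfolded window_maximal_bound_def, rule_format, of X h] X h by (simp add: N_def n_def)
    ultimately have "(\<integral>\<^sup>+y. (SUP r\<in>X. window_avg r h y)\<^sup>2 \<partial>lborel) \<le> ennreal 16 * N"
      by (intro LIMSEQ_le_const) auto
    then show ?thesis by (simp add: N_def)
  qed
qed

text \<open>Rational radii keep the supremum countable and hence measurable; all real radii are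
  recovered in \<open>window_avg_le_window_maximal\<close>.\<close>

definition window_maximal :: "(real \<Rightarrow> ennreal) \<Rightarrow> real \<Rightarrow> ennreal" where
  "window_maximal h y = (SUP r\<in>\<rat> \<inter> {0<..}. window_avg r h y)"

lemma countable_pos_Rats: "countable (\<rat> \<inter> {0::real<..})"
  using countable_rat by blast

lemma measurable_window_maximal [measurable]:
  assumes [measurable]: "h \<in> borel_measurable borel"
  shows "window_maximal h \<in> borel_measurable borel"
  unfolding window_maximal_def[abs_def] by (intro borel_measurable_SUP countable_pos_Rats) auto

lemma SUP_power2_ennreal:
  fixes f :: "nat \<Rightarrow> ennreal"
  assumes "mono f"
  shows "(SUP n. f n)\<^sup>2 = (SUP n. (f n)\<^sup>2)"
proof (rule antisym)
  have "(SUP n. f n)\<^sup>2 = (SUP n. SUP m. f n * f m)"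
    by (simp add: power2_eq_square SUP_mult_left_ennreal[symmetric] SUP_mult_right_ennreal[symmetric])
  also have "\<dots> \<le> (SUP n. (f n)\<^sup>2)"
  proof (intro SUP_least)
    fix n m
    have "f n * f m \<le> (f (max n m))\<^sup>2"
      unfolding power2_eq_square using assms by (intro mult_mono) (auto simp: mono_def)
    also have "\<dots> \<le> (SUP n. (f n)\<^sup>2)" by (intro SUP_upper) auto
    finally show "f n * f m \<le> (SUP n. (f n)\<^sup>2)" .
  qed
  finally show "(SUP n. f n)\<^sup>2 \<le> (SUP n. (f n)\<^sup>2)" .
qed (auto intro!: SUP_least power_mono SUP_upper)

text \<open>The bound for finitely many radii does not depend on their number, so it survives
  monotone convergence along an enumeration of the positive rationals.\<close>

theorem window_maximal_le:
  assumes [measurable]: "h \<in> borel_measurable borel"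
  shows "(\<integral>\<^sup>+y. (window_maximal h y)\<^sup>2 \<partial>lborel) \<le> 16 * (\<integral>\<^sup>+s. (h s)\<^sup>2 \<partial>lborel)"
proof -
  define Q where "Q = from_nat_into (\<rat> \<inter> {0::real<..})"
  have ne: "\<rat> \<inter> {0::real<..} \<noteq> {}" by (auto intro: exI[of _ 1])
  have Q: "range Q = \<rat> \<inter> {0<..}"
    unfolding Q_def using ne countable_pos_Rats by (rule range_from_nat_into)
  define m where "m n y = (SUP r\<in>Q ` {..n}. window_avg r h y)" for n y
  have [measurable]: "m n \<in> borel_measurable borel" for n
    unfolding m_def[abs_def] by (intro borel_measurable_SUP) (auto intro: countable_finite)
  have mono: "mono (\<lambda>n. m n y)" for y
    unfolding m_def by (intro monoI SUP_subset_mono) auto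
  have sup: "window_maximal h y = (SUP n. m n y)" for y
  proof (rule antisym)
    show "window_maximal h y \<le> (SUP n. m n y)"
      unfolding window_maximal_def Q[symmetric]
    proof (rule SUP_least)
      fix r assume "r \<in> range Q"
      then obtain i where "r = Q i" by auto
      then have "window_avg r h y \<le> m i y" unfolding m_def by (intro SUP_upper) auto
      also have "\<dots> \<le> (SUP n. m n y)" by (intro SUP_upper) auto
      finally show "window_avg r h y \<le> (SUP n. m n y)" .
    qed
    show "(SUP n. m n y) \<le> window_maximal h y"
      unfolding window_maximal_def Q[symmetric] m_def
      by (intro SUP_least) (auto intro!: SUP_upper)
  qed
  have "(\<integral>\<^sup>+y. (window_maximal h y)\<^sup>2 \<partial>lborel) = (\<integral>\<^sup>+y. (SUP n. (m n y)\<^sup>2) \<partial>lborel)"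
    by (simp add: sup SUP_power2_ennreal[OF mono])
  also have "\<dots> = (SUP n. \<integral>\<^sup>+y. (m n y)\<^sup>2 \<partial>lborel)"
    using mono by (intro nn_integral_monotone_convergence_SUP) (auto simp: mono_def le_fun_def intro: power_mono)
  also have "\<dots> \<le> 16 * (\<integral>\<^sup>+s. (h s)\<^sup>2 \<partial>lborel)"
    unfolding m_def using Q by (intro SUP_least finite_window_maximal_le) auto
  finally show ?thesis .
qed

text \<open>Widening the window to a rational radius q \<ge> r costs the factor q / r, which tends
  to 1 as q tends to r. The limit is taken where the maximal function is finite; elsewhere the claim
  is trivial.\<close>

lemma window_avg_le_window_maximal:
  assumes "r > 0" and [measurable]: "h \<in> borel_measurable borel"
  shows "window_avg r h y \<le> window_maximal h y"
proof (cases "window_maximal h y = \<infinity>")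
  case False
  have le: "window_avg r h y \<le> ennreal (q / r) * window_maximal h y" if q: "q \<in> \<rat>" "q \<ge> r" for q
  proof -
    have "window r y s \<le> ennreal (q / r) * window q y s" for s
      using \<open>r > 0\<close> q by (auto simp: window_def indicator_def ennreal_mult[symmetric])
    then have "window r y s * h s \<le> ennreal (q / r) * (window q y s * h s)" for s
      by (metis mult.assoc mult_right_mono zero_le)
    then have "window_avg r h y \<le> ennreal (q / r) * window_avg q h y"
      unfolding window_avg_def by (subst nn_integral_cmult[symmetric]) (auto intro: nn_integral_mono)
    also have "window_avg q h y \<le> window_maximal h y"
      unfolding window_maximal_def using q \<open>r > 0\<close> by (intro SUP_upper) auto
    finally show ?thesis by (simp add: mult_left_mono)
  qed
  have "\<exists>q\<in>\<rat>. r < q \<and> q < r + 1 / real (Suc n)" for n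
    by (rule Rats_dense_in_real) simp
  then obtain q where q: "\<And>n. q n \<in> \<rat>" "\<And>n. r < q n" "\<And>n. q n < r + 1 / real (Suc n)" by metis
  have "q \<longlonglongrightarrow> r"
  proof (rule tendsto_sandwich[of "\<lambda>_. r" _ _ "\<lambda>n. r + 1 / real (Suc n)"])
    show "(\<lambda>n. r + 1 / real (Suc n)) \<longlonglongrightarrow> r"
      using tendsto_add[OF tendsto_const LIMSEQ_inverse_real_of_nat, of r] by (simp add: inverse_eq_divide)
  qed (use q in \<open>auto intro!: always_eventually intro: less_imp_le simp del: of_nat_Suc\<close>)
  then have "(\<lambda>n. q n / r) \<longlonglongrightarrow> r / r" using \<open>r > 0\<close> by (intro tendsto_intros) auto
  then have "(\<lambda>n. ennreal (q n / r)) \<longlonglongrightarrow> ennreal 1" using \<open>r > 0\<close> by (intro tendsto_ennrealI) simp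
  then have "(\<lambda>n. ennreal (q n / r) * window_maximal h y) \<longlonglongrightarrow> ennreal 1 * window_maximal h y"
    using False by (intro tendsto_mult_ennreal tendsto_const) auto
  then have "window_avg r h y \<le> ennreal 1 * window_maximal h y"
    by (rule LIMSEQ_le_const) (use le q in \<open>blast intro: less_imp_le\<close>)
  then show ?thesis by simp
qed simp

section \<open>Plancherel's inequality\<close>

text \<open>Sign and normalisation are those of the characteristic function \<open>char\<close>.
  Hence Plancherel carries 2 pi, and the boundary value of \<open>laplace f\<close> at the point i y
  is \<open>fourier f (- y)\<close>.\<close>

definition fourier :: "(real \<Rightarrow> complex) \<Rightarrow> real \<Rightarrow> complex" where
  "fourier f s = (\<integral>t. iexp (s * t) * f t \<partial>lborel)"

text \<open>True for every \<open>f\<close>, because the Bochner integral of a non-integrable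
  function is 0.\<close>

lemma ennreal_norm_integral_le:
  fixes f :: "'a \<Rightarrow> 'b :: {banach, second_countable_topology}"
  shows "ennreal (norm (integral\<^sup>L M f)) \<le> (\<integral>\<^sup>+x. norm (f x) \<partial>M)"
  by (cases "integrable M f") (auto intro: integral_norm_bound_ennreal simp: not_integrable_integral_eq)

lemma integrable_iexp_mult:
  assumes [measurable]: "integrable lborel f" "g \<in> borel_measurable borel"
  shows "integrable lborel (\<lambda>t::real. iexp (g t) * f t)"
  by (rule Bochner_Integration.integrable_bound[OF assms(1)]) (auto simp: norm_mult)

lemma measurable_fourier [measurable]:
  assumes "integrable lborel f"
  shows "fourier f \<in> borel_measurable borel"
proof -
  have [measurable]: "f \<in> borel_measurable borel" using assms by auto
  show ?thesis unfolding fourier_def by measurable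
qed

lemma norm_fourier_le:
  assumes "integrable lborel f"
  shows "norm (fourier f s) \<le> (\<integral>t. norm (f t) \<partial>lborel)"
proof -
  have "norm (fourier f s) \<le> (\<integral>t. norm (iexp (s * t) * f t) \<partial>lborel)"
    unfolding fourier_def by (rule integral_norm_bound)
  then show ?thesis by (simp add: norm_mult)
qed

lemma integrable_fourier_mult:
  assumes "integrable lborel f" "integrable lborel g"
  shows "integrable lborel (\<lambda>s. fourier f s * g s)"
proof (rule Bochner_Integration.integrable_bound)
  show "integrable lborel (\<lambda>s. (\<integral>t. norm (f t) \<partial>lborel) * norm (g s))"
    using assms by simp
  show "(\<lambda>s. fourier f s * g s) \<in> borel_measurable lborel"
    using assms(2) measurable_fourier[OF assms(1)] by simp
  show "AE s in lborel. norm (fourier f s * g s) \<le> norm ((\<integral>t. norm (f t) \<partial>lborel) * norm (g s))"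
    using norm_fourier_le[OF assms(1)] by (auto simp: norm_mult intro!: mult_right_mono)
qed

text \<open>Fubini. Pairing with explicit kernels through this identity takes the place of a general
  Fourier inversion theorem.\<close>

lemma fourier_multiplication_formula:
  assumes f: "integrable lborel f" and g: "integrable lborel g"
  shows "(\<integral>s. fourier f s * g s \<partial>lborel) = (\<integral>t. f t * fourier g t \<partial>lborel)"
proof -
  have [measurable]: "f \<in> borel_measurable borel" "g \<in> borel_measurable borel" using f g by auto
  have int: "integrable (lborel \<Otimes>\<^sub>M lborel) (\<lambda>(s, t). iexp (s * t) * f t * g s)"
  proof (rule lborel_pair.Fubini_integrable)
    have "(\<integral>t. norm (iexp (s * t) * f t * g s) \<partial>lborel) = (\<integral>t. norm (f t) \<partial>lborel) * norm (g s)" for s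
      by (simp add: norm_mult)
    then show "integrable lborel (\<lambda>s. \<integral>t. norm (case (s, t) of (s, t) \<Rightarrow> iexp (s * t) * f t * g s) \<partial>lborel)"
      using g by simp
    have "integrable lborel (\<lambda>t. iexp (s * t) * f t)" for s
      using f by (rule integrable_iexp_mult) simp
    then show "AE s in lborel. integrable lborel (\<lambda>t. case (s, t) of (s, t) \<Rightarrow> iexp (s * t) * f t * g s)"
      by simp
  qed measurable
  have "(\<integral>s. fourier f s * g s \<partial>lborel) = (\<integral>s. \<integral>t. iexp (s * t) * f t * g s \<partial>lborel \<partial>lborel)"
    using f by (simp add: fourier_def integrable_iexp_mult)
  also have "\<dots> = (\<integral>t. \<integral>s. iexp (s * t) * f t * g s \<partial>lborel \<partial>lborel)"
    using lborel_pair.Fubini_integral[OF int] by simp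
  also have "\<dots> = (\<integral>t. f t * fourier g t \<partial>lborel)"
  proof (rule Bochner_Integration.integral_cong[OF refl])
    fix t
    have "(\<integral>s. iexp (s * t) * f t * g s \<partial>lborel) = (\<integral>s. f t * (iexp (t * s) * g s) \<partial>lborel)"
      by (simp add: mult_ac)
    also have "\<dots> = f t * fourier g t"
      unfolding fourier_def by (rule integral_mult_right_zero)
    finally show "(\<integral>s. iexp (s * t) * f t * g s \<partial>lborel) = f t * fourier g t" .
  qed
  finally show ?thesis .
qed

lemma fourier_modulate: "fourier (\<lambda>t. iexp (a * t) * f t) s = fourier f (s + a)"
  unfolding fourier_def
  by (intro Bochner_Integration.integral_cong) (auto simp: algebra_simps simp flip: exp_add)

lemma integrable_gaussian:
  fixes \<sigma> :: real assumes "\<sigma> > 0"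
  shows "integrable lborel (\<lambda>s. exp (- (\<sigma>\<^sup>2 * s\<^sup>2 / 2)))"
proof -
  have "integrable lborel (\<lambda>s. sqrt (2 * pi * (1 / \<sigma>)\<^sup>2) * normal_density 0 (1 / \<sigma>) s)"
    using assms by (intro integrable_mult_right integrable_normal_density) simp
  then show ?thesis using assms by (simp add: normal_density_def power_divide field_simps)
qed

text \<open>Rescaling by \<sigma> leads to the characteristic function of the standard normal law.
  The result has mass 2 pi and concentrates at 0 as \<sigma> tends to 0: an approximate
  identity.\<close>

lemma fourier_gaussian:
  fixes \<sigma> :: real assumes "\<sigma> > 0"
  shows "fourier (\<lambda>s. of_real (exp (- (\<sigma>\<^sup>2 * s\<^sup>2 / 2)))) t = of_real (2 * pi * normal_density 0 \<sigma> t)"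
proof -
  have "fourier (\<lambda>s. of_real (exp (- (\<sigma>\<^sup>2 * s\<^sup>2 / 2)))) t
      = \<bar>1 / \<sigma>\<bar> *\<^sub>R (\<integral>x. iexp (t * (0 + 1 / \<sigma> * x)) * of_real (exp (- (\<sigma>\<^sup>2 * (0 + 1 / \<sigma> * x)\<^sup>2 / 2))) \<partial>lborel)"
    unfolding fourier_def using assms by (intro lborel_integral_real_affine) auto
  also have "(\<integral>x. iexp (t * (0 + 1 / \<sigma> * x)) * of_real (exp (- (\<sigma>\<^sup>2 * (0 + 1 / \<sigma> * x)\<^sup>2 / 2))) \<partial>lborel)
      = (\<integral>x. sqrt (2 * pi) *\<^sub>R (std_normal_density x *\<^sub>R iexp (t / \<sigma> * x)) \<partial>lborel)"
    using assms
    by (intro Bochner_Integration.integral_cong)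
       (auto simp: std_normal_density_def power_mult_distrib power_divide scaleR_conv_of_real field_simps)
  also have "\<dots> = sqrt (2 * pi) *\<^sub>R char std_normal_distribution (t / \<sigma>)"
    unfolding char_def integral_scaleR_right by (subst integral_density) auto
  also have "\<dots> = of_real (sqrt (2 * pi) * exp (- ((t / \<sigma>)\<^sup>2) / 2))"
    by (simp add: char_std_normal_distribution scaleR_conv_of_real)
  finally show ?thesis
    using assms by (simp add: normal_density_def scaleR_conv_of_real power_divide real_sqrt_mult field_simps
        flip: of_real_mult of_real_divide)
qed

text \<open>With a Gaussian factor on the frequency side, the multiplication formula bounds the
  left-hand side by a double integral of |f(t)| |f(u)| against the nonnegative kernel
  \<open>k (t - u)\<close> of mass 2 pi. Fatou's lemma then removes the Gaussian, which yields the
  inequality and not the identity.\<close>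

theorem plancherel_le:
  assumes f: "integrable lborel f"
  shows "(\<integral>\<^sup>+s. ennreal ((norm (fourier f s))\<^sup>2) \<partial>lborel) \<le> ennreal (2 * pi) * (\<integral>\<^sup>+t. ennreal ((norm (f t))\<^sup>2) \<partial>lborel)"
proof -
  have [measurable]: "f \<in> borel_measurable borel" "fourier f \<in> borel_measurable borel"
    using f by (auto intro: measurable_fourier)
  define N where "N = (\<integral>\<^sup>+t. ennreal ((norm (f t))\<^sup>2) \<partial>lborel)"
  have reg: "(\<integral>\<^sup>+s. ennreal ((norm (fourier f s))\<^sup>2 * exp (- (\<sigma>\<^sup>2 * s\<^sup>2 / 2))) \<partial>lborel) \<le> ennreal (2 * pi) * N"
    if "\<sigma> > 0" for \<sigma> :: real
  proof -
    define g where "g s = complex_of_real (exp (- (\<sigma>\<^sup>2 * s\<^sup>2 / 2)))" for s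
    have g: "integrable lborel g"
      unfolding g_def using integrable_gaussian[OF that] by simp
    define k where "k t = 2 * pi * normal_density 0 \<sigma> t" for t
    have k: "fourier g t = of_real (k t)" for t
      unfolding g_def k_def by (rule fourier_gaussian[OF that])
    have k0: "k t \<ge> 0" for t by (simp add: k_def)
    have [measurable]: "k \<in> borel_measurable borel" unfolding k_def by measurable
    have k1: "(\<integral>\<^sup>+t. ennreal (k (a - t)) \<partial>lborel) = ennreal (2 * pi)" for a
    proof -
      have "(\<integral>\<^sup>+t. ennreal (k (a - t)) \<partial>lborel) = (\<integral>\<^sup>+t. ennreal (k t) \<partial>lborel)"
        by (subst nn_integral_real_affine[where c = "-1" and t = a]) auto
      also have "\<dots> = ennreal (\<integral>t. k t \<partial>lborel)"
        using k0 that by (intro nn_integral_eq_integral) (auto simp: k_def)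
      finally show ?thesis using that by (simp add: k_def)
    qed
    have ksym: "k (- t) = k t" for t by (simp add: k_def normal_density_def)
    \<comment> \<open>The reflected conjugate, whose transform is the conjugate of that of
      \<open>f\<close>; it turns |\<open>fourier f\<close>|^2 into a product of two
      transforms.\<close>
    define f' where "f' t = cnj (f (- t))" for t
    have f': "integrable lborel f'"
      unfolding f'_def using lborel_integrable_real_affine[of "\<lambda>t. cnj (f t)" "-1" 0] f by simp
    have cf: "cnj (fourier f s) = fourier f' s" for s
    proof -
      have "fourier f' s = (\<integral>t. iexp (s * (0 + (-1) * t)) * f' (0 + (-1) * t) \<partial>lborel)"
        unfolding fourier_def by (subst lborel_integral_real_affine[where c = "-1" and t = 0]) auto
      moreover have "cnj (fourier f s) = (\<integral>t. cnj (iexp (s * t) * f t) \<partial>lborel)"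
        unfolding fourier_def by (rule Bochner_Integration.integral_cnj[symmetric])
      ultimately show ?thesis by (simp add: f'_def exp_cnj)
    qed
    have i1: "integrable lborel (\<lambda>s. fourier f' s * g s)"
      by (rule integrable_fourier_mult[OF f' g])
    have inner: "norm (fourier (\<lambda>s. fourier f' s * g s) t) \<le> (\<integral>\<^sup>+u. ennreal (norm (f u) * k (t - u)) \<partial>lborel)" for t
    proof -
      have "fourier (\<lambda>s. fourier f' s * g s) t = (\<integral>s. fourier f' s * (iexp (t * s) * g s) \<partial>lborel)"
        unfolding fourier_def[of "\<lambda>s. fourier f' s * g s"] by (simp add: mult_ac)
      also have "\<dots> = (\<integral>u. f' u * fourier (\<lambda>s. iexp (t * s) * g s) u \<partial>lborel)"
        by (rule fourier_multiplication_formula[OF f' integrable_iexp_mult[OF g]]) simp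
      also have "\<dots> = (\<integral>u. f' u * of_real (k (u + t)) \<partial>lborel)"
        by (simp only: fourier_modulate k)
      finally have "ennreal (norm (fourier (\<lambda>s. fourier f' s * g s) t))
          \<le> (\<integral>\<^sup>+u. ennreal (norm (f' u * of_real (k (u + t)))) \<partial>lborel)"
        by (simp add: ennreal_norm_integral_le)
      also have "\<dots> = (\<integral>\<^sup>+u. ennreal (norm (f u) * k (t - u)) \<partial>lborel)"
        by (subst nn_integral_real_affine[where c = "-1" and t = 0])
           (auto simp: f'_def norm_mult k0 algebra_simps)
      finally show ?thesis .
    qed
    have eq: "complex_of_real ((norm (fourier f s))\<^sup>2 * exp (- (\<sigma>\<^sup>2 * s\<^sup>2 / 2))) = fourier f s * (fourier f' s * g s)" for s
      by (simp add: g_def cf[symmetric] complex_norm_square[symmetric] flip: mult.assoc)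
    have i2: "integrable lborel (\<lambda>s. fourier f s * (fourier f' s * g s))"
      by (rule integrable_fourier_mult[OF f i1])
    then have "integrable lborel (\<lambda>s. complex_of_real ((norm (fourier f s))\<^sup>2 * exp (- (\<sigma>\<^sup>2 * s\<^sup>2 / 2))))"
      by (simp only: eq)
    then have i3: "integrable lborel (\<lambda>s. (norm (fourier f s))\<^sup>2 * exp (- (\<sigma>\<^sup>2 * s\<^sup>2 / 2)))"
      unfolding complex_of_real_integrable_eq .
    have "(\<integral>\<^sup>+s. ennreal ((norm (fourier f s))\<^sup>2 * exp (- (\<sigma>\<^sup>2 * s\<^sup>2 / 2))) \<partial>lborel)
        = ennreal (\<integral>s. (norm (fourier f s))\<^sup>2 * exp (- (\<sigma>\<^sup>2 * s\<^sup>2 / 2)) \<partial>lborel)"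
      by (rule nn_integral_eq_integral[OF i3]) auto
    also have "\<dots> \<le> ennreal (norm (\<integral>s. fourier f s * (fourier f' s * g s) \<partial>lborel))"
    proof -
      have "(\<integral>s. fourier f s * (fourier f' s * g s) \<partial>lborel) =
          complex_of_real (\<integral>s. (norm (fourier f s))\<^sup>2 * exp (- (\<sigma>\<^sup>2 * s\<^sup>2 / 2)) \<partial>lborel)"
        unfolding eq[symmetric] by (rule integral_complex_of_real)
      then show ?thesis by (simp add: ennreal_leI)
    qed
    also have "\<dots> = ennreal (norm (\<integral>t. f t * fourier (\<lambda>s. fourier f' s * g s) t \<partial>lborel))"
      by (subst fourier_multiplication_formula[OF f i1]) simp
    also have "\<dots> \<le> (\<integral>\<^sup>+t. ennreal (norm (f t * fourier (\<lambda>s. fourier f' s * g s) t)) \<partial>lborel)"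
      by (rule ennreal_norm_integral_le)
    also have "\<dots> \<le> (\<integral>\<^sup>+t. ennreal (norm (f t)) * (\<integral>\<^sup>+u. ennreal (norm (f u) * k (t - u)) \<partial>lborel) \<partial>lborel)"
      using inner by (intro nn_integral_mono) (auto simp: norm_mult ennreal_mult' intro: mult_left_mono)
    also have "\<dots> = (\<integral>\<^sup>+t. \<integral>\<^sup>+u. ennreal (norm (f t) * norm (f u) * k (t - u)) \<partial>lborel \<partial>lborel)"
      by (subst nn_integral_cmult[symmetric]) (auto simp: ennreal_mult' k0 mult_ac)
    \<comment> \<open>|f(t)| |f(u)| \<le> (|f(t)|^2 + |f(u)|^2) / 2 splits the double integral.
      Writing the kernel of the second part as \<open>k (u - t)\<close> lets Fubini identify it with
      the first.\<close>
    also have "\<dots> \<le> (\<integral>\<^sup>+t. \<integral>\<^sup>+u. ennreal ((norm (f t))\<^sup>2 / 2) * ennreal (k (t - u)) +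
        ennreal ((norm (f u))\<^sup>2 / 2) * ennreal (k (u - t)) \<partial>lborel \<partial>lborel)"
    proof (intro nn_integral_mono)
      fix t u
      have "norm (f t) * norm (f u) \<le> (norm (f t))\<^sup>2 / 2 + (norm (f u))\<^sup>2 / 2"
        using sum_squares_bound[of "norm (f t)" "norm (f u)"] by simp
      then have "norm (f t) * norm (f u) * k (t - u) \<le> (norm (f t))\<^sup>2 / 2 * k (t - u) + (norm (f u))\<^sup>2 / 2 * k (u - t)"
        using mult_right_mono[OF _ k0[of "t - u"]] ksym[of "t - u"] by (fastforce simp: distrib_right)
      then show "ennreal (norm (f t) * norm (f u) * k (t - u)) \<le> ennreal ((norm (f t))\<^sup>2 / 2) * ennreal (k (t - u)) +
        ennreal ((norm (f u))\<^sup>2 / 2) * ennreal (k (u - t))"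
        using k0 by (simp add: ennreal_leI flip: ennreal_mult ennreal_plus)
    qed
    also have "\<dots> = (\<integral>\<^sup>+t. \<integral>\<^sup>+u. ennreal ((norm (f t))\<^sup>2 / 2) * ennreal (k (t - u)) \<partial>lborel \<partial>lborel) +
      (\<integral>\<^sup>+t. \<integral>\<^sup>+u. ennreal ((norm (f u))\<^sup>2 / 2) * ennreal (k (u - t)) \<partial>lborel \<partial>lborel)"
      by (simp add: nn_integral_add)
    also have "(\<integral>\<^sup>+t. \<integral>\<^sup>+u. ennreal ((norm (f u))\<^sup>2 / 2) * ennreal (k (u - t)) \<partial>lborel \<partial>lborel)
      = (\<integral>\<^sup>+t. \<integral>\<^sup>+u. ennreal ((norm (f t))\<^sup>2 / 2) * ennreal (k (t - u)) \<partial>lborel \<partial>lborel)"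
      by (rule lborel_pair.Fubini') measurable
    also have "(\<integral>\<^sup>+t. \<integral>\<^sup>+u. ennreal ((norm (f t))\<^sup>2 / 2) * ennreal (k (t - u)) \<partial>lborel \<partial>lborel)
      = (\<integral>\<^sup>+t. ennreal ((norm (f t))\<^sup>2 / 2) * ennreal (2 * pi) \<partial>lborel)"
      by (subst nn_integral_cmult) (auto simp: k1)
    also have "\<dots> + \<dots> = (\<integral>\<^sup>+t. ennreal ((norm (f t))\<^sup>2 / 2) * ennreal (2 * pi) + ennreal ((norm (f t))\<^sup>2 / 2) * ennreal (2 * pi) \<partial>lborel)"
      by (subst nn_integral_add) auto
    also have "\<dots> = (\<integral>\<^sup>+t. ennreal (2 * pi) * ennreal ((norm (f t))\<^sup>2) \<partial>lborel)"
      by (intro nn_integral_cong) (simp flip: ennreal_mult ennreal_plus)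
    also have "\<dots> = ennreal (2 * pi) * N"
      unfolding N_def by (subst nn_integral_cmult) auto
    finally show ?thesis .
  qed
  define \<sigma> where "\<sigma> n = 1 / real (Suc n)" for n
  have \<sigma>: "\<sigma> n > 0" for n by (simp add: \<sigma>_def)
  have \<sigma>0: "\<sigma> \<longlonglongrightarrow> 0"
    unfolding \<sigma>_def using LIMSEQ_inverse_real_of_nat by (simp add: inverse_eq_divide)
  have "(\<integral>\<^sup>+s. ennreal ((norm (fourier f s))\<^sup>2) \<partial>lborel)
     = (\<integral>\<^sup>+s. liminf (\<lambda>n. ennreal ((norm (fourier f s))\<^sup>2 * exp (- ((\<sigma> n)\<^sup>2 * s\<^sup>2 / 2)))) \<partial>lborel)"
  proof (rule nn_integral_cong)
    fix s
    have "(\<lambda>n. (norm (fourier f s))\<^sup>2 * exp (- ((\<sigma> n)\<^sup>2 * s\<^sup>2 / 2)))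
        \<longlonglongrightarrow> (norm (fourier f s))\<^sup>2 * exp (- (0\<^sup>2 * s\<^sup>2 / 2))"
      by (intro tendsto_intros \<sigma>0) simp
    then have "(\<lambda>n. ennreal ((norm (fourier f s))\<^sup>2 * exp (- ((\<sigma> n)\<^sup>2 * s\<^sup>2 / 2)))) \<longlonglongrightarrow> ennreal ((norm (fourier f s))\<^sup>2)"
      by (intro tendsto_ennrealI) simp
    then show "ennreal ((norm (fourier f s))\<^sup>2) = liminf (\<lambda>n. ennreal ((norm (fourier f s))\<^sup>2 * exp (- ((\<sigma> n)\<^sup>2 * s\<^sup>2 / 2))))"
      by (rule lim_imp_Liminf[OF trivial_limit_sequentially, symmetric])
  qed
  also have "\<dots> \<le> liminf (\<lambda>n. \<integral>\<^sup>+s. ennreal ((norm (fourier f s))\<^sup>2 * exp (- ((\<sigma> n)\<^sup>2 * s\<^sup>2 / 2))) \<partial>lborel)"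
    by (rule nn_integral_liminf) measurable
  also have "\<dots> \<le> ennreal (2 * pi) * N"
    using reg[OF \<sigma>] by (intro Liminf_le) auto
  finally show ?thesis by (simp add: N_def)
qed

section \<open>The Poisson kernel\<close>

definition poisson :: "real \<Rightarrow> real \<Rightarrow> real" where
  "poisson x u = x / (pi * (x\<^sup>2 + u\<^sup>2))"

lemma measurable_poisson [measurable]: "poisson x \<in> borel_measurable borel"
  unfolding poisson_def[abs_def] by measurable

lemma poisson_nonneg: "x \<ge> 0 \<Longrightarrow> 0 \<le> poisson x u"
  by (simp add: poisson_def)

lemma poisson_minus [simp]: "poisson x (- u) = poisson x u"
  by (simp add: poisson_def)

text \<open>The Poisson kernel is a superposition of normalised indicators of centred intervals.\<close>

lemma poisson_le_window_maximal:
  assumes x: "x > 0" and [measurable]: "h \<in> borel_measurable borel"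
  shows "(\<integral>\<^sup>+s. ennreal (poisson x (y - s)) * h s \<partial>lborel) \<le> window_maximal h y"
proof -
  have pos: "x\<^sup>2 + r\<^sup>2 > 0" "pi * (x\<^sup>2 + r\<^sup>2) \<noteq> 0" for r using x by (auto intro: add_pos_nonneg simp: add_nonneg_eq_0_iff)
  \<comment> \<open>Minus the derivative of \<open>poisson x\<close>, so that the kernel at u is the
    integral of \<open>q\<close> over all radii r \<ge> |u|.\<close>
  define q where "q r = 2 * x * r / (pi * (x\<^sup>2 + r\<^sup>2)\<^sup>2)" for r
  have [measurable]: "q \<in> borel_measurable borel" unfolding q_def by measurable
  have q0: "0 \<le> q r" if "r \<ge> 0" for r using x that by (simp add: q_def)
  have sup: "ennreal (poisson x u) = (\<integral>\<^sup>+r. ennreal (q r) * indicator {- r..r} u \<partial>lborel)" for u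
  proof -
    have "((\<lambda>r. - (x / (pi * (x\<^sup>2 + r\<^sup>2)))) \<longlongrightarrow> 0) at_top" using x by real_asymp
    moreover have "((\<lambda>r. - (x / (pi * (x\<^sup>2 + r\<^sup>2)))) has_real_derivative q r) (at r)" for r
      using pos[of r] x unfolding q_def
      by (auto intro!: derivative_eq_intros simp: power2_eq_square divide_simps)
    ultimately have "(\<integral>\<^sup>+r. ennreal (q r) * indicator {\<bar>u\<bar>..} r \<partial>lborel) = ennreal (0 - - (x / (pi * (x\<^sup>2 + \<bar>u\<bar>\<^sup>2))))"
      by (intro nn_integral_FTC_atLeast) (auto simp: q0)
    then have "ennreal (poisson x u) = (\<integral>\<^sup>+r. ennreal (q r) * indicator {\<bar>u\<bar>..} r \<partial>lborel)"
      by (simp add: poisson_def)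
    also have "\<dots> = (\<integral>\<^sup>+r. ennreal (q r) * indicator {- r..r} u \<partial>lborel)"
      by (intro nn_integral_cong) (auto simp: indicator_def)
    finally show ?thesis .
  qed
  \<comment> \<open>Normalising an interval of length 2 r multiplies its weight by 2 r. The
    antiderivative used below comes from integration by parts: twice the integral of the kernel
    minus 2 r times the kernel.\<close>
  have mass: "(\<integral>\<^sup>+r. ennreal (q r * (2 * r)) * indicator {0..} r \<partial>lborel) = 1"
  proof -
    have "((\<lambda>r. 2 / pi * arctan (r / x) - 2 * x * r / (pi * (x\<^sup>2 + r\<^sup>2))) \<longlongrightarrow> 1) at_top"
      using x by real_asymp
    moreover have "((\<lambda>r. 2 / pi * arctan (r / x) - 2 * x * r / (pi * (x\<^sup>2 + r\<^sup>2))) has_real_derivative q r * (2 * r)) (at r)" for r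
    proof -
      have [simp]: "1 + (r / x)\<^sup>2 = (x\<^sup>2 + r\<^sup>2) / x\<^sup>2" using x by (simp add: field_simps power2_eq_square)
      have "((\<lambda>r. 2 / pi * arctan (r / x) - 2 * x * r / (pi * (x\<^sup>2 + r\<^sup>2))) has_real_derivative
          2 / pi * (inverse ((x\<^sup>2 + r\<^sup>2) / x\<^sup>2) * (1 / x)) -
          (2 * x * (pi * (x\<^sup>2 + r\<^sup>2)) - 2 * x * r * (pi * (2 * r))) / (pi * (x\<^sup>2 + r\<^sup>2) * (pi * (x\<^sup>2 + r\<^sup>2)))) (at r)"
        using pos[of r] x by (auto intro!: derivative_eq_intros simp: mult_ac)
      also have "2 / pi * (inverse ((x\<^sup>2 + r\<^sup>2) / x\<^sup>2) * (1 / x)) -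
          (2 * x * (pi * (x\<^sup>2 + r\<^sup>2)) - 2 * x * r * (pi * (2 * r))) / (pi * (x\<^sup>2 + r\<^sup>2) * (pi * (x\<^sup>2 + r\<^sup>2))) = q r * (2 * r)"
      proof -
        define d where "d = x\<^sup>2 + r\<^sup>2"
        have d: "d \<noteq> 0" unfolding d_def using pos(1)[of r] by linarith
        show ?thesis unfolding q_def d_def[symmetric] using x d by (simp add: divide_simps power2_eq_square)
      qed
      finally show ?thesis .
    qed
    ultimately have "(\<integral>\<^sup>+r. ennreal (q r * (2 * r)) * indicator {0..} r \<partial>lborel) =
        ennreal (1 - (2 / pi * arctan (0 / x) - 2 * x * 0 / (pi * (x\<^sup>2 + 0\<^sup>2))))"
      by (intro nn_integral_FTC_atLeast) (auto simp: q0)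
    then show ?thesis by simp
  qed
  have "(\<integral>\<^sup>+s. ennreal (poisson x (y - s)) * h s \<partial>lborel)
      = (\<integral>\<^sup>+s. \<integral>\<^sup>+r. ennreal (q r) * (indicator {- r..r} (y - s) * h s) \<partial>lborel \<partial>lborel)"
  proof (rule nn_integral_cong)
    fix s
    have [measurable]: "(\<lambda>r. indicator {- r..r} (y - s) :: ennreal) \<in> borel_measurable borel"
    proof -
      have "(\<lambda>r. indicator {- r..r} (y - s) :: ennreal) = indicator {\<bar>y - s\<bar>..}"
        by (auto simp: indicator_def fun_eq_iff)
      then show ?thesis by simp
    qed
    show "ennreal (poisson x (y - s)) * h s = (\<integral>\<^sup>+r. ennreal (q r) * (indicator {- r..r} (y - s) * h s) \<partial>lborel)"
      unfolding sup by (subst nn_integral_multc[symmetric]) (auto simp: mult_ac)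
  qed
  also have "\<dots> = (\<integral>\<^sup>+r. \<integral>\<^sup>+s. ennreal (q r) * (indicator {- r..r} (y - s) * h s) \<partial>lborel \<partial>lborel)"
  proof (rule lborel_pair.Fubini')
    have "(\<lambda>(r, s). ennreal (q r) * (indicator {- r..r} (y - s) * h s)) =
      (\<lambda>(r, s). if - r \<le> y - s \<and> y - s \<le> r then ennreal (q r) * h s else 0)"
      by (auto simp: indicator_def fun_eq_iff)
    then show "(\<lambda>(r, s). ennreal (q r) * (indicator {- r..r} (y - s) * h s)) \<in> borel_measurable (lborel \<Otimes>\<^sub>M lborel)"
      by simp
  qed
  also have "\<dots> \<le> (\<integral>\<^sup>+r. ennreal (q r * (2 * r)) * indicator {0..} r * window_maximal h y \<partial>lborel)"
  proof (rule nn_integral_mono)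
    fix r :: real
    show "(\<integral>\<^sup>+s. ennreal (q r) * (indicator {- r..r} (y - s) * h s) \<partial>lborel)
        \<le> ennreal (q r * (2 * r)) * indicator {0..} r * window_maximal h y"
    proof (cases "r > 0")
      case True
      have "ennreal (2 * r) * window r y s = indicator {- r..r} (y - s)" for s
        unfolding window_def mult.assoc[symmetric] using True by (simp flip: ennreal_mult)
      then have "indicator {- r..r} (y - s) * h s = ennreal (2 * r) * (window r y s * h s)" for s
        by (metis mult.assoc)
      then have "(\<integral>\<^sup>+s. ennreal (q r) * (indicator {- r..r} (y - s) * h s) \<partial>lborel)
          = ennreal (q r) * (ennreal (2 * r) * window_avg r h y)"
        unfolding window_avg_def by (simp add: nn_integral_cmult)
      also have "\<dots> \<le> ennreal (q r) * (ennreal (2 * r) * window_maximal h y)"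
        using True by (intro mult_left_mono window_avg_le_window_maximal) auto
      finally show ?thesis using True by (simp add: ennreal_mult q0 mult.assoc)
    next
      case False
      then consider "r = 0" | "r < 0" by linarith
      then show ?thesis
      proof cases
        case 1
        then show ?thesis by (simp add: q_def)
      next
        case 2
        then show ?thesis by simp
      qed
    qed
  qed
  also have "\<dots> = window_maximal h y"
    by (subst nn_integral_multc) (auto simp: mass)
  finally show ?thesis .
qed

lemma integrable_exp_neg:
  fixes x :: real assumes "x > 0"
  shows "integrable lborel (\<lambda>t. indicator {0..} t *\<^sub>R exp (- (x * t)))"
proof (rule integrableI_bounded)
  have "((\<lambda>t. - (exp (- (x * t)) / x)) \<longlongrightarrow> 0) at_top" using assms by real_asymp
  then have "(\<integral>\<^sup>+t. ennreal (exp (- (x * t))) * indicator {0..} t \<partial>lborel) = ennreal (0 - (- (exp (- (x * 0)) / x)))"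
    using assms by (intro nn_integral_FTC_atLeast) (auto intro!: derivative_eq_intros)
  moreover have "(\<integral>\<^sup>+t. ennreal (norm (indicator {0..} t *\<^sub>R exp (- (x * t)))) \<partial>lborel)
      = (\<integral>\<^sup>+t. ennreal (exp (- (x * t))) * indicator {0..} t \<partial>lborel)"
    by (intro nn_integral_cong) (auto simp: indicator_def)
  ultimately show "(\<integral>\<^sup>+t. ennreal (norm (indicator {0..} t *\<^sub>R exp (- (x * t)))) \<partial>lborel) < \<infinity>" by simp
qed simp

lemma integral_exp_half_line:
  assumes "Re w > 0"
  shows "(\<integral>t. indicator {0..} t *\<^sub>R exp (- (w * of_real t)) \<partial>lborel) = 1 / w"
proof -
  have w: "w \<noteq> 0" using assms by auto
  have int: "set_integrable lborel (einterval 0 \<infinity>) (\<lambda>t. exp (- (w * of_real t)))"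
    unfolding set_integrable_def
    by (rule Bochner_Integration.integrable_bound[OF integrable_exp_neg[OF assms]])
       (auto simp: indicator_def einterval_def)
  have "(LBINT t=0..\<infinity>. exp (- (w * of_real t))) = 0 - (- (1 / w))"
  proof (rule interval_integral_FTC_integrable[where F = "\<lambda>t. - (exp (- (w * of_real t)) / w)"])
    show "((\<lambda>t. - (exp (- (w * of_real t)) / w)) has_vector_derivative exp (- (w * of_real t))) (at t)" for t
    proof -
      have "((\<lambda>z. - (exp (- (w * z)) / w)) has_field_derivative exp (- (w * of_real t))) (at (of_real t))"
        using w by (auto intro!: derivative_eq_intros)
      then show ?thesis by (rule has_vector_derivative_real_field)
    qed
    show "(((\<lambda>t. - (exp (- (w * complex_of_real t)) / w)) \<circ> real_of_ereal) \<longlongrightarrow> - (1 / w)) (at_right 0)"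
    proof -
      have "((\<lambda>t. - (exp (- (w * complex_of_real t)) / w)) \<longlongrightarrow> - (exp (- (w * complex_of_real 0)) / w)) (at_right 0)"
        using w by (intro tendsto_intros) auto
      then show ?thesis
        unfolding zero_ereal_def by (simp add: ereal_tendsto_simps)
    qed
    show "(((\<lambda>t. - (exp (- (w * complex_of_real t)) / w)) \<circ> real_of_ereal) \<longlongrightarrow> 0) (at_left \<infinity>)"
      unfolding ereal_tendsto_simps
    proof (rule tendsto_norm_zero_cancel)
      have "((\<lambda>t. exp (- (Re w * t)) / norm w) \<longlongrightarrow> 0) at_top" using assms w by real_asymp
      then show "((\<lambda>t. norm (- (exp (- (w * complex_of_real t)) / w))) \<longlongrightarrow> 0) at_top"
        by (simp add: norm_divide)
    qed
  qed (use int in \<open>auto intro!: continuous_intros\<close>)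
  moreover have "(LBINT t=0..\<infinity>. exp (- (w * of_real t))) = (\<integral>t. indicator {0<..} t *\<^sub>R exp (- (w * of_real t)) \<partial>lborel)"
    by (simp add: interval_lebesgue_integral_0_infty set_lebesgue_integral_def)
  moreover have "(\<integral>t. indicator {0<..} t *\<^sub>R exp (- (w * of_real t)) \<partial>lborel)
      = (\<integral>t. indicator {0..} t *\<^sub>R exp (- (w * of_real t)) \<partial>lborel)"
  proof (rule integral_cong_AE)
    have "AE t in lborel. t \<noteq> (0::real)" by (rule AE_lborel_singleton)
    then show "AE t in lborel. indicator {0<..} t *\<^sub>R exp (- (w * of_real t)) = indicator {0..} t *\<^sub>R exp (- (w * of_real t))"
      by eventually_elim (auto simp: indicator_def)
  qed auto
  ultimately show ?thesis by simp
qed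

text \<open>The two half-lines contribute 1 / (x - i s) and 1 / (x + i s), whose sum is 2 x / (x^2 +
  s^2).\<close>

lemma fourier_exp_abs:
  assumes x: "x > 0"
  shows "integrable lborel (\<lambda>t. complex_of_real (exp (- (x * \<bar>t\<bar>))))"
    and "fourier (\<lambda>t. of_real (exp (- (x * \<bar>t\<bar>)))) s = of_real (2 * pi * poisson x s)"
proof -
  define E where "E t = indicator {0..} t *\<^sub>R complex_of_real (exp (- (x * t)))" for t
  have E: "integrable lborel E"
  proof -
    have "E = (\<lambda>t. of_real (indicator {0..} t *\<^sub>R exp (- (x * t))))"
      by (auto simp: E_def indicator_def fun_eq_iff)
    then show ?thesis using integrable_of_real[OF integrable_exp_neg[OF x]] by simp
  qed
  have E': "integrable lborel (\<lambda>t. E (- t))"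
    using lborel_integrable_real_affine[OF E, of "-1" 0] by simp
  have ae: "AE t in lborel. complex_of_real (exp (- (x * \<bar>t\<bar>))) = E t + E (- t)"
    using AE_lborel_singleton[of "0::real"] by eventually_elim (auto simp: E_def indicator_def)
  have [measurable]: "E \<in> borel_measurable borel" using E by auto
  show "integrable lborel (\<lambda>t. complex_of_real (exp (- (x * \<bar>t\<bar>))))"
    using Bochner_Integration.integrable_add[OF E E'] by (rule integrable_cong_AE_imp) (use ae in auto)
  have fE: "fourier E s = 1 / (of_real x - \<i> * of_real s)" for s
  proof -
    have "fourier E s = (\<integral>t. indicator {0..} t *\<^sub>R exp (- ((of_real x - \<i> * of_real s) * of_real t)) \<partial>lborel)"
      unfolding fourier_def E_def
    proof (intro Bochner_Integration.integral_cong refl)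
      fix t
      have "iexp (s * t) * of_real (exp (- (x * t))) = exp (- ((of_real x - \<i> * of_real s) * of_real t))"
        by (simp only: exp_of_real[symmetric] exp_add[symmetric]) (simp add: algebra_simps)
      then show "iexp (s * t) * (indicator {0..} t *\<^sub>R of_real (exp (- (x * t)))) =
          indicator {0..} t *\<^sub>R exp (- ((of_real x - \<i> * of_real s) * of_real t))"
        by (auto simp: indicator_def)
    qed
    then show ?thesis using integral_exp_half_line[of "of_real x - \<i> * of_real s"] x by simp
  qed
  have fE': "fourier (\<lambda>t. E (- t)) s = fourier E (- s)" for s
    unfolding fourier_def by (subst lborel_integral_real_affine[where c = "-1" and t = 0]) auto
  have "fourier (\<lambda>t. of_real (exp (- (x * \<bar>t\<bar>)))) s = (\<integral>t. iexp (s * t) * E t + iexp (s * t) * E (- t) \<partial>lborel)"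
    unfolding fourier_def by (intro integral_cong_AE) (use ae in \<open>auto simp: distrib_left\<close>)
  also have "\<dots> = fourier E s + fourier E (- s)"
    unfolding fE'[symmetric] unfolding fourier_def using E E' by (intro Bochner_Integration.integral_add integrable_iexp_mult) auto
  also have "\<dots> = of_real (2 * pi * poisson x s)"
    using x by (simp add: fE poisson_def complex_eq_iff Re_divide Im_divide power2_eq_square)
  finally show "fourier (\<lambda>t. of_real (exp (- (x * \<bar>t\<bar>)))) s = of_real (2 * pi * poisson x s)" .
qed

text \<open>Comparison with the maximal function of the constant 1 gives total mass at most
  1.\<close>

lemma integrable_poisson:
  assumes "x > 0"
  shows "integrable lborel (\<lambda>s. complex_of_real (poisson x s))"
proof -
  have "integrable lborel (poisson x)"
  proof (rule integrableI_bounded)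
    have "window_maximal (\<lambda>_. 1) 0 \<le> 1"
      unfolding window_maximal_def window_avg_def by (intro SUP_least) (auto simp: nn_integral_window)
    moreover have "(\<integral>\<^sup>+s. ennreal (poisson x (0 - s)) * 1 \<partial>lborel) \<le> window_maximal (\<lambda>_. 1) 0"
      by (rule poisson_le_window_maximal[OF assms]) simp
    ultimately have "(\<integral>\<^sup>+s. ennreal (poisson x s) \<partial>lborel) \<le> 1" by simp
    then show "(\<integral>\<^sup>+s. ennreal (norm (poisson x s)) \<partial>lborel) < \<infinity>"
      using poisson_nonneg[of x] assms by (simp add: le_less_trans)
  qed simp
  then show ?thesis by simp
qed

text \<open>Inversion of \<open>fourier_exp_abs\<close>: pair the transform of exp (- x |t|) with a
  modulated Gaussian, move the transform onto the Gaussian, and let \<sigma> tend to 0 on both sides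
  by dominated convergence.\<close>

lemma fourier_poisson:
  assumes x: "x > 0"
  shows "fourier (\<lambda>s. of_real (poisson x s)) t = of_real (exp (- (x * \<bar>t\<bar>)))"
proof -
  define e where "e t = complex_of_real (exp (- (x * \<bar>t\<bar>)))" for t
  note P = integrable_poisson[OF x]
  have e: "integrable lborel e" "fourier e = (\<lambda>s. of_real (2 * pi * poisson x s))"
    using fourier_exp_abs[OF x] by (auto simp: e_def[abs_def])
  \<comment> \<open>After the substitution u = - t + \<sigma> v the density is the standard one for
    every \<sigma>; only the argument of \<open>e\<close> still depends on \<sigma>, and it tends to
    - t.\<close>
  have reg: "(\<integral>s. of_real (2 * pi * poisson x s) * (iexp (t * s) * of_real (exp (- (\<sigma>\<^sup>2 * s\<^sup>2 / 2)))) \<partial>lborel)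
      = (\<integral>v. of_real (2 * pi * std_normal_density v) * e (- t + \<sigma> * v) \<partial>lborel)" if "\<sigma> > 0" for \<sigma>
  proof -
    define g where "g s = iexp (t * s) * complex_of_real (exp (- (\<sigma>\<^sup>2 * s\<^sup>2 / 2)))" for s
    have g: "integrable lborel g"
      unfolding g_def using integrable_gaussian[OF that] by (intro integrable_iexp_mult) auto
    have "fourier g u = of_real (2 * pi * normal_density 0 \<sigma> (u + t))" for u
      unfolding g_def by (simp only: fourier_modulate fourier_gaussian[OF that])
    then have "(\<integral>s. fourier e s * g s \<partial>lborel) = (\<integral>u. e u * of_real (2 * pi * normal_density 0 \<sigma> (u + t)) \<partial>lborel)"
      using fourier_multiplication_formula[OF e(1) g] by simp
    also have "\<dots> = \<bar>\<sigma>\<bar> *\<^sub>R (\<integral>v. e (- t + \<sigma> * v) * of_real (2 * pi * normal_density 0 \<sigma> (- t + \<sigma> * v + t)) \<partial>lborel)"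
      using that by (intro lborel_integral_real_affine) auto
    also have "\<dots> = (\<integral>v. \<bar>\<sigma>\<bar> *\<^sub>R (e (- t + \<sigma> * v) * of_real (2 * pi * normal_density 0 \<sigma> (- t + \<sigma> * v + t))) \<partial>lborel)"
      by (rule integral_scaleR_right[symmetric])
    also have "\<dots> = (\<integral>v. of_real (2 * pi * std_normal_density v) * e (- t + \<sigma> * v) \<partial>lborel)"
    proof (intro Bochner_Integration.integral_cong refl)
      fix v
      have "\<sigma> * (2 * pi * normal_density 0 \<sigma> (- t + \<sigma> * v + t)) = 2 * pi * std_normal_density v"
        using that by (simp add: normal_density_def real_sqrt_mult power_mult_distrib)
      then have "complex_of_real \<sigma> * of_real (2 * pi * normal_density 0 \<sigma> (- t + \<sigma> * v + t)) = of_real (2 * pi * std_normal_density v)"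
        by (metis of_real_mult)
      then show "\<bar>\<sigma>\<bar> *\<^sub>R (e (- t + \<sigma> * v) * of_real (2 * pi * normal_density 0 \<sigma> (- t + \<sigma> * v + t))) =
          of_real (2 * pi * std_normal_density v) * e (- t + \<sigma> * v)"
        using that by (simp only: scaleR_conv_of_real abs_of_pos) (metis mult.assoc mult.commute)
    qed
    finally show ?thesis by (simp add: e(2) g_def)
  qed
  define \<sigma> where "\<sigma> n = 1 / real (Suc n)" for n
  have \<sigma>: "\<sigma> n > 0" for n by (simp add: \<sigma>_def)
  have \<sigma>0: "\<sigma> \<longlonglongrightarrow> 0"
    unfolding \<sigma>_def using LIMSEQ_inverse_real_of_nat by (simp add: inverse_eq_divide)
  have lim1: "(\<lambda>n. \<integral>s. of_real (2 * pi * poisson x s) * (iexp (t * s) * of_real (exp (- ((\<sigma> n)\<^sup>2 * s\<^sup>2 / 2)))) \<partial>lborel)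
      \<longlonglongrightarrow> (\<integral>s. of_real (2 * pi * poisson x s) * (iexp (t * s) * of_real (exp (- (0\<^sup>2 * s\<^sup>2 / 2)))) \<partial>lborel)"
  proof (rule integral_dominated_convergence[where w = "\<lambda>s. norm (2 * pi * poisson x s)"])
    show "AE s in lborel. (\<lambda>n. of_real (2 * pi * poisson x s) * (iexp (t * s) * of_real (exp (- ((\<sigma> n)\<^sup>2 * s\<^sup>2 / 2)))))
        \<longlonglongrightarrow> complex_of_real (2 * pi * poisson x s) * (iexp (t * s) * of_real (exp (- (0\<^sup>2 * s\<^sup>2 / 2))))"
      by (intro AE_I2 tendsto_intros \<sigma>0) simp
    show "integrable lborel (\<lambda>s. norm (2 * pi * poisson x s))"
      using P unfolding complex_of_real_integrable_eq by simp
    show "AE s in lborel. norm (complex_of_real (2 * pi * poisson x s) * (iexp (t * s) * of_real (exp (- ((\<sigma> n)\<^sup>2 * s\<^sup>2 / 2)))))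
        \<le> norm (2 * pi * poisson x s)" for n
    proof (rule AE_I2)
      fix s
      have "norm (complex_of_real (2 * pi * poisson x s) * (iexp (t * s) * of_real (exp (- ((\<sigma> n)\<^sup>2 * s\<^sup>2 / 2)))))
          = norm (2 * pi * poisson x s) * exp (- ((\<sigma> n)\<^sup>2 * s\<^sup>2 / 2))"
        by (simp only: norm_mult norm_exp_i_times norm_of_real) (simp add: abs_mult)
      also have "\<dots> \<le> norm (2 * pi * poisson x s)"
        by (intro mult_left_le) auto
      finally show "norm (complex_of_real (2 * pi * poisson x s) * (iexp (t * s) * of_real (exp (- ((\<sigma> n)\<^sup>2 * s\<^sup>2 / 2)))))
        \<le> norm (2 * pi * poisson x s)" .
    qed
  qed measurable
  have lim2: "(\<lambda>n. \<integral>v. of_real (2 * pi * std_normal_density v) * e (- t + \<sigma> n * v) \<partial>lborel)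
      \<longlonglongrightarrow> (\<integral>v. of_real (2 * pi * std_normal_density v) * e (- t + 0 * v) \<partial>lborel)"
  proof (rule integral_dominated_convergence[where w = "\<lambda>v. 2 * pi * std_normal_density v"])
    show "AE v in lborel. (\<lambda>n. of_real (2 * pi * std_normal_density v) * e (- t + \<sigma> n * v))
        \<longlonglongrightarrow> of_real (2 * pi * std_normal_density v) * e (- t + 0 * v)"
      unfolding e_def by (intro AE_I2 tendsto_intros \<sigma>0)
    show "AE v in lborel. norm (of_real (2 * pi * std_normal_density v) * e (- t + \<sigma> n * v)) \<le> 2 * pi * std_normal_density v" for n
      using x by (auto simp: norm_mult e_def intro!: mult_left_le)
    show "integrable lborel (\<lambda>v. 2 * pi * std_normal_density v)"
      by (intro integrable_mult_right integrable_normal_density) simp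
  qed (auto simp: e_def)
  have "(\<integral>s. of_real (2 * pi * poisson x s) * (iexp (t * s) * of_real (exp (- (0\<^sup>2 * s\<^sup>2 / 2)))) \<partial>lborel)
      = (\<integral>v. of_real (2 * pi * std_normal_density v) * e (- t + 0 * v) \<partial>lborel)"
    using lim1 lim2 LIMSEQ_unique unfolding reg[OF \<sigma>] by blast
  moreover have "(\<integral>s. of_real (2 * pi * poisson x s) * (iexp (t * s) * of_real (exp (- (0\<^sup>2 * s\<^sup>2 / 2)))) \<partial>lborel)
      = of_real (2 * pi) * fourier (\<lambda>s. of_real (poisson x s)) t"
  proof -
    have "of_real (2 * pi * poisson x s) * (iexp (t * s) * of_real (exp (- (0\<^sup>2 * s\<^sup>2 / 2))))
        = of_real (2 * pi) * (iexp (t * s) * of_real (poisson x s))" for s by simp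
    then show ?thesis unfolding fourier_def by (simp only: integral_mult_right_zero)
  qed
  moreover have "(\<integral>v. of_real (2 * pi * std_normal_density v) * e (- t + 0 * v) \<partial>lborel) = of_real (2 * pi) * e (- t)"
  proof -
    have "of_real (2 * pi * std_normal_density v) * e (- t + 0 * v) = (of_real (2 * pi) * e (- t)) * of_real (std_normal_density v)" for v
      by simp
    then have "(\<integral>v. of_real (2 * pi * std_normal_density v) * e (- t + 0 * v) \<partial>lborel)
        = (of_real (2 * pi) * e (- t)) * (\<integral>v. of_real (std_normal_density v) \<partial>lborel)"
      by (simp only: integral_mult_right_zero)
    also have "(\<integral>v. complex_of_real (std_normal_density v) \<partial>lborel) = 1"
      by (subst integral_complex_of_real) simp
    finally show ?thesis by simp
  qed
  ultimately show ?thesis by (simp add: e_def)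
qed

lemma laplace_eq_lborel:
  assumes "\<forall>t\<le>0. f t = 0"
  shows "laplace f z = (\<integral>t. f t * exp (- (z * of_real t)) \<partial>lborel)"
  unfolding laplace_def Rplus_def
  by (subst integral_restrict_space, simp) (intro Bochner_Integration.integral_cong, auto simp: indicator_def assms)

text \<open>The transform of the Poisson kernel shifted by \<open>Im z\<close> is exp (- i t Im z -
  Re z |t|), which coincides with exp (- z t) for t > 0, where \<open>f\<close> lives. The claim is
  the multiplication formula for this pair.\<close>

theorem laplace_poisson_formula:
  assumes f: "integrable lborel f" and f0: "\<forall>t\<le>0. f t = 0" and z: "Re z > 0"
  shows "laplace f z = (\<integral>s. fourier f s * of_real (poisson (Re z) (Im z + s)) \<partial>lborel)"
proof -
  define P where "P s = complex_of_real (poisson (Re z) (Im z + s))" for s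
  have P: "integrable lborel P"
    unfolding P_def using lborel_integrable_real_affine[OF integrable_poisson[OF z], of 1 "Im z"] by simp
  have "fourier P t = iexp (- (t * Im z)) * of_real (exp (- (Re z * \<bar>t\<bar>)))" for t
  proof -
    have "fourier P t = (\<integral>s. iexp (t * (- Im z + 1 * s)) * P (- Im z + 1 * s) \<partial>lborel)"
      unfolding fourier_def by (subst lborel_integral_real_affine[where c = 1 and t = "- Im z"]) auto
    also have "\<dots> = (\<integral>s. iexp (- (t * Im z)) * (iexp (t * s) * of_real (poisson (Re z) s)) \<partial>lborel)"
      unfolding P_def
      by (intro Bochner_Integration.integral_cong refl)
         (simp add: algebra_simps mult_exp_exp[symmetric] exp_diff exp_minus field_simps)
    also have "\<dots> = iexp (- (t * Im z)) * fourier (\<lambda>s. of_real (poisson (Re z) s)) t"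
      unfolding fourier_def by (rule integral_mult_right_zero)
    finally show ?thesis by (simp only: fourier_poisson[OF z])
  qed
  then have "(\<integral>s. fourier f s * P s \<partial>lborel) = (\<integral>t. f t * (iexp (- (t * Im z)) * of_real (exp (- (Re z * \<bar>t\<bar>)))) \<partial>lborel)"
    using fourier_multiplication_formula[OF f P] by simp
  also have "\<dots> = (\<integral>t. f t * exp (- (z * of_real t)) \<partial>lborel)"
  proof (intro Bochner_Integration.integral_cong refl)
    fix t
    show "f t * (iexp (- (t * Im z)) * of_real (exp (- (Re z * \<bar>t\<bar>)))) = f t * exp (- (z * of_real t))"
    proof (cases "t > 0")
      case True
      have "- (z * of_real t) = \<i> * of_real (- (t * Im z)) + of_real (- (Re z * \<bar>t\<bar>))"
        using True by (simp add: complex_eq_iff mult.commute)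
      then show ?thesis by (simp only: exp_add exp_of_real)
    qed (simp add: f0)
  qed
  finally show ?thesis by (simp add: laplace_eq_lborel[OF f0] P_def)
qed

lemma norm_laplace_le_poisson:
  assumes f: "integrable lborel f" and f0: "\<forall>t\<le>0. f t = 0" and z: "Re z > 0"
  shows "ennreal (norm (laplace f z))
    \<le> (\<integral>\<^sup>+s. ennreal (poisson (Re z) (Im z - s)) * ennreal (norm (fourier f (- s))) \<partial>lborel)"
proof -
  have [measurable]: "fourier f \<in> borel_measurable borel" using f by (rule measurable_fourier)
  have "ennreal (norm (laplace f z)) \<le> (\<integral>\<^sup>+s. ennreal (norm (fourier f s * of_real (poisson (Re z) (Im z + s)))) \<partial>lborel)"
    unfolding laplace_poisson_formula[OF assms] by (rule ennreal_norm_integral_le)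
  also have "\<dots> = (\<integral>\<^sup>+s. ennreal (norm (fourier f (- s) * of_real (poisson (Re z) (Im z - s)))) \<partial>lborel)"
    by (subst nn_integral_real_affine[where c = "-1" and t = 0]) auto
  also have "\<dots> = (\<integral>\<^sup>+s. ennreal (poisson (Re z) (Im z - s)) * ennreal (norm (fourier f (- s))) \<partial>lborel)"
    using z by (intro nn_integral_cong) (simp add: norm_mult poisson_nonneg mult.commute flip: ennreal_mult)
  finally show ?thesis .
qed

text \<open>Moving the centre by a fixed multiple \<delta> of the distance x from the boundary
  changes the kernel by a bounded factor only. This transfers the Poisson integral at a point of a
  slightly tilted line to the end point of that line on the boundary.\<close>

lemma poisson_shift_le:
  assumes "x > 0" "\<delta> \<ge> 0"
  shows "poisson x (u - \<delta> * x) \<le> (1 + \<delta> + \<delta>\<^sup>2) * poisson x u"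
proof -
  define v where "v = u - \<delta> * x"
  have pos: "x\<^sup>2 + v\<^sup>2 > 0" "x\<^sup>2 + u\<^sup>2 > 0" using assms by (auto intro: add_pos_nonneg)
  have uv: "u = v + \<delta> * x" by (simp add: v_def)
  have "x\<^sup>2 + u\<^sup>2 \<le> (1 + \<delta> + \<delta>\<^sup>2) * (x\<^sup>2 + v\<^sup>2)"
  proof -
    have "(1 + \<delta> + \<delta>\<^sup>2) * (x\<^sup>2 + v\<^sup>2) - (x\<^sup>2 + u\<^sup>2) = \<delta> * (x - v)\<^sup>2 + \<delta>\<^sup>2 * v\<^sup>2"
      unfolding uv by (simp add: power2_eq_square algebra_simps)
    moreover have "\<dots> \<ge> 0" using assms by simp
    ultimately show ?thesis by linarith
  qed
  then have "x * (pi * (x\<^sup>2 + u\<^sup>2)) \<le> (1 + \<delta> + \<delta>\<^sup>2) * x * (pi * (x\<^sup>2 + v\<^sup>2))"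
    using assms(1) by (simp add: mult.assoc mult.left_commute mult_left_mono)
  then show ?thesis
    unfolding poisson_def v_def[symmetric] using pos by (simp add: divide_simps mult_ac)
qed

section \<open>Hilbert's inequality\<close>

text \<open>It dominates |\<open>laplace f\<close>| on the vertical line Re z = x and decreases in
  x; values in \<open>ennreal\<close> make both true without any question of convergence.\<close>

definition laplace_abs :: "(real \<Rightarrow> complex) \<Rightarrow> real \<Rightarrow> ennreal" where
  "laplace_abs f x = (\<integral>\<^sup>+t. ennreal (norm (f t)) * (ennreal (exp (- (x * t))) * indicator {0<..} t) \<partial>lborel)"

lemma measurable_laplace_abs [measurable]:
  assumes [measurable]: "f \<in> borel_measurable borel"
  shows "laplace_abs f \<in> borel_measurable borel"
  unfolding laplace_abs_def[abs_def] by measurable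

lemma laplace_abs_antimono: "x \<le> y \<Longrightarrow> laplace_abs f y \<le> laplace_abs f x"
  unfolding laplace_abs_def
  by (intro nn_integral_mono mult_left_mono) (auto simp: indicator_def mult_right_mono intro!: ennreal_leI)

lemma norm_laplace_le_laplace_abs:
  assumes f0: "\<forall>t\<le>0. f t = 0"
  shows "ennreal (norm (laplace f z)) \<le> laplace_abs f (Re z)"
proof -
  have "ennreal (norm (laplace f z)) \<le> (\<integral>\<^sup>+t. ennreal (norm (f t * exp (- (z * of_real t)))) \<partial>lborel)"
    unfolding laplace_eq_lborel[OF f0] by (rule ennreal_norm_integral_le)
  also have "\<dots> = laplace_abs f (Re z)"
    unfolding laplace_abs_def
    by (intro nn_integral_cong) (use f0 in \<open>auto simp: norm_mult indicator_def not_less simp flip: ennreal_mult\<close>)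
  finally show ?thesis .
qed

text \<open>Gamma (1/2) = sqrt pi, with x t as the variable of integration. This is the source of pi
  in Hilbert's inequality.\<close>

lemma nn_integral_inverse_sqrt_exp:
  assumes x: "x > 0"
  shows "(\<integral>\<^sup>+t. ennreal (t powr (-1/2) * exp (- (x * t))) * indicator {0<..} t \<partial>lborel) = ennreal (sqrt pi * x powr (-1/2))"
proof -
  have "(\<integral>\<^sup>+t. ennreal (t powr (1/2 - 1) / exp t) * indicator {0..} t \<partial>lborel) = ennreal (Gamma (1/2))"
    by (rule nn_integral_has_integral_lebesgue'[OF _ Gamma_integral_real]) auto
  then have "ennreal (sqrt pi) = (\<integral>\<^sup>+t. ennreal (t powr (1/2 - 1) / exp t) * indicator {0..} t \<partial>lborel)"
    by (simp add: Gamma_one_half_real)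
  also have "\<dots> = ennreal \<bar>x\<bar> * (\<integral>\<^sup>+t. ennreal ((0 + x * t) powr (1/2 - 1) / exp (0 + x * t)) * indicator {0..} (0 + x * t) \<partial>lborel)"
    using x by (intro nn_integral_real_affine) auto
  also have "\<dots> = (\<integral>\<^sup>+t. ennreal \<bar>x\<bar> * (ennreal ((0 + x * t) powr (1/2 - 1) / exp (0 + x * t)) * indicator {0..} (0 + x * t)) \<partial>lborel)"
    by (subst nn_integral_cmult) auto
  also have "\<dots> = (\<integral>\<^sup>+t. ennreal (x powr (1/2)) * (ennreal (t powr (-1/2) * exp (- (x * t))) * indicator {0<..} t) \<partial>lborel)"
  proof (intro nn_integral_cong)
    fix t :: real
    consider "t < 0" | "t = 0" | "t > 0" by linarith
    then show "ennreal \<bar>x\<bar> * (ennreal ((0 + x * t) powr (1/2 - 1) / exp (0 + x * t)) * indicator {0..} (0 + x * t))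
      = ennreal (x powr (1/2)) * (ennreal (t powr (-1/2) * exp (- (x * t))) * indicator {0<..} t)"
    proof cases
      case 1
      then have "x * t < 0" using x by (simp add: mult_pos_neg)
      then show ?thesis using 1 by simp
    next
      case 3
      have "x * x powr (-1/2) = x powr (1/2)"
      proof -
        have "x powr (1/2) = x powr (1 + -1/2)" by simp
        also have "\<dots> = x powr 1 * x powr (-1/2)" by (rule powr_add)
        also have "x powr 1 = x" using x by simp
        finally show ?thesis by (rule sym)
      qed
      moreover have "(x * t) powr (1/2 - 1) / exp (x * t) = x powr (-1/2) * (t powr (-1/2) * exp (- (x * t)))"
      proof -
        have e: "1/2 - 1 = (-1/2 :: real)" by simp
        show ?thesis unfolding e by (simp only: powr_mult exp_minus divide_inverse mult.assoc)
      qed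
      ultimately have "x * ((x * t) powr (1/2 - 1) / exp (x * t)) = x powr (1/2) * (t powr (-1/2) * exp (- (x * t)))"
        by (metis mult.assoc)
      then show ?thesis using 3 x by (simp flip: ennreal_mult)
    qed simp
  qed
  also have "\<dots> = ennreal (x powr (1/2)) * (\<integral>\<^sup>+t. ennreal (t powr (-1/2) * exp (- (x * t))) * indicator {0<..} t \<partial>lborel)"
    by (subst nn_integral_cmult) auto
  finally have eq: "ennreal (sqrt pi) = ennreal (x powr (1/2)) * (\<integral>\<^sup>+t. ennreal (t powr (-1/2) * exp (- (x * t))) * indicator {0<..} t \<partial>lborel)" .
  have "ennreal (x powr (-1/2)) * ennreal (x powr (1/2)) = 1"
    using x by (simp flip: ennreal_mult powr_add)
  then have "(\<integral>\<^sup>+t. ennreal (t powr (-1/2) * exp (- (x * t))) * indicator {0<..} t \<partial>lborel) = ennreal (x powr (-1/2)) * ennreal (sqrt pi)"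
    unfolding eq by (simp flip: mult.assoc)
  then show ?thesis by (simp add: mult.commute flip: ennreal_mult)
qed

text \<open>Schur's test with the weight \<open>t\<^sup>-\<^sup>1\<^sup>/\<^sup>2\<close>.\<close>

theorem laplace_abs_square_le:
  assumes [measurable]: "f \<in> borel_measurable borel"
  shows "(\<integral>\<^sup>+x. (laplace_abs f x)\<^sup>2 * indicator {0<..} x \<partial>lborel) \<le> ennreal pi * (\<integral>\<^sup>+t. ennreal ((norm (f t))\<^sup>2) \<partial>lborel)"
proof -
  \<comment> \<open>The splitting uses t^(1/4) and t^(-1/4), so the squares carry t^(1/2) and
    t^(-1/2). The t-integral of the square of \<open>b\<close> leaves x^(-1/2); the x-integral that
    follows is then of the same form, and each of them contributes sqrt pi.\<close>
  define a where "a x t = ennreal (norm (f t)) * (ennreal (t powr (1/4) * exp (- (x * t / 2))) * indicator {0<..} t)" for x t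
  define b where "b x t = ennreal (t powr (-1/4) * exp (- (x * t / 2))) * indicator {0<..} t" for x t :: real
  have [measurable]: "a x \<in> borel_measurable borel" "b x \<in> borel_measurable borel" for x
    unfolding a_def b_def by measurable
  have pw: "(\<integral>\<^sup>+t. (b x t)\<^sup>2 \<partial>lborel) = ennreal (sqrt pi * x powr (-1/2))" if "x > 0" for x
  proof -
    have "(b x t)\<^sup>2 = ennreal (t powr (-1/2) * exp (- (x * t))) * indicator {0<..} t" for t
      by (auto simp: b_def power2_eq_square indicator_def mult_ac simp flip: ennreal_mult powr_add exp_add)
    then show ?thesis using nn_integral_inverse_sqrt_exp[OF that] by simp
  qed
  define c where "c x t = ennreal ((norm (f t))\<^sup>2) * (ennreal (t powr (1/2)) * (ennreal (exp (- (x * t))) * indicator {0<..} t))" for x t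
  have [measurable]: "(\<lambda>(x, t). c x t) \<in> borel_measurable (lborel \<Otimes>\<^sub>M lborel)"
    unfolding c_def by measurable
  have [measurable]: "c x \<in> borel_measurable borel" for x unfolding c_def by measurable
  have aa: "(a x t)\<^sup>2 = c x t" for x t
    by (auto simp: a_def c_def power2_eq_square indicator_def mult_ac simp flip: ennreal_mult powr_add exp_add)
  have ab: "laplace_abs f x = (\<integral>\<^sup>+t. a x t * b x t \<partial>lborel)" for x
    unfolding laplace_abs_def
  proof (intro nn_integral_cong)
    fix t
    show "ennreal (norm (f t)) * (ennreal (exp (- (x * t))) * indicator {0<..} t) = a x t * b x t"
    proof (cases "t > 0")
      case True
      define p q where "p = t powr (1/4) * exp (- (x * t / 2))" and "q = t powr (-1/4) * exp (- (x * t / 2))"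
      have "p * q = (t powr (1/4) * t powr (-1/4)) * (exp (- (x * t / 2)) * exp (- (x * t / 2)))"
        by (simp add: p_def q_def)
      also have "\<dots> = exp (- (x * t))"
        using True by (simp flip: powr_add exp_add)
      finally have "ennreal (exp (- (x * t))) = ennreal p * ennreal q"
        by (simp add: p_def q_def flip: ennreal_mult)
      then show ?thesis
        unfolding a_def b_def p_def[symmetric] q_def[symmetric] using True by (simp add: mult.assoc)
    qed (simp add: a_def)
  qed
  have "(laplace_abs f x)\<^sup>2 * indicator {0<..} x \<le> (\<integral>\<^sup>+t. ennreal (sqrt pi) * (ennreal (x powr (-1/2)) * indicator {0<..} x * c x t) \<partial>lborel)" for x
  proof (cases "x > 0")
    case True
    have "(laplace_abs f x)\<^sup>2 \<le> (\<integral>\<^sup>+t. (a x t)\<^sup>2 \<partial>lborel) * (\<integral>\<^sup>+t. (b x t)\<^sup>2 \<partial>lborel)"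
      unfolding ab by (rule Cauchy_Schwarz_nn_integral) auto
    also have "\<dots> = ennreal (sqrt pi) * (ennreal (x powr (-1/2)) * (\<integral>\<^sup>+t. c x t \<partial>lborel))"
    proof -
      have "ennreal (sqrt pi * x powr (-1/2)) = ennreal (sqrt pi) * ennreal (x powr (-1/2))"
        by (rule ennreal_mult) auto
      then show ?thesis unfolding pw[OF True] aa by (simp only: ac_simps)
    qed
    also have "\<dots> = (\<integral>\<^sup>+t. ennreal (sqrt pi) * (ennreal (x powr (-1/2)) * c x t) \<partial>lborel)"
      by (simp add: nn_integral_cmult)
    finally show ?thesis using True by simp
  qed simp
  then have "(\<integral>\<^sup>+x. (laplace_abs f x)\<^sup>2 * indicator {0<..} x \<partial>lborel)
      \<le> (\<integral>\<^sup>+x. \<integral>\<^sup>+t. ennreal (sqrt pi) * (ennreal (x powr (-1/2)) * indicator {0<..} x * c x t) \<partial>lborel \<partial>lborel)"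
    by (rule nn_integral_mono)
  also have "\<dots> = (\<integral>\<^sup>+t. \<integral>\<^sup>+x. ennreal (sqrt pi) * (ennreal (x powr (-1/2)) * indicator {0<..} x * c x t) \<partial>lborel \<partial>lborel)"
    by (rule lborel_pair.Fubini') measurable
  also have "\<dots> \<le> (\<integral>\<^sup>+t. ennreal pi * ennreal ((norm (f t))\<^sup>2) \<partial>lborel)"
  proof (rule nn_integral_mono)
    fix t :: real
    show "(\<integral>\<^sup>+x. ennreal (sqrt pi) * (ennreal (x powr (-1/2)) * indicator {0<..} x * c x t) \<partial>lborel) \<le> ennreal pi * ennreal ((norm (f t))\<^sup>2)"
    proof (cases "t > 0")
      case True
      define K where "K = ennreal (sqrt pi) * (ennreal ((norm (f t))\<^sup>2) * ennreal (t powr (1/2)))"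
      have "ennreal (sqrt pi) * (ennreal (x powr (-1/2)) * indicator {0<..} x * c x t)
          = K * (ennreal (x powr (-1/2) * exp (- (t * x))) * indicator {0<..} x)" for x
        using True by (simp add: c_def K_def ennreal_mult mult_ac)
      then have "(\<integral>\<^sup>+x. ennreal (sqrt pi) * (ennreal (x powr (-1/2)) * indicator {0<..} x * c x t) \<partial>lborel)
          = K * (\<integral>\<^sup>+x. ennreal (x powr (-1/2) * exp (- (t * x))) * indicator {0<..} x \<partial>lborel)"
        by (simp add: nn_integral_cmult)
      also have "\<dots> = K * ennreal (sqrt pi * t powr (-1/2))"
        by (simp only: nn_integral_inverse_sqrt_exp[OF True])
      also have "\<dots> = ennreal ((sqrt pi * sqrt pi) * (norm (f t))\<^sup>2 * (t powr (1/2) * t powr (-1/2)))"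
        unfolding K_def by (simp add: mult_ac flip: ennreal_mult)
      also have "\<dots> = ennreal pi * ennreal ((norm (f t))\<^sup>2)"
        using True by (simp flip: ennreal_mult powr_add)
      finally show ?thesis by simp
    qed (simp add: c_def)
  qed
  also have "\<dots> = ennreal pi * (\<integral>\<^sup>+t. ennreal ((norm (f t))\<^sup>2) \<partial>lborel)"
    by (rule nn_integral_cmult) auto
  finally show ?thesis .
qed

section \<open>Integration by projections\<close>

lemma emeasure_lborel_greaterThan [simp]: "emeasure lborel {a::real<..} = \<infinity>"
proof (rule ccontr)
  assume "emeasure lborel {a<..} \<noteq> \<infinity>"
  then obtain n where "emeasure lborel {a<..} < of_nat n"
    using ennreal_Ex_less_of_nat[of "emeasure lborel {a<..}"] by (auto simp: less_top)
  moreover have "emeasure lborel {a<..<a + real n} \<le> emeasure lborel {a<..}"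
    by (intro emeasure_mono) auto
  ultimately show False by (simp add: ennreal_of_nat_eq_real_of_nat)
qed

lemma nn_integral_layer_cake_point:
  "(\<integral>\<^sup>+(s::real). (if 0 < s \<and> ennreal s < u then 1 else 0) \<partial>lborel) = u"
proof -
  have "(\<integral>\<^sup>+(s::real). (if 0 < s \<and> ennreal s < u then 1 else 0) \<partial>lborel)
      = (\<integral>\<^sup>+s. indicator {s. 0 < s \<and> ennreal s < u} s \<partial>lborel)"
    by (intro nn_integral_cong) (auto simp: indicator_def)
  also have "\<dots> = emeasure lborel {s. 0 < s \<and> ennreal s < u}"
    by (intro nn_integral_indicator) measurable
  also have "\<dots> = u"
  proof (cases u)
    case (real r)
    have "{s::real. 0 < s \<and> ennreal s < u} = {0<..<r}"
      using real by (auto simp: ennreal_less_iff)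
    then show ?thesis using real by simp
  next
    case top
    have "{s::real. 0 < s \<and> ennreal s < u} = {0<..}"
      using top by (auto simp: ennreal_less_top)
    then show ?thesis using top by simp
  qed
  finally show ?thesis .
qed

lemma nn_integral_layer_cake:
  assumes "sigma_finite_measure M" and [measurable]: "u \<in> borel_measurable M"
  shows "(\<integral>\<^sup>+z. u z \<partial>M) = (\<integral>\<^sup>+s. emeasure M {z\<in>space M. ennreal s < u z} * indicator {0<..} s \<partial>lborel)"
proof -
  interpret sigma_finite_measure M by fact
  interpret P: pair_sigma_finite M lborel ..
  have "(\<integral>\<^sup>+z. u z \<partial>M) = (\<integral>\<^sup>+z. \<integral>\<^sup>+s. (if 0 < s \<and> ennreal s < u z then 1 else 0) \<partial>lborel \<partial>M)"
    by (simp only: nn_integral_layer_cake_point)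
  also have "\<dots> = (\<integral>\<^sup>+s. \<integral>\<^sup>+z. (if 0 < s \<and> ennreal s < u z then 1 else 0) \<partial>M \<partial>lborel)"
    by (rule P.Fubini'[symmetric]) measurable
  also have "\<dots> = (\<integral>\<^sup>+s. emeasure M {z\<in>space M. ennreal s < u z} * indicator {0<..} s \<partial>lborel)"
  proof (rule nn_integral_cong)
    fix s :: real
    have "(\<integral>\<^sup>+z. (if 0 < s \<and> ennreal s < u z then 1 else 0) \<partial>M)
        = (\<integral>\<^sup>+z. indicator {0<..} s * indicator {z\<in>space M. ennreal s < u z} z \<partial>M)"
      by (intro nn_integral_cong) (auto simp: indicator_def)
    then show "(\<integral>\<^sup>+z. (if 0 < s \<and> ennreal s < u z then 1 else 0) \<partial>M)
        = emeasure M {z\<in>space M. ennreal s < u z} * indicator {0<..} s"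
      by (simp add: nn_integral_cmult_indicator mult.commute)
  qed
  finally show ?thesis .
qed

text \<open>A crude factor, sufficient for the projections of a ball to be bounded.\<close>

lemma abs_xi_le: "\<bar>xi \<alpha> z\<bar> \<le> 2 * norm z"
proof -
  have "\<bar>Re z * cos \<alpha>\<bar> \<le> norm z * 1" "\<bar>Im z * sin \<alpha>\<bar> \<le> norm z * 1"
    unfolding abs_mult by (intro mult_mono; simp add: abs_Re_le_cmod abs_Im_le_cmod)+
  then show ?thesis unfolding xi_def by linarith
qed

lemma abs_eta_le: "\<bar>eta \<alpha> z\<bar> \<le> 2 * norm z"
proof -
  have "\<bar>Re z * sin \<alpha>\<bar> \<le> norm z * 1" "\<bar>Im z * cos \<alpha>\<bar> \<le> norm z * 1"
    unfolding abs_mult by (intro mult_mono; simp add: abs_Re_le_cmod abs_Im_le_cmod)+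
  then show ?thesis unfolding eta_def by linarith
qed

text \<open>Should a projection fail to be measurable, its \<^const>\<open>emeasure\<close> would be 0, so a Borel
  superset gives an upper bound in any case.\<close>

lemma W1_emeasure_le:
  assumes \<mu>: "\<mu> \<in> W1 \<alpha> k k'" and A: "A \<in> sets borel"
    and X: "X \<in> sets borel" "xi \<alpha> ` A \<subseteq> X" and Y: "Y \<in> sets borel" "eta \<alpha> ` A \<subseteq> Y"
    and fin: "ennreal k * emeasure lborel X + ennreal k' * emeasure lborel Y < \<infinity>"
  shows "emeasure \<mu> A \<le> ennreal k * emeasure lborel X + ennreal k' * emeasure lborel Y"
proof -
  have "emeasure lebesgue (xi \<alpha> ` A) \<le> emeasure lebesgue X" "emeasure lebesgue (eta \<alpha> ` A) \<le> emeasure lebesgue Y"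
    using emeasure_mono[OF X(2), of lebesgue] emeasure_mono[OF Y(2), of lebesgue] X Y by auto
  then have le: "ennreal k * emeasure lebesgue (xi \<alpha> ` A) + ennreal k' * emeasure lebesgue (eta \<alpha> ` A)
      \<le> ennreal k * emeasure lborel X + ennreal k' * emeasure lborel Y"
    using X Y by (auto intro!: add_mono mult_left_mono)
  then have "emeasure \<mu> A \<le> ennreal k * emeasure lebesgue (xi \<alpha> ` A) + ennreal k' * emeasure lebesgue (eta \<alpha> ` A)"
    using \<mu> A le_less_trans[OF le fin] unfolding W1_def by blast
  with le show ?thesis by (rule order_trans[rotated])
qed

text \<open>Balls have bounded projections and therefore finite measure. Fubini in the layer-cake
  formula relies on this.\<close>

lemma W1_sigma_finite:
  assumes "\<mu> \<in> W1 \<alpha> k k'"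
  shows "sigma_finite_measure \<mu>"
proof
  have sets: "sets \<mu> = sets borel" using assms by (simp add: W1_def)
  define B where "B n = cball (0::complex) (real n)" for n
  have "emeasure \<mu> (B n) \<noteq> \<infinity>" for n
  proof -
    have "emeasure \<mu> (B n) \<le> ennreal k * emeasure lborel {- 2 * real n..2 * real n} + ennreal k' * emeasure lborel {- 2 * real n..2 * real n}"
      using abs_xi_le[of \<alpha>] abs_eta_le[of \<alpha>]
      by (intro W1_emeasure_le[OF assms])
         (auto simp: B_def abs_le_iff dest: order_trans[OF _ mult_left_mono[of _ "real n" 2]] simp: ennreal_mult_less_top,
          (smt (verit))+)
    also have "\<dots> < \<infinity>" by (simp add: ennreal_mult_less_top)
    finally show ?thesis by simp
  qed
  moreover have "(\<Union>n. B n) = UNIV"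
    unfolding B_def by (auto simp: real_arch_simple)
  ultimately show "\<exists>A. countable A \<and> A \<subseteq> sets \<mu> \<and> \<Union> A = space \<mu> \<and> (\<forall>a\<in>A. emeasure \<mu> a \<noteq> \<infinity>)"
    using sets sets_eq_imp_space_eq[OF sets]
    by (intro exI[of _ "range B"]) (auto simp: B_def)
qed

text \<open>The part of \<open>U\<close> where \<open>u\<close> exceeds s projects into the sets
  where \<open>G\<close>, respectively \<open>H\<close>, exceeds s. The projection bound at each
  level s, integrated over s, gives the claim.\<close>

lemma W1_nn_integral_le:
  assumes \<mu>: "\<mu> \<in> W1 \<alpha> k k'" and U [measurable]: "U \<in> sets borel"
    and u [measurable]: "u \<in> borel_measurable borel"
    and G [measurable]: "G \<in> borel_measurable borel" "H \<in> borel_measurable borel"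
    and le: "\<And>z. z \<in> U \<Longrightarrow> u z \<le> G (xi \<alpha> z)" "\<And>z. z \<in> U \<Longrightarrow> u z \<le> H (eta \<alpha> z)"
  shows "(\<integral>\<^sup>+z. u z * indicator U z \<partial>\<mu>) \<le> ennreal k * (\<integral>\<^sup>+s. G s \<partial>lborel) + ennreal k' * (\<integral>\<^sup>+s. H s \<partial>lborel)"
proof (cases "ennreal k * (\<integral>\<^sup>+s. G s \<partial>lborel) + ennreal k' * (\<integral>\<^sup>+s. H s \<partial>lborel) = \<infinity>")
  case False
  have sets [measurable_cong]: "sets \<mu> = sets borel" using \<mu> by (simp add: W1_def)
  note sp = sets_eq_imp_space_eq[OF sets]
  define g h where "g s = emeasure lborel {x. ennreal s < G x}" and "h s = emeasure lborel {x. ennreal s < H x}" for s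
  have G_int: "(\<integral>\<^sup>+s. G s \<partial>lborel) = (\<integral>\<^sup>+s. g s * indicator {0<..} s \<partial>lborel)"
    and H_int: "(\<integral>\<^sup>+s. H s \<partial>lborel) = (\<integral>\<^sup>+s. h s * indicator {0<..} s \<partial>lborel)"
    unfolding g_def h_def
    by (subst nn_integral_layer_cake[OF sigma_finite_lborel]; simp)+
  have meas: "(\<lambda>s. emeasure lborel {x. ennreal s < F x}) \<in> borel_measurable borel"
    if [measurable]: "F \<in> borel_measurable borel" for F :: "real \<Rightarrow> ennreal"
  proof -
    have "(\<lambda>s. \<integral>\<^sup>+x. (if ennreal s < F x then 1 else 0) \<partial>lborel) \<in> borel_measurable borel" by measurable
    also have "(\<lambda>s. \<integral>\<^sup>+x. (if ennreal s < F x then 1 else 0) \<partial>lborel) = (\<lambda>s. emeasure lborel {x. ennreal s < F x})"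
    proof
      fix s
      have "(\<integral>\<^sup>+x. (if ennreal s < F x then 1 else 0) \<partial>lborel) = (\<integral>\<^sup>+x. indicator {x. ennreal s < F x} x \<partial>lborel)"
        by (intro nn_integral_cong) (auto simp: indicator_def)
      then show "(\<integral>\<^sup>+x. (if ennreal s < F x then 1 else 0) \<partial>lborel) = emeasure lborel {x. ennreal s < F x}" by simp
    qed
    finally show ?thesis .
  qed
  have [measurable]: "g \<in> borel_measurable borel" "h \<in> borel_measurable borel"
    unfolding g_def h_def by (auto intro: meas)
  \<comment> \<open>The projection bound is available only when its right-hand side is finite.
    Chebyshev's inequality supplies this at every level s > 0; the factor \<open>c\<close> stays
    inside, since for c = 0 the level set itself may have infinite measure.\<close>
  have cheb: "c * emeasure lborel {x. ennreal s < F x} < \<infinity>"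
    if "c * (\<integral>\<^sup>+s. F s \<partial>lborel) < \<infinity>" "s > 0" and [measurable]: "F \<in> borel_measurable borel" for c :: ennreal and F :: "real \<Rightarrow> ennreal" and s
  proof -
    have "ennreal s * emeasure lborel {x. ennreal s < F x} = (\<integral>\<^sup>+x. ennreal s * indicator {x. ennreal s < F x} x \<partial>lborel)"
      by (subst nn_integral_cmult_indicator) auto
    also have "\<dots> \<le> (\<integral>\<^sup>+x. F x \<partial>lborel)"
      by (intro nn_integral_mono) (auto simp: indicator_def)
    finally have "c * (ennreal s * emeasure lborel {x. ennreal s < F x}) \<le> c * (\<integral>\<^sup>+s. F s \<partial>lborel)"
      by (rule mult_left_mono) simp
    then have "ennreal s * (c * emeasure lborel {x. ennreal s < F x}) < \<infinity>"
      using that(1) by (simp add: mult.left_commute le_less_trans)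
    then show ?thesis using that(2) by (auto simp: ennreal_mult_less_top)
  qed
  have fin: "ennreal k * (\<integral>\<^sup>+s. G s \<partial>lborel) < \<infinity>" "ennreal k' * (\<integral>\<^sup>+s. H s \<partial>lborel) < \<infinity>"
    using False by (auto simp: less_top)
  have "(\<integral>\<^sup>+z. u z * indicator U z \<partial>\<mu>)
      = (\<integral>\<^sup>+s. emeasure \<mu> {z\<in>space \<mu>. ennreal s < u z * indicator U z} * indicator {0<..} s \<partial>lborel)"
    by (rule nn_integral_layer_cake[OF W1_sigma_finite[OF \<mu>]]) measurable
  also have "\<dots> \<le> (\<integral>\<^sup>+s. ennreal k * (g s * indicator {0<..} s) + ennreal k' * (h s * indicator {0<..} s) \<partial>lborel)"
  proof (rule nn_integral_mono)
    fix s :: real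
    show "emeasure \<mu> {z\<in>space \<mu>. ennreal s < u z * indicator U z} * indicator {0<..} s
        \<le> ennreal k * (g s * indicator {0<..} s) + ennreal k' * (h s * indicator {0<..} s)"
    proof (cases "s > 0")
      case True
      define A where "A = {z\<in>U. ennreal s < u z}"
      have A: "{z\<in>space \<mu>. ennreal s < u z * indicator U z} = A"
        using sp by (auto simp: A_def indicator_def split: if_splits)
      have "emeasure \<mu> A \<le> ennreal k * g s + ennreal k' * h s"
        unfolding g_def h_def
      proof (rule W1_emeasure_le[OF \<mu>])
        show "A \<in> sets borel" unfolding A_def by measurable
        show "xi \<alpha> ` A \<subseteq> {x. ennreal s < G x}" "eta \<alpha> ` A \<subseteq> {x. ennreal s < H x}"
          using le by (auto simp: A_def intro: less_le_trans)
        show "ennreal k * emeasure lborel {x. ennreal s < G x} + ennreal k' * emeasure lborel {x. ennreal s < H x} < \<infinity>"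
          using cheb[OF fin(1) True] cheb[OF fin(2) True] by simp
      qed measurable
      then show ?thesis using True by (simp add: A)
    qed simp
  qed
  also have "\<dots> = ennreal k * (\<integral>\<^sup>+s. G s \<partial>lborel) + ennreal k' * (\<integral>\<^sup>+s. H s \<partial>lborel)"
    unfolding G_int H_int by (simp add: nn_integral_add nn_integral_cmult)
  finally show ?thesis .
qed (simp only: infinity_ennreal_def top_greatest)

text \<open>Majorants of \<open>|\<L>f|\<^sup>2\<close> on the upper part of the sector, as functions of \<open>\<eta>\<close> and of \<open>\<xi>\<close>.
  If \<open>cos \<beta>\<close> is not small, then \<open>Re z \<ge> \<xi> cos \<beta>\<close> and absolute values suffice. Otherwise the lines
  \<open>\<xi> = const\<close> are almost horizontal, and the Poisson integral along such a line is controlled by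
  the maximal function at its end point on the imaginary axis; the factor \<open>6/5\<close> absorbs the tilt.\<close>

definition eta_majorant :: "(real \<Rightarrow> complex) \<Rightarrow> real \<Rightarrow> ennreal" where
  "eta_majorant f s = (laplace_abs f \<bar>s\<bar>)\<^sup>2"

definition xi_majorant :: "real \<Rightarrow> (real \<Rightarrow> complex) \<Rightarrow> real \<Rightarrow> ennreal" where
  "xi_majorant \<beta> f s = (if cos \<beta> \<ge> 1 / 24 then (laplace_abs f (\<bar>s\<bar> * cos \<beta>))\<^sup>2
     else (let h = (\<lambda>s. ennreal (norm (fourier f (- s)))) in
       ennreal (6/5) * ((window_maximal h (s / sin \<beta>))\<^sup>2 + (h (s / sin \<beta>))\<^sup>2)))"

text \<open>The angle between the positive real axis and the direction \<beta>, through linear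
  inequalities; the last one says \<open>eta \<beta> z \<le> 0\<close>.\<close>

definition upper_sector :: "real \<Rightarrow> complex set" where
  "upper_sector \<beta> = {z. 0 \<le> Re z \<and> 0 \<le> Im z \<and> Im z * cos \<beta> \<le> Re z * sin \<beta>}"

lemma nn_integral_laplace_abs_abs_le:
  assumes [measurable]: "f \<in> borel_measurable borel"
  shows "(\<integral>\<^sup>+s. (laplace_abs f \<bar>s\<bar>)\<^sup>2 \<partial>lborel) \<le> ennreal (2 * pi) * (\<integral>\<^sup>+t. ennreal ((norm (f t))\<^sup>2) \<partial>lborel)"
proof -
  define L where "L = (\<integral>\<^sup>+s. (laplace_abs f s)\<^sup>2 * indicator {0<..} s \<partial>lborel)"
  have "(\<integral>\<^sup>+s. (laplace_abs f \<bar>s\<bar>)\<^sup>2 \<partial>lborel)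
      = (\<integral>\<^sup>+s. (laplace_abs f s)\<^sup>2 * indicator {0<..} s + (laplace_abs f (- s))\<^sup>2 * indicator {0<..} (- s) \<partial>lborel)"
  proof (rule nn_integral_cong_AE)
    show "AE s in lborel. (laplace_abs f \<bar>s\<bar>)\<^sup>2 = (laplace_abs f s)\<^sup>2 * indicator {0<..} s + (laplace_abs f (- s))\<^sup>2 * indicator {0<..} (- s)"
      using AE_lborel_singleton[of "0::real"] by eventually_elim (auto simp: indicator_def abs_if)
  qed
  also have "\<dots> = L + (\<integral>\<^sup>+s. (laplace_abs f (- s))\<^sup>2 * indicator {0<..} (- s) \<partial>lborel)"
    unfolding L_def by (rule nn_integral_add) measurable
  also have "(\<integral>\<^sup>+s. (laplace_abs f (- s))\<^sup>2 * indicator {0<..} (- s) \<partial>lborel) = L"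
    unfolding L_def by (subst (2) nn_integral_real_affine[where c = "-1" and t = 0]) auto
  also have "L + L \<le> ennreal pi * (\<integral>\<^sup>+t. ennreal ((norm (f t))\<^sup>2) \<partial>lborel) + ennreal pi * (\<integral>\<^sup>+t. ennreal ((norm (f t))\<^sup>2) \<partial>lborel)"
    unfolding L_def by (rule add_mono; rule laplace_abs_square_le[OF assms])
  also have "\<dots> = ennreal (2 * pi) * (\<integral>\<^sup>+t. ennreal ((norm (f t))\<^sup>2) \<partial>lborel)"
  proof -
    have "ennreal pi + ennreal pi = ennreal (2 * pi)" by (simp flip: ennreal_plus)
    then show ?thesis by (simp only: distrib_right[symmetric])
  qed
  finally show ?thesis .
qed

lemma nn_integral_scale:
  assumes [measurable]: "g \<in> borel_measurable borel" and "c > 0"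
  shows "(\<integral>\<^sup>+s. g (s * c) \<partial>lborel) = ennreal (1 / c) * (\<integral>\<^sup>+s. g s \<partial>lborel)"
proof -
  have "(\<integral>\<^sup>+s. g s \<partial>lborel) = ennreal c * (\<integral>\<^sup>+s. g (s * c) \<partial>lborel)"
    using assms(2) by (subst nn_integral_real_affine[where c = c and t = 0]) (auto simp: mult.commute)
  then have "ennreal (1 / c) * (\<integral>\<^sup>+s. g s \<partial>lborel) = (ennreal (1 / c) * ennreal c) * (\<integral>\<^sup>+s. g (s * c) \<partial>lborel)"
    by (simp add: mult.assoc)
  also have "ennreal (1 / c) * ennreal c = 1" using assms(2) by (simp flip: ennreal_mult)
  finally show ?thesis by simp
qed

lemma measurable_eta_majorant [measurable]:
  assumes [measurable]: "f \<in> borel_measurable borel"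
  shows "eta_majorant f \<in> borel_measurable borel"
  unfolding eta_majorant_def[abs_def] by measurable

lemma measurable_xi_majorant [measurable]:
  assumes f: "integrable lborel f"
  shows "xi_majorant \<beta> f \<in> borel_measurable borel"
proof -
  have [measurable]: "f \<in> borel_measurable borel" "fourier f \<in> borel_measurable borel"
    using f by (auto intro: measurable_fourier)
  show ?thesis unfolding xi_majorant_def[abs_def] Let_def by measurable
qed

text \<open>Hilbert's inequality on the two half-lines gives 2 pi; 8 pi is the unit in which the
  final constant is expressed.\<close>

lemma nn_integral_eta_majorant_le:
  assumes "f \<in> borel_measurable borel"
  shows "(\<integral>\<^sup>+s. eta_majorant f s \<partial>lborel) \<le> ennreal (8 * pi) * (\<integral>\<^sup>+t. ennreal ((norm (f t))\<^sup>2) \<partial>lborel)"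
proof -
  have "(\<integral>\<^sup>+s. eta_majorant f s \<partial>lborel) \<le> ennreal (2 * pi) * (\<integral>\<^sup>+t. ennreal ((norm (f t))\<^sup>2) \<partial>lborel)"
    unfolding eta_majorant_def by (rule nn_integral_laplace_abs_abs_le[OF assms])
  also have "\<dots> \<le> ennreal (8 * pi) * (\<integral>\<^sup>+t. ennreal ((norm (f t))\<^sup>2) \<partial>lborel)"
    by (intro mult_right_mono ennreal_leI) auto
  finally show ?thesis .
qed

lemma nn_integral_xi_majorant_le:
  assumes f: "integrable lborel f" and \<beta>: "0 \<le> \<beta>" "\<beta> \<le> pi / 2"
  shows "(\<integral>\<^sup>+s. xi_majorant \<beta> f s \<partial>lborel) \<le> ennreal (48 * pi) * (\<integral>\<^sup>+t. ennreal ((norm (f t))\<^sup>2) \<partial>lborel)"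
proof (cases "cos \<beta> \<ge> 1 / 24")
  case True
  have [measurable]: "f \<in> borel_measurable borel" using f by auto
  have "(\<integral>\<^sup>+s. xi_majorant \<beta> f s \<partial>lborel) = (\<integral>\<^sup>+s. (laplace_abs f \<bar>s * cos \<beta>\<bar>)\<^sup>2 \<partial>lborel)"
    using True by (simp add: xi_majorant_def abs_mult)
  also have "\<dots> = ennreal (1 / cos \<beta>) * (\<integral>\<^sup>+s. (laplace_abs f \<bar>s\<bar>)\<^sup>2 \<partial>lborel)"
    using True by (intro nn_integral_scale) auto
  also have "\<dots> \<le> ennreal 24 * (ennreal (2 * pi) * (\<integral>\<^sup>+t. ennreal ((norm (f t))\<^sup>2) \<partial>lborel))"
    using True by (intro mult_mono nn_integral_laplace_abs_abs_le ennreal_leI) (auto simp: field_simps)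
  also have "\<dots> = ennreal (48 * pi) * (\<integral>\<^sup>+t. ennreal ((norm (f t))\<^sup>2) \<partial>lborel)"
    unfolding mult.assoc[symmetric] by (subst ennreal_mult[symmetric]) auto
  finally show ?thesis .
next
  case False
  have [measurable]: "f \<in> borel_measurable borel" "fourier f \<in> borel_measurable borel"
    using f by (auto intro: measurable_fourier)
  define N where "N = (\<integral>\<^sup>+t. ennreal ((norm (f t))\<^sup>2) \<partial>lborel)"
  define h where "h s = ennreal (norm (fourier f (- s)))" for s
  have [measurable]: "h \<in> borel_measurable borel" unfolding h_def by measurable
  have s0: "sin \<beta> > 0"
  proof -
    have "\<beta> > 0" using False \<beta> by (cases "\<beta> = 0") auto
    then show ?thesis using \<beta> by (intro sin_gt_zero) auto
  qed
  have hN: "(\<integral>\<^sup>+s. (h s)\<^sup>2 \<partial>lborel) \<le> ennreal (2 * pi) * N"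
  proof -
    have "(\<integral>\<^sup>+s. (h s)\<^sup>2 \<partial>lborel) = (\<integral>\<^sup>+s. ennreal ((norm (fourier f s))\<^sup>2) \<partial>lborel)"
      unfolding h_def by (subst nn_integral_real_affine[where c = "-1" and t = 0]) (auto simp: ennreal_power)
    then show ?thesis using plancherel_le[OF f] by (simp add: N_def)
  qed
  define g where "g s = ennreal (6/5) * ((window_maximal h s)\<^sup>2 + (h s)\<^sup>2)" for s
  have [measurable]: "g \<in> borel_measurable borel" unfolding g_def by measurable
  have "(\<integral>\<^sup>+s. xi_majorant \<beta> f s \<partial>lborel) = (\<integral>\<^sup>+s. g (s * (1 / sin \<beta>)) \<partial>lborel)"
    using False by (simp add: xi_majorant_def g_def h_def[abs_def] Let_def)
  also have "\<dots> = ennreal (1 / (1 / sin \<beta>)) * (\<integral>\<^sup>+s. g s \<partial>lborel)"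
    using s0 by (intro nn_integral_scale) auto
  also have "\<dots> \<le> 1 * (\<integral>\<^sup>+s. g s \<partial>lborel)"
    by (intro mult_right_mono) auto
  also have "\<dots> = ennreal (6/5) * ((\<integral>\<^sup>+s. (window_maximal h s)\<^sup>2 \<partial>lborel) + (\<integral>\<^sup>+s. (h s)\<^sup>2 \<partial>lborel))"
    unfolding g_def by (simp add: nn_integral_cmult nn_integral_add)
  also have "\<dots> \<le> ennreal (6/5) * (16 * (\<integral>\<^sup>+s. (h s)\<^sup>2 \<partial>lborel) + (\<integral>\<^sup>+s. (h s)\<^sup>2 \<partial>lborel))"
    by (intro mult_left_mono add_mono window_maximal_le) auto
  also have "\<dots> = ennreal (6/5) * (17 * (\<integral>\<^sup>+s. (h s)\<^sup>2 \<partial>lborel))"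
    using distrib_right[of 16 1 "\<integral>\<^sup>+s. (h s)\<^sup>2 \<partial>lborel"] by simp
  also have "\<dots> \<le> ennreal (6/5) * (17 * (ennreal (2 * pi) * N))"
    using hN by (intro mult_left_mono) auto
  also have "\<dots> = ennreal (6/5 * 17 * (2 * pi)) * N"
  proof -
    have "ennreal (6/5 * 17 * (2 * pi)) = ennreal (6/5 * 17) * ennreal (2 * pi)" by (rule ennreal_mult') simp
    moreover have "ennreal (6/5 * 17) = ennreal (6/5) * ennreal 17" by (rule ennreal_mult') simp
    ultimately show ?thesis by (simp only: mult.assoc ennreal_numeral)
  qed
  also have "\<dots> \<le> ennreal (48 * pi) * N"
    by (intro mult_right_mono ennreal_leI) auto
  finally show ?thesis by (simp add: N_def)
qed

lemma norm_laplace_le_eta_majorant: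
  assumes f0: "\<forall>t\<le>0. f t = 0" and \<beta>: "0 \<le> \<beta>" "\<beta> \<le> pi / 2" and z: "z \<in> upper_sector \<beta>"
  shows "(ennreal (norm (laplace f z)))\<^sup>2 \<le> eta_majorant f (eta \<beta> z)"
proof -
  have cs: "0 \<le> cos \<beta>" "0 \<le> sin \<beta>" using \<beta> by (auto intro: cos_ge_zero sin_ge_zero)
  have "Re z * sin \<beta> \<le> Re z" using z cs by (intro mult_left_le) (auto simp: upper_sector_def)
  moreover have "0 \<le> Im z * cos \<beta>" using z cs by (auto simp: upper_sector_def)
  ultimately have "\<bar>eta \<beta> z\<bar> \<le> Re z" using z by (auto simp: eta_def upper_sector_def)
  then have "laplace_abs f (Re z) \<le> laplace_abs f \<bar>eta \<beta> z\<bar>" by (rule laplace_abs_antimono)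
  then show ?thesis
    unfolding eta_majorant_def using norm_laplace_le_laplace_abs[OF f0, of z] by (intro power_mono) auto
qed

lemma norm_laplace_le_xi_majorant:
  assumes f: "integrable lborel f" and f0: "\<forall>t\<le>0. f t = 0" and \<beta>: "0 \<le> \<beta>" "\<beta> \<le> pi / 2" and z: "z \<in> upper_sector \<beta>"
  shows "(ennreal (norm (laplace f z)))\<^sup>2 \<le> xi_majorant \<beta> f (xi \<beta> z)"
proof -
  have cs: "0 \<le> cos \<beta>" "0 \<le> sin \<beta>" using \<beta> by (auto intro: cos_ge_zero sin_ge_zero)
  have z': "0 \<le> Re z" "0 \<le> Im z" "Im z * cos \<beta> \<le> Re z * sin \<beta>" using z by (auto simp: upper_sector_def)
  show ?thesis
  proof (cases "cos \<beta> \<ge> 1 / 24")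
    case True
    have "0 \<le> xi \<beta> z" using z' cs by (simp add: xi_def)
    \<comment> \<open>On a line of constant \<open>xi\<close>, the point of the half-sector closest
      to the imaginary axis lies on the edge of direction \<beta>, where equality holds.\<close>
    moreover have "xi \<beta> z * cos \<beta> \<le> Re z"
    proof -
      have "xi \<beta> z * cos \<beta> = Re z * (cos \<beta>)\<^sup>2 + sin \<beta> * (Im z * cos \<beta>)"
        by (simp add: xi_def power2_eq_square algebra_simps)
      also have "\<dots> \<le> Re z * (cos \<beta>)\<^sup>2 + sin \<beta> * (Re z * sin \<beta>)"
        using z' cs by (intro add_left_mono mult_left_mono)
      also have "\<dots> = Re z * ((sin \<beta>)\<^sup>2 + (cos \<beta>)\<^sup>2)"
        by (simp only: power2_eq_square distrib_left ac_simps)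
      finally show ?thesis by (simp only: sin_cos_squared_add mult_1_right)
    qed
    ultimately have "laplace_abs f (Re z) \<le> laplace_abs f (\<bar>xi \<beta> z\<bar> * cos \<beta>)"
      by (intro laplace_abs_antimono) simp
    then show ?thesis
      unfolding xi_majorant_def using True norm_laplace_le_laplace_abs[OF f0, of z] by (auto intro!: power_mono)
  next
    case False
    have [measurable]: "f \<in> borel_measurable borel" "fourier f \<in> borel_measurable borel"
      using f by (auto intro: measurable_fourier)
    define h where "h s = ennreal (norm (fourier f (- s)))" for s
    have [measurable]: "h \<in> borel_measurable borel" unfolding h_def by measurable
    have s0: "sin \<beta> > 0"
    proof -
      have "\<beta> > 0" using False \<beta> by (cases "\<beta> = 0") auto
      then show ?thesis using \<beta> by (intro sin_gt_zero) auto
    qed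
    \<comment> \<open>The line of constant \<open>xi\<close> through \<open>z\<close> meets the
      imaginary axis at height \<open>y0\<close> and descends from there with slope - \<delta>,
      where \<delta> = cot \<beta>.\<close>
    define y0 where "y0 = xi \<beta> z / sin \<beta>"
    define \<delta> where "\<delta> = cos \<beta> / sin \<beta>"
    have y0: "Im z = y0 - \<delta> * Re z"
      using s0 by (simp add: y0_def \<delta>_def xi_def field_simps)
    \<comment> \<open>cos \<beta> < 1/24 gives sin^2 \<beta> \<ge> 1 - 1/576, hence sin \<beta>
      \<ge> 23/24 and cot \<beta> \<le> 1/23.\<close>
    have \<delta>: "0 \<le> \<delta>" "\<delta> \<le> 1 / 23"
    proof -
      show "0 \<le> \<delta>" using cs by (simp add: \<delta>_def)
      have "(23 / 24)\<^sup>2 \<le> (sin \<beta>)\<^sup>2"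
      proof -
        have "(cos \<beta>)\<^sup>2 \<le> (1 / 24)\<^sup>2" using False cs by (intro power_mono) auto
        then show ?thesis using sin_cos_squared_add[of \<beta>] by (simp add: power2_eq_square)
      qed
      then have "23 / 24 \<le> sin \<beta>" by (rule power2_le_imp_le[OF _ cs(2)])
      then have "1 / 24 \<le> 1 / 23 * sin \<beta>" by simp
      then have "cos \<beta> \<le> 1 / 23 * sin \<beta>" using False by linarith
      then show "\<delta> \<le> 1 / 23" using s0 by (simp add: \<delta>_def field_simps)
    qed
    define c where "c = 1 + \<delta> + \<delta>\<^sup>2"
    have c: "c \<ge> 0" "c\<^sup>2 \<le> 6 / 5"
    proof -
      show "c \<ge> 0" using \<delta> by (simp add: c_def)
      have "\<delta>\<^sup>2 \<le> (1/23)\<^sup>2" using \<delta> by (intro power_mono) auto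
      then have "c \<le> 1 + 1/23 + (1/23)\<^sup>2" unfolding c_def using \<delta> by linarith
      then have "c\<^sup>2 \<le> (1 + 1/23 + (1/23)\<^sup>2)\<^sup>2" using \<open>c \<ge> 0\<close> by (rule power_mono)
      also have "\<dots> \<le> 6 / 5" by (simp add: power2_eq_square)
      finally show "c\<^sup>2 \<le> 6 / 5" .
    qed
    have "(ennreal (norm (laplace f z)))\<^sup>2 \<le> ennreal (6/5) * ((window_maximal h y0)\<^sup>2 + (h y0)\<^sup>2)"
    proof (cases "Re z > 0")
      case True
      have "ennreal (norm (laplace f z)) \<le> (\<integral>\<^sup>+s. ennreal (poisson (Re z) (Im z - s)) * h s \<partial>lborel)"
        unfolding h_def by (rule norm_laplace_le_poisson[OF f f0 True])
      also have "\<dots> \<le> (\<integral>\<^sup>+s. ennreal c * (ennreal (poisson (Re z) (y0 - s)) * h s) \<partial>lborel)"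
      proof (rule nn_integral_mono)
        fix s
        have "poisson (Re z) (Im z - s) \<le> c * poisson (Re z) (y0 - s)"
          unfolding c_def using poisson_shift_le[OF True \<delta>(1), of "y0 - s"] by (simp add: y0 algebra_simps)
        then have "ennreal (poisson (Re z) (Im z - s)) \<le> ennreal c * ennreal (poisson (Re z) (y0 - s))"
          using c by (simp add: ennreal_leI flip: ennreal_mult')
        then show "ennreal (poisson (Re z) (Im z - s)) * h s \<le> ennreal c * (ennreal (poisson (Re z) (y0 - s)) * h s)"
          unfolding mult.assoc[symmetric] by (rule mult_right_mono) simp
      qed
      also have "\<dots> = ennreal c * (\<integral>\<^sup>+s. ennreal (poisson (Re z) (y0 - s)) * h s \<partial>lborel)"
        by (rule nn_integral_cmult) measurable
      also have "\<dots> \<le> ennreal c * window_maximal h y0"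
        by (intro mult_left_mono poisson_le_window_maximal True) auto
      finally have "(ennreal (norm (laplace f z)))\<^sup>2 \<le> (ennreal c * window_maximal h y0)\<^sup>2"
        by (rule power_mono) simp
      also have "\<dots> = ennreal (c\<^sup>2) * (window_maximal h y0)\<^sup>2"
        using c by (simp add: power_mult_distrib ennreal_power)
      also have "\<dots> \<le> ennreal (6/5) * ((window_maximal h y0)\<^sup>2 + (h y0)\<^sup>2)"
        using c by (intro mult_mono ennreal_leI) auto
      finally show ?thesis .
    next
      \<comment> \<open>On the imaginary axis there is no Poisson integral: \<open>laplace f\<close>
        equals the boundary function there, and the summand \<open>(h y0)\<^sup>2\<close> of the
        majorant takes care of it. A measure may charge the axis, so these points count.\<close>
      case False
      then have "Re z = 0" using z' by simp
      then have "Im z = y0" "z = \<i> * of_real y0" using y0 by (auto simp: complex_eq_iff)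
      then have "laplace f z = fourier f (- y0)"
        unfolding laplace_eq_lborel[OF f0] fourier_def by (simp add: mult_ac)
      then have "(ennreal (norm (laplace f z)))\<^sup>2 = 1 * (h y0)\<^sup>2" by (simp add: h_def)
      also have "\<dots> \<le> ennreal (6/5) * ((window_maximal h y0)\<^sup>2 + (h y0)\<^sup>2)"
        by (intro mult_mono) (auto simp: one_ennreal_def[symmetric] intro: ennreal_leI simp del: ennreal_1 simp flip: ennreal_1)
      finally show ?thesis .
    qed
    then show ?thesis using False by (simp add: xi_majorant_def h_def[abs_def] y0_def Let_def)
  qed
qed

section \<open>The case of exponent 2\<close>

lemma sigma_finite_Rplus: "sigma_finite_measure Rplus"
  unfolding Rplus_def by (intro sigma_finite_measure_restrict_space sigma_finite_lborel) auto

lemma measurable_laplace [measurable]: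
  assumes [measurable]: "f \<in> borel_measurable Rplus"
  shows "laplace f \<in> borel_measurable borel"
proof -
  interpret sigma_finite_measure Rplus by (rule sigma_finite_Rplus)
  have [measurable]: "(\<lambda>t. t) \<in> borel_measurable Rplus"
    unfolding Rplus_def by (intro measurable_restrict_space1) simp
  show ?thesis unfolding laplace_def[abs_def] by measurable
qed

lemma laplace_cnj: "laplace (\<lambda>t. cnj (f t)) (cnj z) = cnj (laplace f z)"
  unfolding laplace_def
  by (subst Bochner_Integration.integral_cnj[symmetric]) (simp add: exp_cnj)

lemma upper_sector_borel [measurable]: "upper_sector \<beta> \<in> sets borel"
proof -
  have "closed (upper_sector \<beta>)"
    unfolding upper_sector_def by (intro closed_Collect_conj closed_Collect_le continuous_intros)
  then show ?thesis by (rule borel_closed)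
qed

lemma borel_measurable_Rplus:
  "f \<in> borel_measurable borel \<Longrightarrow> f \<in> borel_measurable Rplus"
  unfolding Rplus_def by (intro measurable_restrict_space1) simp

lemma majorants_le:
  assumes l: "0 \<le> l" "0 \<le> l'" and \<beta>: "0 \<le> \<beta>" "\<beta> \<le> pi / 2" and f: "integrable lborel f"
  shows "ennreal l * (\<integral>\<^sup>+s. xi_majorant \<beta> f s \<partial>lborel) + ennreal l' * (\<integral>\<^sup>+s. eta_majorant f s \<partial>lborel)
    \<le> ennreal (8 * pi * (6 * l + l')) * (\<integral>\<^sup>+t. ennreal ((norm (f t))\<^sup>2) \<partial>lborel)"
proof -
  define N where "N = (\<integral>\<^sup>+t. ennreal ((norm (f t))\<^sup>2) \<partial>lborel)"
  have "ennreal l * (\<integral>\<^sup>+s. xi_majorant \<beta> f s \<partial>lborel) + ennreal l' * (\<integral>\<^sup>+s. eta_majorant f s \<partial>lborel)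
      \<le> ennreal l * (ennreal (48 * pi) * N) + ennreal l' * (ennreal (8 * pi) * N)"
    unfolding N_def
    by (rule add_mono; rule mult_left_mono)
       (use nn_integral_xi_majorant_le[OF f \<beta>] nn_integral_eta_majorant_le[of f] f in auto)
  also have "\<dots> = ennreal (8 * pi * (6 * l + l')) * N"
  proof -
    have "ennreal (8 * pi * (6 * l + l')) = ennreal (l * (48 * pi) + l' * (8 * pi))"
      by (simp add: algebra_simps)
    also have "\<dots> = ennreal l * ennreal (48 * pi) + ennreal l' * ennreal (8 * pi)"
      using l by (simp only: ennreal_plus ennreal_mult mult_nonneg_nonneg zero_le_numeral pi_ge_zero)
    finally show ?thesis by (simp only: distrib_right mult.assoc)
  qed
  finally show ?thesis by (simp add: N_def)
qed

lemma laplace_upper_sector_le: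
  assumes \<mu>: "\<mu> \<in> W1 \<beta> l l'" and l: "0 \<le> l" "0 \<le> l'" and \<beta>: "0 \<le> \<beta>" "\<beta> \<le> pi / 2"
    and f: "integrable lborel f" and f0: "\<forall>t\<le>0. f t = 0"
  shows "(\<integral>\<^sup>+z. (ennreal (norm (laplace f z)))\<^sup>2 * indicator (upper_sector \<beta>) z \<partial>\<mu>)
    \<le> ennreal (8 * pi * (6 * l + l')) * (\<integral>\<^sup>+t. ennreal ((norm (f t))\<^sup>2) \<partial>lborel)"
proof -
  have [measurable]: "f \<in> borel_measurable borel" using f by auto
  then have [measurable]: "laplace f \<in> borel_measurable borel"
    by (intro measurable_laplace borel_measurable_Rplus)
  have "(\<integral>\<^sup>+z. (ennreal (norm (laplace f z)))\<^sup>2 * indicator (upper_sector \<beta>) z \<partial>\<mu>)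
    \<le> ennreal l * (\<integral>\<^sup>+s. xi_majorant \<beta> f s \<partial>lborel) + ennreal l' * (\<integral>\<^sup>+s. eta_majorant f s \<partial>lborel)"
    by (intro W1_nn_integral_le[OF \<mu>] norm_laplace_le_xi_majorant norm_laplace_le_eta_majorant
        measurable_xi_majorant measurable_eta_majorant upper_sector_borel f f0 \<beta>) auto
  also note majorants_le[OF l \<beta> f]
  finally show ?thesis .
qed

text \<open>Conjugation exchanges the half-sectors: as \<alpha> becomes - \<alpha>, it keeps
  \<open>xi\<close> and reverses the sign of \<open>eta\<close>. The majorant in \<open>eta\<close>
  is even, so the estimates of the upper half apply to the conjugate of \<open>f\<close>.\<close>

lemma laplace_lower_sector_le:
  assumes \<mu>: "\<mu> \<in> W1 \<alpha> k k'" and k: "0 \<le> k" "0 \<le> k'" and \<alpha>: "- pi / 2 \<le> \<alpha>" "\<alpha> \<le> 0"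
    and f: "integrable lborel f" and f0: "\<forall>t\<le>0. f t = 0"
  shows "(\<integral>\<^sup>+z. (ennreal (norm (laplace f z)))\<^sup>2 * indicator (cnj -` upper_sector (- \<alpha>)) z \<partial>\<mu>)
    \<le> ennreal (8 * pi * (6 * k + k')) * (\<integral>\<^sup>+t. ennreal ((norm (f t))\<^sup>2) \<partial>lborel)"
proof -
  have [measurable]: "f \<in> borel_measurable borel" using f by auto
  then have [measurable]: "laplace f \<in> borel_measurable borel"
    by (intro measurable_laplace borel_measurable_Rplus)
  define g where "g t = cnj (f t)" for t
  have g: "integrable lborel g" "\<forall>t\<le>0. g t = 0" using f f0 by (auto simp: g_def[abs_def])
  have [measurable]: "g \<in> borel_measurable borel" using g by auto
  have \<beta>: "0 \<le> - \<alpha>" "- \<alpha> \<le> pi / 2" using \<alpha> by auto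
  have [measurable]: "cnj -` upper_sector (- \<alpha>) \<in> sets borel"
    using measurable_sets[of cnj borel borel "upper_sector (- \<alpha>)"]
    by (simp add: borel_measurable_continuous_onI continuous_on_cnj)
  have norm_g: "norm (laplace f z) = norm (laplace g (cnj z))" for z
    unfolding g_def laplace_cnj by simp
  have xi: "xi (- \<alpha>) (cnj z) = xi \<alpha> z" and eta: "eta (- \<alpha>) (cnj z) = - eta \<alpha> z" for z
    by (simp_all add: xi_def eta_def)
  have even: "eta_majorant g (- s) = eta_majorant g s" for s by (simp add: eta_majorant_def)
  have "(\<integral>\<^sup>+z. (ennreal (norm (laplace f z)))\<^sup>2 * indicator (cnj -` upper_sector (- \<alpha>)) z \<partial>\<mu>)
    \<le> ennreal k * (\<integral>\<^sup>+s. xi_majorant (- \<alpha>) g s \<partial>lborel) + ennreal k' * (\<integral>\<^sup>+s. eta_majorant g s \<partial>lborel)"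
  proof (rule W1_nn_integral_le[OF \<mu>])
    fix z assume "z \<in> cnj -` upper_sector (- \<alpha>)"
    then have z: "cnj z \<in> upper_sector (- \<alpha>)" by simp
    show "(ennreal (norm (laplace f z)))\<^sup>2 \<le> xi_majorant (- \<alpha>) g (xi \<alpha> z)"
      unfolding norm_g using norm_laplace_le_xi_majorant[OF g \<beta> z] by (simp add: xi)
    show "(ennreal (norm (laplace f z)))\<^sup>2 \<le> eta_majorant g (eta \<alpha> z)"
      unfolding norm_g using norm_laplace_le_eta_majorant[OF g(2) \<beta> z] by (simp add: eta even)
  qed (use g(1) in \<open>auto intro: measurable_xi_majorant\<close>)
  also note majorants_le[OF k \<beta> g(1)]
  finally show ?thesis by (simp add: g_def)
qed

section \<open>The sector as an intersection of half-planes\<close>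

lemma eta_polar: "eta \<phi> (of_real r * cis \<theta>) = r * sin (\<theta> - \<phi>)"
  by (simp add: eta_def sin_diff algebra_simps)

text \<open>In polar coordinates the conditions on \<open>eta\<close> are signs of sin (\<theta> -
  \<alpha>) and sin (\<theta> - \<beta>), with all angles in [- pi / 2, pi / 2]. Linear conditions
  instead of \<open>Arg\<close> make the sector visibly closed.\<close>

lemma sector_eq:
  assumes "- pi / 2 \<le> \<alpha>" "\<alpha> < \<beta>" "\<beta> \<le> pi / 2"
  shows "sector \<alpha> \<beta> = {z. 0 \<le> Re z \<and> 0 \<le> eta \<alpha> z \<and> eta \<beta> z \<le> 0}"
proof (intro set_eqI)
  fix z
  show "z \<in> sector \<alpha> \<beta> \<longleftrightarrow> z \<in> {z. 0 \<le> Re z \<and> 0 \<le> eta \<alpha> z \<and> eta \<beta> z \<le> 0}"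
  proof (cases "z = 0")
    case True
    then show ?thesis by (simp add: sector_def eta_def)
  next
    case False
    define r where "r = norm z"
    define \<theta> where "\<theta> = Arg z"
    have r: "r > 0" using False by (simp add: r_def)
    have \<theta>: "- pi < \<theta>" "\<theta> \<le> pi" using mpi_less_Arg[of z] Arg_le_pi[of z] by (auto simp: \<theta>_def)
    have z: "z = of_real r * cis \<theta>"
      using rcis_cmod_Arg[of z] by (simp add: r_def \<theta>_def rcis_def)
    have re: "Re z = r * cos \<theta>" by (simp add: z)
    show ?thesis
    proof
      assume "z \<in> sector \<alpha> \<beta>"
      then have "\<alpha> \<le> \<theta>" "\<theta> \<le> \<beta>" using False by (auto simp: sector_def \<theta>_def)
      then have "0 \<le> cos \<theta>" "0 \<le> sin (\<theta> - \<alpha>)" "0 \<le> sin (\<beta> - \<theta>)"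
        using assms by (auto intro!: cos_ge_zero sin_ge_zero)
      moreover have "sin (\<theta> - \<beta>) = - sin (\<beta> - \<theta>)" by (metis minus_diff_eq sin_minus)
      ultimately show "z \<in> {z. 0 \<le> Re z \<and> 0 \<le> eta \<alpha> z \<and> eta \<beta> z \<le> 0}"
        using r by (simp add: re) (simp add: z eta_polar mult_nonneg_nonpos)
    next
      assume a: "z \<in> {z. 0 \<le> Re z \<and> 0 \<le> eta \<alpha> z \<and> eta \<beta> z \<le> 0}"
      have "0 \<le> eta \<alpha> z" "eta \<beta> z \<le> 0" "0 \<le> Re z" using a by auto
      then have s: "0 \<le> sin (\<theta> - \<alpha>)" "sin (\<theta> - \<beta>) \<le> 0" and c: "0 \<le> cos \<theta>"
        using r by (simp_all add: z eta_polar zero_le_mult_iff mult_le_0_iff)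
      have \<theta>2: "- pi / 2 \<le> \<theta>" "\<theta> \<le> pi / 2"
        using c \<theta> cos_lt_zero_pi[of \<theta>] cos_lt_zero_pi[of "- \<theta>"] by (force simp: not_less)+
      have "\<alpha> \<le> \<theta>"
      proof (rule ccontr)
        assume "\<not> \<alpha> \<le> \<theta>"
        then have "0 < sin (\<alpha> - \<theta>)" using assms \<theta>2 by (intro sin_gt_zero) auto
        then show False using s by (simp add: sin_diff mult.commute)
      qed
      moreover have "\<theta> \<le> \<beta>"
      proof (rule ccontr)
        assume "\<not> \<theta> \<le> \<beta>"
        then have "0 < sin (\<theta> - \<beta>)" using assms \<theta>2 by (intro sin_gt_zero) auto
        then show False using s by simp
      qed
      ultimately show "z \<in> sector \<alpha> \<beta>" by (simp add: sector_def \<theta>_def)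
    qed
  qed
qed

lemma sector_borel:
  assumes "- pi / 2 \<le> \<alpha>" "\<alpha> < \<beta>" "\<beta> \<le> pi / 2"
  shows "sector \<alpha> \<beta> \<in> sets borel"
proof -
  have "closed {z. 0 \<le> Re z \<and> 0 \<le> eta \<alpha> z \<and> eta \<beta> z \<le> 0}"
    unfolding eta_def by (intro closed_Collect_conj closed_Collect_le continuous_intros)
  then show ?thesis unfolding sector_eq[OF assms] by (rule borel_closed)
qed

lemma W2_AE:
  assumes "- pi / 2 \<le> \<alpha>" "\<alpha> < \<beta>" "\<beta> \<le> pi / 2" "\<mu> \<in> W2 \<alpha> \<beta> k k' l l'"
  shows "AE z in \<mu>. z \<in> sector \<alpha> \<beta>"
proof -
  have "sets \<mu> = sets borel" using assms(4) by (simp add: W2_def W1_def)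
  then show ?thesis
    using sector_borel[OF assms(1-3)] assms(4)
    by (intro AE_I[of _ _ "- sector \<alpha> \<beta>"]) (auto simp: W2_def dest: sets_eq_imp_space_eq)
qed

theorem laplace_L2_bound:
  assumes ab: "- pi / 2 \<le> \<alpha>" "\<alpha> < \<beta>" "\<beta> \<le> pi / 2" and \<mu>: "\<mu> \<in> W2 \<alpha> \<beta> k k' l l'"
    and k: "0 \<le> k" "0 \<le> k'" "0 \<le> l" "0 \<le> l'"
    and f: "integrable lborel f" and f0: "\<forall>t\<le>0. f t = 0"
  shows "(\<integral>\<^sup>+z. (ennreal (norm (laplace f z)))\<^sup>2 \<partial>\<mu>)
    \<le> ennreal (8 * pi * (sqrt (6 * k + k') + sqrt (6 * l + l'))\<^sup>2) * (\<integral>\<^sup>+t. ennreal ((norm (f t))\<^sup>2) \<partial>lborel)"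
proof -
  have \<mu>1: "\<mu> \<in> W1 \<alpha> k k'" "\<mu> \<in> W1 \<beta> l l'" using \<mu> by (auto simp: W2_def)
  have sets [measurable_cong]: "sets \<mu> = sets borel" using \<mu>1 by (simp add: W1_def)
  have [measurable]: "f \<in> borel_measurable borel" using f by auto
  then have [measurable]: "laplace f \<in> borel_measurable borel"
    by (intro measurable_laplace borel_measurable_Rplus)
  define N where "N = (\<integral>\<^sup>+t. ennreal ((norm (f t))\<^sup>2) \<partial>lborel)"
  define u where "u z = (ennreal (norm (laplace f z)))\<^sup>2" for z
  have [measurable]: "u \<in> borel_measurable borel" unfolding u_def by measurable
  \<comment> \<open>When the sector lies on one side of the real axis only one half is kept: the
    estimate for the upper half asks for \<beta> \<ge> 0, the one for the lower half for \<alpha>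
    \<le> 0.\<close>
  define U V where "U = (if 0 \<le> \<beta> then upper_sector \<beta> else {})"
    and "V = (if \<alpha> \<le> 0 then cnj -` upper_sector (- \<alpha>) else {})"
  have [measurable]: "cnj -` upper_sector (- \<alpha>) \<in> sets borel"
    using measurable_sets[of cnj borel borel "upper_sector (- \<alpha>)"]
    by (simp add: borel_measurable_continuous_onI continuous_on_cnj)
  have [measurable]: "U \<in> sets borel" "V \<in> sets borel" unfolding U_def V_def by auto
  have sub: "sector \<alpha> \<beta> \<subseteq> U \<union> V"
  proof
    fix z assume z: "z \<in> sector \<alpha> \<beta>"
    then have e: "0 \<le> Re z" "0 \<le> eta \<alpha> z" "eta \<beta> z \<le> 0" unfolding sector_eq[OF ab] by auto
    have Arg: "z = 0 \<or> \<alpha> \<le> Arg z \<and> Arg z \<le> \<beta>" using z by (simp add: sector_def)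
    show "z \<in> U \<union> V"
    proof (cases "0 \<le> Im z \<and> 0 \<le> \<beta>")
      case True
      then show ?thesis using e by (simp add: U_def upper_sector_def eta_def algebra_simps)
    next
      case False
      have "\<alpha> \<le> 0 \<and> Im z \<le> 0"
      proof (cases "z = 0")
        case True
        then show ?thesis using False ab by simp
      next
        case nz: False
        have "Arg z < 0"
          using False Arg nz Arg_neg_iff[of z] by (cases "0 \<le> \<beta>") auto
        then show ?thesis using Arg nz Arg_neg_iff[of z] by auto
      qed
      then show ?thesis using e by (simp add: V_def upper_sector_def eta_def algebra_simps)
    qed
  qed
  have U_le: "(\<integral>\<^sup>+z. u z * indicator U z \<partial>\<mu>) \<le> ennreal (8 * pi * (6 * l + l')) * N"
    using laplace_upper_sector_le[OF \<mu>1(2) k(3,4) _ ab(3) f f0] by (auto simp: U_def u_def N_def)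
  have V_le: "(\<integral>\<^sup>+z. u z * indicator V z \<partial>\<mu>) \<le> ennreal (8 * pi * (6 * k + k')) * N"
    using laplace_lower_sector_le[OF \<mu>1(1) k(1,2) ab(1) _ f f0] by (auto simp: V_def u_def N_def)
  have "(\<integral>\<^sup>+z. u z \<partial>\<mu>) \<le> (\<integral>\<^sup>+z. u z * indicator U z + u z * indicator V z \<partial>\<mu>)"
  proof (rule nn_integral_mono_AE)
    show "AE z in \<mu>. u z \<le> u z * indicator U z + u z * indicator V z"
      using W2_AE[OF ab \<mu>]
    proof eventually_elim
      case (elim z)
      then have "z \<in> U \<or> z \<in> V" using sub by auto
      then show ?case by (auto simp: indicator_def)
    qed
  qed
  also have "\<dots> = (\<integral>\<^sup>+z. u z * indicator U z \<partial>\<mu>) + (\<integral>\<^sup>+z. u z * indicator V z \<partial>\<mu>)"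
    by (rule nn_integral_add) measurable
  also have "\<dots> \<le> ennreal (8 * pi * (6 * l + l')) * N + ennreal (8 * pi * (6 * k + k')) * N"
    by (rule add_mono[OF U_le V_le])
  also have "\<dots> = ennreal (8 * pi * (6 * l + l') + 8 * pi * (6 * k + k')) * N"
    using k by (subst ennreal_plus) (auto simp: distrib_right)
  also have "\<dots> \<le> ennreal (8 * pi * (sqrt (6 * k + k') + sqrt (6 * l + l'))\<^sup>2) * N"
  proof (intro mult_right_mono ennreal_leI)
    \<comment> \<open>The two halves give the sum of the two radicands, and a + b \<le> (sqrt a +
      sqrt b)^2.\<close>
    have "8 * pi * ((6 * l + l') + (6 * k + k')) \<le> 8 * pi * (sqrt (6 * k + k') + sqrt (6 * l + l'))\<^sup>2"
      using k by (intro mult_left_mono) (auto simp: power2_sum)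
    then show "8 * pi * (6 * l + l') + 8 * pi * (6 * k + k') \<le> 8 * pi * (sqrt (6 * k + k') + sqrt (6 * l + l'))\<^sup>2"
      by (simp only: distrib_left)
  qed simp
  finally show ?thesis by (simp add: u_def N_def)
qed

section \<open>Interpolation\<close>

lemma mult_le_abs:
  fixes a b :: real
  assumes "0 \<le> a" "a \<le> 1"
  shows "a * b \<le> \<bar>b\<bar>"
proof -
  have "a * b \<le> a * \<bar>b\<bar>" using assms by (intro mult_left_mono) auto
  also have "\<dots> \<le> 1 * \<bar>b\<bar>" using assms by (intro mult_right_mono) auto
  finally show ?thesis by simp
qed

text \<open>Dividing by exp w, with w affine and Re w equal to ln A0 and ln A1 on the two edges,
  normalises the edge bounds to 1. The strip is unbounded, so a factor exp (\<epsilon> (z^2 - 1))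
  enforces decay; the maximum principle on a large rectangle applies, and \<epsilon> tends to 0. The
  size of \<open>B\<close> drops out.\<close>

theorem three_lines:
  assumes holo: "\<Phi> holomorphic_on UNIV"
    and bdd: "\<And>z. 0 \<le> Re z \<Longrightarrow> Re z \<le> 1 \<Longrightarrow> norm (\<Phi> z) \<le> B"
    and b0: "\<And>z. Re z = 0 \<Longrightarrow> norm (\<Phi> z) \<le> A0" and b1: "\<And>z. Re z = 1 \<Longrightarrow> norm (\<Phi> z) \<le> A1"
    and A: "0 < A0" "0 < A1" and \<theta>: "0 \<le> \<theta>" "\<theta> \<le> 1"
  shows "norm (\<Phi> (of_real \<theta>)) \<le> A0 powr (1 - \<theta>) * A1 powr \<theta>"
proof -
  define w where "w z = (1 - z) * of_real (ln A0) + z * of_real (ln A1)" for z :: complex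
  have Re_w: "Re (w z) = (1 - Re z) * ln A0 + Re z * ln A1" for z by (simp add: w_def)
  define D where "D = exp (\<bar>ln A0\<bar> + \<bar>ln A1\<bar>)"
  have w_le: "exp (- Re (w z)) \<le> D" if "0 \<le> Re z" "Re z \<le> 1" for z
  proof -
    have "(1 - Re z) * (- ln A0) \<le> \<bar>ln A0\<bar>" "Re z * (- ln A1) \<le> \<bar>ln A1\<bar>"
      using that mult_le_abs[of "1 - Re z" "- ln A0"] mult_le_abs[of "Re z" "- ln A1"] by auto
    then show ?thesis unfolding D_def Re_w by simp
  qed
  have eps: "norm (\<Phi> (of_real \<theta>)) \<le> exp (\<epsilon> * (1 - \<theta>\<^sup>2)) * (A0 powr (1 - \<theta>) * A1 powr \<theta>)" if e: "\<epsilon> > 0" for \<epsilon> :: real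
  proof -
    \<comment> \<open>On the strip Re (z^2 - 1) \<le> - (Im z)^2, so the last factor is at most 1 on
      the vertical edges and at most exp (- \<epsilon> R^2) on the horizontal sides at height
      R.\<close>
    define \<Psi> where "\<Psi> z = \<Phi> z * exp (- w z) * exp (of_real \<epsilon> * (z\<^sup>2 - 1))" for z
    have norm_\<Psi>: "norm (\<Psi> z) = norm (\<Phi> z) * exp (- Re (w z)) * exp (\<epsilon> * ((Re z)\<^sup>2 - (Im z)\<^sup>2 - 1))" for z
      by (simp add: \<Psi>_def norm_mult power2_eq_square)
    have "((\<lambda>R. B * D * exp (- (\<epsilon> * R\<^sup>2))) \<longlongrightarrow> 0) at_top" using e by real_asymp
    then have "eventually (\<lambda>R. B * D * exp (- (\<epsilon> * R\<^sup>2)) < 1) at_top"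
      by (rule order_tendstoD) simp
    then have "eventually (\<lambda>R. B * D * exp (- (\<epsilon> * R\<^sup>2)) < 1 \<and> R > 0) at_top"
      using eventually_gt_at_top by (rule eventually_conj)
    then obtain R where R: "B * D * exp (- (\<epsilon> * R\<^sup>2)) < 1" "R > 0"
      using eventually_happens'[OF trivial_limit_at_top_linorder] by blast
    define S where "S = cbox (Complex 0 (- R)) (Complex 1 R)"
    have S: "z \<in> S \<longleftrightarrow> 0 \<le> Re z \<and> Re z \<le> 1 \<and> - R \<le> Im z \<and> Im z \<le> R" for z
      by (auto simp: S_def in_cbox_complex_iff)
    have B0: "0 \<le> B" using bdd[of 0] norm_ge_zero[of "\<Phi> 0"] by (simp del: norm_ge_zero)
    have "norm (\<Psi> (of_real \<theta>)) \<le> 1"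
    proof (rule maximum_modulus_frontier[of \<Psi> S 1 "of_real \<theta>"])
      show "\<Psi> holomorphic_on interior S"
        unfolding \<Psi>_def w_def by (intro holomorphic_intros holomorphic_on_subset[OF holo]) auto
      show "continuous_on (closure S) \<Psi>"
        unfolding \<Psi>_def w_def
        by (intro continuous_intros continuous_on_subset[OF holomorphic_on_imp_continuous_on[OF holo]]) auto
      show "bounded S" by (simp add: S_def)
      show "complex_of_real \<theta> \<in> S" using \<theta> R by (simp add: S)
      fix z assume "z \<in> frontier S"
      then have z: "z \<in> S" "z \<notin> box (Complex 0 (- R)) (Complex 1 R)"
        by (auto simp: S_def frontier_cbox)
      then consider "Re z = 0" | "Re z = 1" | "\<bar>Im z\<bar> = R"
        unfolding S in_box_complex_iff by fastforce
      then show "norm (\<Psi> z) \<le> 1"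
      proof cases
        case 1
        have "norm (\<Phi> z) * exp (- Re (w z)) \<le> A0 * exp (- Re (w z))"
          using b0[OF 1] by (intro mult_right_mono) auto
        also have "\<dots> = 1" using 1 A by (simp add: Re_w exp_minus)
        finally have le: "norm (\<Phi> z) * exp (- Re (w z)) \<le> 1" .
        have E: "exp (\<epsilon> * ((Re z)\<^sup>2 - (Im z)\<^sup>2 - 1)) \<le> 1"
          using 1 e by (auto intro!: mult_nonneg_nonpos order_trans[OF _ zero_le_power2])
        show ?thesis unfolding norm_\<Psi> by (rule mult_le_one[OF le exp_ge_zero E])
      next
        case 2
        have "norm (\<Phi> z) * exp (- Re (w z)) \<le> A1 * exp (- Re (w z))"
          using b1[OF 2] by (intro mult_right_mono) auto
        also have "\<dots> = 1" using 2 A by (simp add: Re_w exp_minus)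
        finally have le: "norm (\<Phi> z) * exp (- Re (w z)) \<le> 1" .
        have E: "exp (\<epsilon> * ((Re z)\<^sup>2 - (Im z)\<^sup>2 - 1)) \<le> 1"
          using 2 e mult_nonneg_nonpos[of \<epsilon> "- (Im z)\<^sup>2"] by simp
        show ?thesis unfolding norm_\<Psi> by (rule mult_le_one[OF le exp_ge_zero E])
      next
        case 3
        have "(Re z)\<^sup>2 \<le> 1" using z(1) by (simp add: S power_le_one)
        moreover have "(Im z)\<^sup>2 = R\<^sup>2" using 3 by (metis power2_abs)
        ultimately have "(Re z)\<^sup>2 - (Im z)\<^sup>2 - 1 \<le> - R\<^sup>2" by linarith
        then have "\<epsilon> * ((Re z)\<^sup>2 - (Im z)\<^sup>2 - 1) \<le> \<epsilon> * (- R\<^sup>2)"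
          using e by (intro mult_left_mono) auto
        then have "norm (\<Psi> z) \<le> B * D * exp (- (\<epsilon> * R\<^sup>2))"
          unfolding norm_\<Psi> using z(1) B0 bdd[of z] w_le[of z] by (intro mult_mono) (auto simp: S D_def)
        then show ?thesis using R by simp
      qed
    qed
    then have "norm (\<Phi> (of_real \<theta>)) * (exp (- Re (w (of_real \<theta>))) * exp (\<epsilon> * (\<theta>\<^sup>2 - 1))) \<le> 1"
      by (simp add: norm_\<Psi> mult.assoc)
    then have "norm (\<Phi> (of_real \<theta>)) \<le> exp (Re (w (of_real \<theta>))) * exp (\<epsilon> * (1 - \<theta>\<^sup>2))"
      by (simp add: field_simps exp_minus exp_diff)
    also have "exp (Re (w (of_real \<theta>))) = A0 powr (1 - \<theta>) * A1 powr \<theta>"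
      using A by (simp add: Re_w powr_def exp_add)
    finally show ?thesis by (simp add: mult.commute)
  qed
  have "((\<lambda>\<epsilon>. exp (\<epsilon> * (1 - \<theta>\<^sup>2)) * (A0 powr (1 - \<theta>) * A1 powr \<theta>)) \<longlongrightarrow>
      exp (0 * (1 - \<theta>\<^sup>2)) * (A0 powr (1 - \<theta>) * A1 powr \<theta>)) (at_right 0)"
    by (intro tendsto_intros)
  moreover have "eventually (\<lambda>\<epsilon>. norm (\<Phi> (of_real \<theta>)) \<le> exp (\<epsilon> * (1 - \<theta>\<^sup>2)) * (A0 powr (1 - \<theta>) * A1 powr \<theta>)) (at_right 0)"
    using eps by (auto intro: eventually_at_right_less[THEN eventually_mono])
  ultimately have "norm (\<Phi> (of_real \<theta>)) \<le> exp (0 * (1 - \<theta>\<^sup>2)) * (A0 powr (1 - \<theta>) * A1 powr \<theta>)"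
    by (rule tendsto_lowerbound) simp
  then show ?thesis by simp
qed

text \<open>The p-th power of the norm. Without the root it is a plain \<open>nn_integral\<close>,
  open to Fatou's lemma and dominated convergence; \<open>Lnorm_le_iff\<close> leads back to the
  norm.\<close>

definition powr_int :: "real \<Rightarrow> 'a measure \<Rightarrow> ('a \<Rightarrow> complex) \<Rightarrow> ennreal" where
  "powr_int p M f = (\<integral>\<^sup>+x. ennreal (norm (f x) powr p) \<partial>M)"

lemma powr_int_Fatou:
  assumes r: "r > 0" and u [measurable]: "\<And>k::nat. u k \<in> borel_measurable M"
    and lim: "AE x in M. (\<lambda>k. u k x) \<longlonglongrightarrow> g x"
  shows "powr_int r M g \<le> liminf (\<lambda>k. powr_int r M (u k))"
proof -
  have "powr_int r M g = (\<integral>\<^sup>+x. liminf (\<lambda>k. ennreal (norm (u k x) powr r)) \<partial>M)"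
    unfolding powr_int_def
  proof (rule nn_integral_cong_AE)
    show "AE x in M. ennreal (norm (g x) powr r) = liminf (\<lambda>k. ennreal (norm (u k x) powr r))"
      using lim
    proof eventually_elim
      case (elim x)
      have "(\<lambda>k. ennreal (norm (u k x) powr r)) \<longlonglongrightarrow> ennreal (norm (g x) powr r)"
        using elim r by (intro tendsto_ennrealI tendsto_powr' tendsto_norm tendsto_const) auto
      then show ?case by (rule lim_imp_Liminf[OF trivial_limit_sequentially, symmetric])
    qed
  qed
  also have "\<dots> \<le> liminf (\<lambda>k. powr_int r M (u k))"
    unfolding powr_int_def by (rule nn_integral_liminf) measurable
  finally show ?thesis .
qed

lemma simple_function_level_finite:
  assumes s: "simple_function M f" and p: "p > 0" and fin: "powr_int p M f < \<infinity>" and v: "v \<noteq> 0"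
  shows "emeasure M (f -` {v} \<inter> space M) < \<infinity>"
proof -
  have [measurable]: "f -` {v} \<inter> space M \<in> sets M" using s by (rule simple_functionD)
  have "ennreal (norm v powr p) * emeasure M (f -` {v} \<inter> space M)
      = (\<integral>\<^sup>+x. ennreal (norm v powr p) * indicator (f -` {v} \<inter> space M) x \<partial>M)"
    by (subst nn_integral_cmult_indicator) auto
  also have "\<dots> \<le> powr_int p M f"
    unfolding powr_int_def by (intro nn_integral_mono) (auto simp: indicator_def)
  finally have "ennreal (norm v powr p) * emeasure M (f -` {v} \<inter> space M) < \<infinity>"
    using fin by (rule le_less_trans)
  then show ?thesis using v by (auto simp: ennreal_mult_less_top)
qed

lemma simple_function_expand:
  assumes s: "simple_function M f" and h: "h 0 = (0::complex)" and x: "x \<in> space M"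
  shows "h (f x) = (\<Sum>v\<in>f ` space M - {0}. h v * indicator (f -` {v} \<inter> space M) x)"
proof -
  have fin: "finite (f ` space M - {0})" using s by (simp add: simple_function_def)
  have "(\<Sum>v\<in>f ` space M - {0}. h v * indicator (f -` {v} \<inter> space M) x)
      = (\<Sum>v\<in>f ` space M - {0}. if v = f x then h v else 0)"
    using x by (intro sum.cong) (auto simp: indicator_def)
  also have "\<dots> = (if f x \<in> f ` space M - {0} then h (f x) else 0)"
    using fin by (simp add: sum.delta')
  also have "\<dots> = h (f x)" using x h by auto
  finally show ?thesis by simp
qed

text \<open>The level sets of nonzero values have finite measure, whatever the exponent. So a simple
  function in L^p stays integrable after any change of its nonzero values, in particular after a
  twist.\<close>

lemma integrable_simple_compose:
  assumes s: "simple_function M f" and p: "p > 0" and fin: "powr_int p M f < \<infinity>" and h: "h 0 = (0::complex)"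
  shows "integrable M (\<lambda>x. h (f x))"
proof -
  have "integrable M (\<lambda>x. \<Sum>v\<in>f ` space M - {0}. h v * indicator (f -` {v} \<inter> space M) x)"
  proof (intro Bochner_Integration.integrable_sum integrable_mult_right)
    fix v assume "v \<in> f ` space M - {0}"
    then have "emeasure M (f -` {v} \<inter> space M) < \<infinity>"
      using simple_function_level_finite[OF s p fin] by auto
    moreover have "f -` {v} \<inter> space M \<in> sets M" using s by (rule simple_functionD)
    ultimately have "integrable M (indicator (f -` {v} \<inter> space M) :: 'a \<Rightarrow> real)"
      by (simp add: integrable_indicator_iff)
    then have "integrable M (\<lambda>x. complex_of_real (indicator (f -` {v} \<inter> space M) x))"
      by (rule integrable_of_real)
    then show "integrable M (indicator (f -` {v} \<inter> space M) :: 'a \<Rightarrow> complex)"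
      by (simp add: of_real_indicator)
  qed
  also have "integrable M (\<lambda>x. \<Sum>v\<in>f ` space M - {0}. h v * indicator (f -` {v} \<inter> space M) x)
      \<longleftrightarrow> integrable M (\<lambda>x. h (f x))"
    by (intro Bochner_Integration.integrable_cong refl) (simp add: simple_function_expand[where h = h, OF s h])
  finally show ?thesis .
qed

lemma space_Rplus [simp]: "space Rplus = {0<..}"
  by (simp add: Rplus_def space_restrict_space)

lemma integrable_laplace_kernel:
  assumes "integrable Rplus f" "0 \<le> Re z"
  shows "integrable Rplus (\<lambda>t. f t * exp (- (z * of_real t)))"
proof (rule Bochner_Integration.integrable_bound[OF assms(1)])
  have [measurable]: "f \<in> borel_measurable Rplus" "(\<lambda>t. t) \<in> borel_measurable Rplus"
    using assms(1) by (auto intro: borel_measurable_Rplus)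
  show "(\<lambda>t. f t * exp (- (z * of_real t))) \<in> borel_measurable Rplus" by measurable
  show "AE t in Rplus. norm (f t * exp (- (z * of_real t))) \<le> norm (f t)"
    using assms(2) by (intro AE_I2) (auto simp: norm_mult intro!: mult_left_le)
qed

lemma norm_laplace_le_L1:
  assumes "integrable Rplus f" "0 \<le> Re z"
  shows "norm (laplace f z) \<le> (\<integral>t. norm (f t) \<partial>Rplus)"
proof -
  have "norm (laplace f z) \<le> (\<integral>t. norm (f t * exp (- (z * of_real t))) \<partial>Rplus)"
    unfolding laplace_def by (rule integral_norm_bound)
  also have "\<dots> \<le> (\<integral>t. norm (f t) \<partial>Rplus)"
    using assms by (intro integral_mono integrable_norm integrable_laplace_kernel)
      (auto simp: norm_mult intro!: mult_left_le)
  finally show ?thesis .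
qed

text \<open>Thorin's analytic family: \<open>|w|\<close> is raised to the power \<open>p (1 - \<zeta> / 2)\<close> and the argument of
  \<open>w\<close> is kept, so \<open>L\<^sup>p\<close> functions become \<open>L\<^sup>1\<close> functions on \<open>Re \<zeta> = 0\<close> and \<open>L\<^sup>2\<close> functions on
  \<open>Re \<zeta> = 1\<close>.\<close>

definition twist :: "real \<Rightarrow> complex \<Rightarrow> complex \<Rightarrow> complex" where
  "twist p \<zeta> w = (if w = 0 then 0 else sgn w * exp (of_real p * (1 - \<zeta> / 2) * of_real (ln (norm w))))"

lemma twist_0 [simp]: "twist p \<zeta> 0 = 0"
  by (simp add: twist_def)

lemma norm_twist: "norm (twist p \<zeta> w) = norm w powr (p * (1 - Re \<zeta> / 2))"
  by (simp add: twist_def norm_mult norm_sgn powr_def)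

lemma twist_id:
  assumes "p * (1 - \<theta> / 2) = 1"
  shows "twist p (of_real \<theta>) w = w"
proof (cases "w = 0")
  case False
  have "of_real p * (1 - of_real \<theta> / 2) = (1 :: complex)"
    using arg_cong[OF assms, of complex_of_real] by simp
  then have "twist p (of_real \<theta>) w = sgn w * of_real (norm w)"
    using False exp_of_real[of "ln (norm w)", where 'a = complex] by (simp add: twist_def)
  then show ?thesis using False by (simp add: sgn_div_norm scaleR_conv_of_real)
qed simp

lemma twist_holomorphic: "(\<lambda>\<zeta>. twist p \<zeta> w) holomorphic_on UNIV"
  unfolding twist_def by (cases "w = 0") (auto intro!: holomorphic_intros)

lemma norm_twist_le:
  assumes "0 \<le> p" "0 \<le> Re \<zeta>" "Re \<zeta> \<le> 1"
  shows "norm (twist p \<zeta> w) \<le> exp (p * \<bar>ln (norm w)\<bar>)"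
proof (cases "w = 0")
  case False
  have "p * ((1 - Re \<zeta> / 2) * ln (norm w)) \<le> p * \<bar>ln (norm w)\<bar>"
    using assms by (intro mult_left_mono mult_le_abs) auto
  then show ?thesis using False by (simp add: norm_twist powr_def mult.assoc)
qed simp

section \<open>Riesz-Thorin interpolation for the Laplace transform\<close>

locale half_plane_measure =
  fixes \<mu> :: "complex measure"
  assumes sets_eq [measurable_cong]: "sets \<mu> = sets borel"
    and AE_Re: "AE z in \<mu>. 0 \<le> Re z"
begin

lemma measurable_laplace_\<mu> [measurable]:
  assumes "f \<in> borel_measurable Rplus"
  shows "laplace f \<in> borel_measurable \<mu>"
  using measurable_laplace[OF assms] by (simp add: measurable_cong_sets[OF sets_eq refl])

end

text \<open>The interpolation sees only the L^2 bound and the half-plane, no longer the projections.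
  Positivity of \<open>C\<close> makes the edge bounds in \<open>three_lines\<close>
  positive.\<close>

locale laplace_measure = half_plane_measure +
  fixes C :: real
  assumes L2_bound: "\<And>f. integrable Rplus f \<Longrightarrow>
      (\<integral>\<^sup>+z. (ennreal (norm (laplace f z)))\<^sup>2 \<partial>\<mu>) \<le> ennreal C * (\<integral>\<^sup>+t. ennreal ((norm (f t))\<^sup>2) \<partial>Rplus)"
    and C_pos: "C > 0"
begin

text \<open>The two end points in dual form: L^1 to L^\<infinity> tested against L^1, and L^2 to L^2
  tested against L^2.\<close>

lemma bilinear_bound:
  assumes f: "integrable Rplus f" and g: "g \<in> borel_measurable \<mu>"
  shows "ennreal (norm (\<integral>z. laplace f z * g z \<partial>\<mu>)) \<le> (\<integral>\<^sup>+t. norm (f t) \<partial>Rplus) * (\<integral>\<^sup>+z. norm (g z) \<partial>\<mu>)" (is ?A)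
    and "(ennreal (norm (\<integral>z. laplace f z * g z \<partial>\<mu>)))\<^sup>2 \<le>
      ennreal C * (\<integral>\<^sup>+t. ennreal ((norm (f t))\<^sup>2) \<partial>Rplus) * (\<integral>\<^sup>+z. ennreal ((norm (g z))\<^sup>2) \<partial>\<mu>)" (is ?B)
proof -
  note [measurable] = g
  have [measurable]: "f \<in> borel_measurable Rplus" using f by auto
  have le: "ennreal (norm (\<integral>z. laplace f z * g z \<partial>\<mu>)) \<le> (\<integral>\<^sup>+z. ennreal (norm (laplace f z)) * ennreal (norm (g z)) \<partial>\<mu>)"
    using ennreal_norm_integral_le[of \<mu> "\<lambda>z. laplace f z * g z"] by (simp add: norm_mult ennreal_mult)
  also have "\<dots> \<le> (\<integral>\<^sup>+z. (\<integral>\<^sup>+t. norm (f t) \<partial>Rplus) * ennreal (norm (g z)) \<partial>\<mu>)"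
  proof (rule nn_integral_mono_AE)
    show "AE z in \<mu>. ennreal (norm (laplace f z)) * ennreal (norm (g z)) \<le> (\<integral>\<^sup>+t. norm (f t) \<partial>Rplus) * ennreal (norm (g z))"
      using AE_Re
    proof eventually_elim
      case (elim z)
      have "ennreal (norm (laplace f z)) \<le> ennreal (\<integral>t. norm (f t) \<partial>Rplus)"
        by (intro ennreal_leI norm_laplace_le_L1[OF f elim])
      also have "\<dots> = (\<integral>\<^sup>+t. norm (f t) \<partial>Rplus)"
        using f by (subst nn_integral_eq_integral) auto
      finally show ?case by (rule mult_right_mono) simp
    qed
  qed
  also have "\<dots> = (\<integral>\<^sup>+t. norm (f t) \<partial>Rplus) * (\<integral>\<^sup>+z. norm (g z) \<partial>\<mu>)"
    by (rule nn_integral_cmult) measurable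
  finally show ?A .
  have "(ennreal (norm (\<integral>z. laplace f z * g z \<partial>\<mu>)))\<^sup>2 \<le> (\<integral>\<^sup>+z. ennreal (norm (laplace f z)) * ennreal (norm (g z)) \<partial>\<mu>)\<^sup>2"
    using le by (rule power_mono) simp
  also have "\<dots> \<le> (\<integral>\<^sup>+z. (ennreal (norm (laplace f z)))\<^sup>2 \<partial>\<mu>) * (\<integral>\<^sup>+z. (ennreal (norm (g z)))\<^sup>2 \<partial>\<mu>)"
    by (rule Cauchy_Schwarz_nn_integral) measurable
  also have "\<dots> \<le> (ennreal C * (\<integral>\<^sup>+t. ennreal ((norm (f t))\<^sup>2) \<partial>Rplus)) * (\<integral>\<^sup>+z. (ennreal (norm (g z)))\<^sup>2 \<partial>\<mu>)"
    by (rule mult_right_mono[OF L2_bound[OF f]]) simp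
  finally show ?B by (simp add: ennreal_power)
qed

text \<open>Expanding both simple functions makes the pairing a finite bilinear expression whose
  inner integrals do not involve \<open>h\<close> and \<open>k\<close>. With twists for
  \<open>h\<close> and \<open>k\<close> it is visibly an entire function of the parameter.\<close>

lemma bilinear_simple:
  assumes f: "simple_function Rplus f" "powr_int p Rplus f < \<infinity>"
    and g: "simple_function \<mu> g" "powr_int p \<mu> g < \<infinity>" and p: "p > 0"
    and h: "h 0 = (0::complex)" "k 0 = (0::complex)"
  shows "(\<integral>z. laplace (\<lambda>t. h (f t)) z * k (g z) \<partial>\<mu>) =
    (\<Sum>v\<in>f ` space Rplus - {0}. \<Sum>w\<in>g ` space \<mu> - {0}. h v * k w *
      (\<integral>z. laplace (indicator (f -` {v} \<inter> space Rplus)) z * indicator (g -` {w} \<inter> space \<mu>) z \<partial>\<mu>))"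
proof -
  define F G where "F = f ` space Rplus - {0}" and "G = g ` space \<mu> - {0}"
  define E D where "E v = f -` {v} \<inter> space Rplus" and "D w = g -` {w} \<inter> space \<mu>" for v w
  have E: "integrable Rplus (indicator (E v) :: real \<Rightarrow> complex)" if "v \<in> F" for v
  proof -
    have "integrable Rplus (\<lambda>t. of_bool (f t = v) :: complex)"
      using that by (intro integrable_simple_compose[OF f(1) p f(2)]) (auto simp: F_def)
    then show ?thesis
      by (rule Bochner_Integration.integrable_cong[THEN iffD1, rotated -1]) (auto simp: E_def indicator_def)
  qed
  have D: "integrable \<mu> (indicator (D w) :: complex \<Rightarrow> complex)" if "w \<in> G" for w
  proof -
    have "integrable \<mu> (\<lambda>z. of_bool (g z = w) :: complex)"
      using that by (intro integrable_simple_compose[OF g(1) p g(2)]) (auto simp: G_def)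
    then show ?thesis
      by (rule Bochner_Integration.integrable_cong[THEN iffD1, rotated -1]) (auto simp: D_def indicator_def)
  qed
  have lap: "laplace (\<lambda>t. h (f t)) z = (\<Sum>v\<in>F. h v * laplace (indicator (E v)) z)" if "0 \<le> Re z" for z
  proof -
    have "laplace (\<lambda>t. h (f t)) z = (\<integral>t. (\<Sum>v\<in>F. h v * (indicator (E v) t * exp (- (z * of_real t)))) \<partial>Rplus)"
      unfolding laplace_def
      by (intro Bochner_Integration.integral_cong refl)
         (simp only: simple_function_expand[where h = h, OF f(1) h(1)] F_def E_def sum_distrib_right mult.assoc)
    also have "\<dots> = (\<Sum>v\<in>F. h v * laplace (indicator (E v)) z)"
      unfolding laplace_def using integrable_laplace_kernel[OF E that]
      by (subst Bochner_Integration.integral_sum) auto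
    finally show ?thesis .
  qed
  have int: "integrable \<mu> (\<lambda>z. laplace (indicator (E v)) z * indicator (D w) z)" if "v \<in> F" "w \<in> G" for v w
  proof (rule Bochner_Integration.integrable_bound)
    have [measurable]: "(indicator (E v) :: real \<Rightarrow> complex) \<in> borel_measurable Rplus" using E[OF that(1)] by auto
    have [measurable]: "(indicator (D w) :: complex \<Rightarrow> complex) \<in> borel_measurable \<mu>" using D[OF that(2)] by auto
    show "integrable \<mu> (\<lambda>z. (\<integral>t. norm (indicator (E v) t :: complex) \<partial>Rplus) * norm (indicator (D w) z :: complex))"
      using D[OF that(2)] by simp
    show "(\<lambda>z. laplace (indicator (E v)) z * indicator (D w) z) \<in> borel_measurable \<mu>" by measurable
    show "AE z in \<mu>. norm (laplace (indicator (E v)) z * indicator (D w) z)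
        \<le> norm ((\<integral>t. norm (indicator (E v) t :: complex) \<partial>Rplus) * norm (indicator (D w) z :: complex))"
      using AE_Re
    proof eventually_elim
      case (elim z)
      then show ?case
        using norm_laplace_le_L1[OF E[OF that(1)] elim]
        by (auto simp: norm_mult intro!: mult_right_mono)
    qed
  qed
  have meas_h: "(\<lambda>t. h (f t)) \<in> borel_measurable Rplus"
    using integrable_simple_compose[where h = h, OF f(1) p f(2) h(1)] by auto
  have meas_k: "(\<lambda>z. k (g z)) \<in> borel_measurable \<mu>"
    using integrable_simple_compose[where h = k, OF g(1) p g(2) h(2)] by auto
  have meas_E: "laplace (indicator (E v)) \<in> borel_measurable \<mu>" if "v \<in> F" for v
    using E[OF that] by (intro measurable_laplace_\<mu>) auto
  have meas_D: "(indicator (D w) :: complex \<Rightarrow> complex) \<in> borel_measurable \<mu>" if "w \<in> G" for w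
    using D[OF that] by auto
  have "(\<integral>z. laplace (\<lambda>t. h (f t)) z * k (g z) \<partial>\<mu>)
      = (\<integral>z. (\<Sum>v\<in>F. \<Sum>w\<in>G. h v * k w * (laplace (indicator (E v)) z * indicator (D w) z)) \<partial>\<mu>)"
  proof (rule integral_cong_AE)
    show "AE z in \<mu>. laplace (\<lambda>t. h (f t)) z * k (g z)
        = (\<Sum>v\<in>F. \<Sum>w\<in>G. h v * k w * (laplace (indicator (E v)) z * indicator (D w) z))"
      using AE_Re AE_space
    proof eventually_elim
      case (elim z)
      have "k (g z) = (\<Sum>w\<in>G. k w * indicator (D w) z)"
        unfolding G_def D_def by (rule simple_function_expand[where h = k, OF g(1) h(2) elim(2)])
      then have "laplace (\<lambda>t. h (f t)) z * k (g z)
          = (\<Sum>v\<in>F. \<Sum>w\<in>G. (h v * laplace (indicator (E v)) z) * (k w * indicator (D w) z))"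
        by (simp only: lap[OF elim(1)] sum_product)
      then show ?case by (simp add: mult_ac)
    qed
    show "(\<lambda>z. \<Sum>v\<in>F. \<Sum>w\<in>G. h v * k w * (laplace (indicator (E v)) z * indicator (D w) z)) \<in> borel_measurable \<mu>"
      by (intro borel_measurable_sum borel_measurable_times borel_measurable_const meas_E meas_D)
  qed (intro borel_measurable_times measurable_laplace_\<mu> meas_h meas_k)
  also have "\<dots> = (\<Sum>v\<in>F. \<Sum>w\<in>G. h v * k w * (\<integral>z. laplace (indicator (E v)) z * indicator (D w) z \<partial>\<mu>))"
    using int by (subst Bochner_Integration.integral_sum; (intro Bochner_Integration.integrable_sum integrable_mult_right)?)
      (auto intro!: sum.cong simp: Bochner_Integration.integral_sum)
  finally show ?thesis by (simp add: F_def G_def E_def D_def)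
qed

text \<open>The dual of L^q, for the conjugate exponent q of p, is L^p, so both functions are
  twisted with the same p. At \<theta> = 2 - 2 / p the twist is the identity, and the edge bounds a
  b and sqrt (C a b) combine to the exponents 1 - \<theta> / 2 = 1 / p for a b and \<theta> / 2 = 1
  - 1 / p for C.\<close>

lemma riesz_thorin_bilinear:
  assumes f: "simple_function Rplus f" "powr_int p Rplus f = ennreal a"
    and g: "simple_function \<mu> g" "powr_int p \<mu> g = ennreal b"
    and ab: "a > 0" "b > 0" and p: "1 < p" "p \<le> 2"
  shows "norm (\<integral>z. laplace f z * g z \<partial>\<mu>) \<le> C powr (1 - 1 / p) * (a * b) powr (1 / p)"
proof -
  define F G where "F = f ` space Rplus - {0}" and "G = g ` space \<mu> - {0}"
  have fin: "finite F" "finite G" using f(1) g(1) by (auto simp: F_def G_def simple_function_def)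
  define c where "c v w = (\<integral>z. laplace (indicator (f -` {v} \<inter> space Rplus)) z * indicator (g -` {w} \<inter> space \<mu>) z \<partial>\<mu>)" for v w
  define \<Phi> where "\<Phi> \<zeta> = (\<Sum>v\<in>F. \<Sum>w\<in>G. twist p \<zeta> v * twist p \<zeta> w * c v w)" for \<zeta>
  have p0: "p > 0" using p by simp
  have finp: "powr_int p Rplus f < \<infinity>" "powr_int p \<mu> g < \<infinity>" by (simp_all add: f g)
  have \<Phi>: "\<Phi> \<zeta> = (\<integral>z. laplace (\<lambda>t. twist p \<zeta> (f t)) z * twist p \<zeta> (g z) \<partial>\<mu>)" for \<zeta>
    unfolding \<Phi>_def F_def G_def c_def
    by (rule bilinear_simple[OF f(1) finp(1) g(1) finp(2) p0, symmetric]) auto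
  have int_f: "integrable Rplus (\<lambda>t. twist p \<zeta> (f t))" for \<zeta>
    by (rule integrable_simple_compose[OF f(1) p0 finp(1)]) simp
  have int_g: "(\<lambda>z. twist p \<zeta> (g z)) \<in> borel_measurable \<mu>" for \<zeta>
    using integrable_simple_compose[OF g(1) p0 finp(2), of "twist p \<zeta>"] by auto
  define \<theta> where "\<theta> = 2 - 2 / p"
  have \<theta>: "0 \<le> \<theta>" "\<theta> \<le> 1" "p * (1 - \<theta> / 2) = 1" using p by (auto simp: \<theta>_def field_simps)
  \<comment> \<open>Only finiteness matters here: the twisted values are bounded on the whole strip
    by \<open>norm_twist_le\<close>.\<close>
  define B where "B = (\<Sum>v\<in>F. \<Sum>w\<in>G. exp (p * \<bar>ln (norm v)\<bar>) * exp (p * \<bar>ln (norm w)\<bar>) * norm (c v w))"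
  have "norm (\<Phi> (of_real \<theta>)) \<le> (a * b) powr (1 - \<theta>) * sqrt (C * a * b) powr \<theta>"
  proof (rule three_lines[where B = B])
    show "\<Phi> holomorphic_on UNIV"
      unfolding \<Phi>_def by (intro holomorphic_intros twist_holomorphic)
    show "norm (\<Phi> z) \<le> B" if "0 \<le> Re z" "Re z \<le> 1" for z
      unfolding \<Phi>_def B_def using that p
      by (intro sum_norm_le) (auto simp: norm_mult intro!: mult_mono norm_twist_le)
    show "norm (\<Phi> z) \<le> a * b" if "Re z = 0" for z
    proof -
      have "ennreal (norm (\<Phi> z)) \<le> ennreal a * ennreal b"
        unfolding \<Phi> using bilinear_bound(1)[OF int_f int_g, of z z] that
        by (simp add: norm_twist f(2)[symmetric] g(2)[symmetric] powr_int_def)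
      then show ?thesis using ab by (simp flip: ennreal_mult)
    qed
    show "norm (\<Phi> z) \<le> sqrt (C * a * b)" if "Re z = 1" for z
    proof -
      have sq: "(norm w powr (p * (1 - 1 / 2)))\<^sup>2 = norm w powr p" for w :: complex
        by (simp add: powr_def exp_double[symmetric] flip: exp_add)
      have "(ennreal (norm (\<Phi> z)))\<^sup>2 \<le> ennreal C * ennreal a * ennreal b"
        unfolding \<Phi> using bilinear_bound(2)[OF int_f int_g, of z z] that
        by (simp only: norm_twist f(2)[symmetric] g(2)[symmetric] powr_int_def sq)
      then have "(norm (\<Phi> z))\<^sup>2 \<le> C * a * b"
        using ab C_pos by (simp add: ennreal_power flip: ennreal_mult)
      then show ?thesis by (rule real_le_rsqrt)
    qed
  qed (use ab C_pos \<theta> in auto)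
  also have "(a * b) powr (1 - \<theta>) * sqrt (C * a * b) powr \<theta> = C powr (1 - 1 / p) * (a * b) powr (1 / p)"
  proof -
    have "sqrt (C * a * b) powr \<theta> = (C * (a * b)) powr (\<theta> / 2)"
      using ab C_pos by (simp add: powr_half_sqrt[symmetric] powr_powr mult.assoc)
    also have "\<dots> = C powr (\<theta> / 2) * (a * b) powr (\<theta> / 2)"
      by (rule powr_mult)
    finally have "(a * b) powr (1 - \<theta>) * sqrt (C * a * b) powr \<theta> = C powr (\<theta> / 2) * ((a * b) powr (1 - \<theta>) * (a * b) powr (\<theta> / 2))"
      by (simp add: mult_ac)
    also have "(a * b) powr (1 - \<theta>) * (a * b) powr (\<theta> / 2) = (a * b) powr (1 - \<theta> + \<theta> / 2)"
      by (rule powr_add[symmetric])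
    also have "1 - \<theta> + \<theta> / 2 = 1 / p" by (simp add: \<theta>_def field_simps)
    also have "\<theta> / 2 = 1 - 1 / p" by (simp add: \<theta>_def)
    finally show ?thesis .
  qed
  finally show ?thesis
    by (simp add: \<Phi> twist_id[OF \<theta>(3)])
qed

end

lemma powr_minus_2_mult_square:
  fixes x :: real
  assumes "x \<ge> 0"
  shows "x powr (q - 2) * x\<^sup>2 = x powr q"
proof (cases "x = 0")
  case False
  have "x powr (q - 2) * x powr 2 = x powr q"
    by (simp only: powr_add[symmetric]) simp
  then show ?thesis using assms by simp
qed simp

lemma simple_approx:
  assumes "f \<in> borel_measurable M"
  obtains s where "\<And>n. simple_function M (s n)"
    "\<And>x. x \<in> space M \<Longrightarrow> (\<lambda>n. s n x) \<longlonglongrightarrow> (f x :: complex)"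
    "\<And>n x. x \<in> space M \<Longrightarrow> norm (s n x) \<le> 2 * norm (f x)"
  using borel_measurable_implies_sequence_metric[OF assms, of 0] that by (auto simp: dist_norm) metis

lemma powr_int_dominated_convergence:
  assumes s: "\<And>n. s n \<in> borel_measurable M" and f: "f \<in> borel_measurable M"
    and lim: "\<And>x. x \<in> space M \<Longrightarrow> (\<lambda>n. s n x) \<longlonglongrightarrow> f x"
    and le: "\<And>n x. x \<in> space M \<Longrightarrow> norm (s n x) \<le> c * norm (g x)"
    and g: "g \<in> borel_measurable M" and fin: "powr_int p M g < \<infinity>" and p: "p > 0" and c: "c \<ge> 0"
  shows "(\<lambda>n. powr_int p M (s n)) \<longlonglongrightarrow> powr_int p M f"
  unfolding powr_int_def
proof (rule nn_integral_dominated_convergence)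
  note [measurable] = s f g
  show "AE x in M. ennreal (norm (s n x) powr p) \<le> ennreal (c powr p) * ennreal (norm (g x) powr p)" for n
  proof (rule AE_I2)
    fix x assume "x \<in> space M"
    then have "norm (s n x) powr p \<le> (c * norm (g x)) powr p"
      using le p by (intro powr_mono2) auto
    then show "ennreal (norm (s n x) powr p) \<le> ennreal (c powr p) * ennreal (norm (g x) powr p)"
      using c by (simp add: powr_mult ennreal_leI flip: ennreal_mult)
  qed
  show "(\<integral>\<^sup>+x. ennreal (c powr p) * ennreal (norm (g x) powr p) \<partial>M) < \<infinity>"
    using fin by (simp add: nn_integral_cmult powr_int_def ennreal_mult_less_top)
  show "AE x in M. (\<lambda>n. ennreal (norm (s n x) powr p)) \<longlonglongrightarrow> ennreal (norm (f x) powr p)"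
    using lim p by (intro AE_I2 tendsto_ennrealI tendsto_powr' tendsto_norm tendsto_const) auto
qed (use s f g in measurable)

context laplace_measure
begin

text \<open>Duality: test u = \<open>laplace f\<close> against the extremal function of Hoelder's
  inequality. For the integral I of |u|^q this gives I \<le> const * I^(1/p), and dividing requires
  that I is known to be finite.\<close>

lemma riesz_thorin_simple:
  assumes f: "simple_function Rplus f" "powr_int p Rplus f = ennreal a" and a: "a > 0"
    and p: "1 < p" "p \<le> 2" and q: "q = p / (p - 1)"
  shows "powr_int q \<mu> (laplace f) \<le> ennreal (C * a powr (q - 1))"
proof -
  have p0: "p > 0" using p by simp
  have q2: "q \<ge> 2" and q0: "q > 0" using p by (simp_all add: q field_simps)
  have qp: "(q - 1) * p = q" using p by (simp add: q field_simps)
  have int: "integrable Rplus f"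
    using integrable_simple_compose[where h = "\<lambda>x. x", OF f(1) p0] by (simp add: f)
  have [measurable]: "f \<in> borel_measurable Rplus" using int by auto
  define u where "u = laplace f"
  have [measurable]: "u \<in> borel_measurable \<mu>" unfolding u_def by measurable
  define A where "A = (\<integral>t. norm (f t) \<partial>Rplus)"
  have A0: "A \<ge> 0" by (simp add: A_def)
  \<comment> \<open>Finiteness first: \<open>u\<close> is bounded by the L^1 norm \<open>A\<close>
    on the half-plane and q \<ge> 2, so |u|^q \<le> A^(q-2) |u|^2.\<close>
  have "powr_int q \<mu> u \<le> (\<integral>\<^sup>+z. ennreal (A powr (q - 2)) * (ennreal (norm (u z)))\<^sup>2 \<partial>\<mu>)"
    unfolding powr_int_def
  proof (rule nn_integral_mono_AE)
    show "AE z in \<mu>. ennreal (norm (u z) powr q) \<le> ennreal (A powr (q - 2)) * (ennreal (norm (u z)))\<^sup>2"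
      using AE_Re
    proof eventually_elim
      case (elim z)
      have "norm (u z) \<le> A" unfolding u_def A_def by (rule norm_laplace_le_L1[OF int elim])
      have "norm (u z) powr q = norm (u z) powr (q - 2) * (norm (u z))\<^sup>2"
        by (simp add: powr_minus_2_mult_square)
      also have "\<dots> \<le> A powr (q - 2) * (norm (u z))\<^sup>2"
        using \<open>norm (u z) \<le> A\<close> q2 by (intro mult_right_mono powr_mono2) auto
      finally show ?case by (simp add: ennreal_leI ennreal_power flip: ennreal_mult)
    qed
  qed
  also have "\<dots> \<le> ennreal (A powr (q - 2)) * (ennreal C * (\<integral>\<^sup>+t. ennreal ((norm (f t))\<^sup>2) \<partial>Rplus))"
    using L2_bound[OF int] by (simp add: nn_integral_cmult u_def mult_left_mono)
  also have "\<dots> < \<infinity>"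
  proof -
    have "integrable Rplus (\<lambda>t. complex_of_real ((norm (f t))\<^sup>2))"
      by (rule integrable_simple_compose[where h = "\<lambda>x. complex_of_real ((norm x)\<^sup>2)", OF f(1) p0]) (simp_all add: f)
    then have "integrable Rplus (\<lambda>t. (norm (f t))\<^sup>2)"
      unfolding complex_of_real_integrable_eq .
    then have "(\<integral>\<^sup>+t. ennreal ((norm (f t))\<^sup>2) \<partial>Rplus) < \<infinity>"
      by (subst nn_integral_eq_integral) auto
    then show ?thesis by (simp add: ennreal_mult_less_top)
  qed
  finally have fin: "powr_int q \<mu> u < \<infinity>" .
  then obtain I where I: "powr_int q \<mu> u = ennreal I" "I \<ge> 0"
    by (cases "powr_int q \<mu> u") auto
  show ?thesis
  proof (cases "I = 0")
    case True
    then show ?thesis using I by (simp add: u_def)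
  next
    case False
    then have I0: "I > 0" using I by simp
    \<comment> \<open>The extremal function: u G = |u|^q and, since (q - 1) p = q, also |G|^p =
      |u|^q.\<close>
    define G where "G z = of_real (norm (u z) powr (q - 2)) * cnj (u z)" for z
    have [measurable]: "cnj \<in> borel_measurable borel"
      by (intro borel_measurable_continuous_onI continuous_intros)
    have [measurable]: "G \<in> borel_measurable \<mu>" unfolding G_def by measurable
    have norm_G: "norm (G z) = norm (u z) powr (q - 1)" for z
    proof (cases "u z = 0")
      case False
      then have "norm (u z) powr (q - 2) * norm (u z) powr 1 = norm (u z) powr (q - 1)"
        by (simp only: powr_add[symmetric]) simp
      then show ?thesis using False by (simp add: G_def norm_mult)
    qed (simp add: G_def)
    have G_p: "powr_int p \<mu> G = ennreal I"
      unfolding I(1)[symmetric] powr_int_def norm_G powr_powr qp ..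
    have uG: "u z * G z = of_real (norm (u z) powr q)" for z
    proof -
      have "complex_of_real (norm (u z) powr (q - 2)) * of_real ((norm (u z))\<^sup>2) = of_real (norm (u z) powr q)"
        by (simp only: of_real_mult[symmetric] powr_minus_2_mult_square norm_ge_zero)
      then show ?thesis by (simp only: G_def complex_norm_square mult_ac)
    qed
    have int_q: "integrable \<mu> (\<lambda>z. norm (u z) powr q)"
      using fin by (intro integrableI_bounded) (auto simp: powr_int_def)
    have I_eq: "(\<integral>z. u z * G z \<partial>\<mu>) = of_real I"
    proof -
      have "ennreal I = ennreal (\<integral>z. norm (u z) powr q \<partial>\<mu>)"
        unfolding I(1)[symmetric] powr_int_def using int_q by (subst nn_integral_eq_integral) auto
      then have "I = (\<integral>z. norm (u z) powr q \<partial>\<mu>)" using I by (simp add: ennreal_inj)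
      then show ?thesis unfolding uG by (simp add: integral_complex_of_real)
    qed
    \<comment> \<open>The bilinear bound covers simple functions only, so \<open>G\<close> is
      approximated by simple functions dominated by 2 |G|.\<close>
    obtain s where s: "\<And>n. simple_function \<mu> (s n)"
      "\<And>z. z \<in> space \<mu> \<Longrightarrow> (\<lambda>n. s n z) \<longlonglongrightarrow> G z"
      "\<And>n z. z \<in> space \<mu> \<Longrightarrow> norm (s n z) \<le> 2 * norm (G z)"
      using simple_approx[of G \<mu>] by auto
    have [measurable]: "s n \<in> borel_measurable \<mu>" for n using s(1) by (rule borel_measurable_simple_function)
    have lim_b: "(\<lambda>n. powr_int p \<mu> (s n)) \<longlonglongrightarrow> ennreal I"
      unfolding G_p[symmetric]
      by (rule powr_int_dominated_convergence[where c = 2 and g = G]) (use s p0 G_p in auto)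
    have lim_i: "(\<lambda>n. \<integral>z. u z * s n z \<partial>\<mu>) \<longlonglongrightarrow> (\<integral>z. u z * G z \<partial>\<mu>)"
    proof (rule integral_dominated_convergence[where w = "\<lambda>z. 2 * (norm (u z) powr q)"])
      show "AE z in \<mu>. (\<lambda>n. u z * s n z) \<longlonglongrightarrow> u z * G z"
        using s(2) by (intro AE_I2 tendsto_intros)
      show "AE z in \<mu>. norm (u z * s n z) \<le> 2 * norm (u z) powr q" for n
      proof (rule AE_I2)
        fix z assume "z \<in> space \<mu>"
        then have "norm (u z * s n z) \<le> norm (u z) * (2 * norm (G z))"
          unfolding norm_mult using s(3) by (intro mult_left_mono) auto
        also have "\<dots> = 2 * norm (u z * G z)" by (simp add: norm_mult)
        finally show "norm (u z * s n z) \<le> 2 * norm (u z) powr q" by (simp add: uG)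
      qed
    qed (use int_q in auto)
    have fin_s: "powr_int p \<mu> (s n) < \<infinity>" for n
    proof -
      have "powr_int p \<mu> (s n) \<le> (\<integral>\<^sup>+z. ennreal (2 powr p) * ennreal (norm (G z) powr p) \<partial>\<mu>)"
        unfolding powr_int_def
      proof (rule nn_integral_mono)
        fix z assume "z \<in> space \<mu>"
        then have "norm (s n z) powr p \<le> (2 * norm (G z)) powr p"
          using s(3) p by (intro powr_mono2) auto
        then show "ennreal (norm (s n z) powr p) \<le> ennreal (2 powr p) * ennreal (norm (G z) powr p)"
          by (simp add: powr_mult ennreal_leI flip: ennreal_mult)
      qed
      also have "\<dots> = ennreal (2 powr p) * ennreal I"
        by (subst nn_integral_cmult) (auto simp: G_p[symmetric] powr_int_def)
      also have "\<dots> < \<infinity>" by (simp add: ennreal_mult_less_top)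
      finally show ?thesis .
    qed
    define b where "b n = enn2real (powr_int p \<mu> (s n))" for n
    have b: "powr_int p \<mu> (s n) = ennreal (b n)" for n
      using fin_s[of n] by (simp add: b_def)
    have b0: "b n \<ge> 0" for n by (simp add: b_def)
    have "(\<lambda>n. b n) \<longlonglongrightarrow> I"
      using lim_b I unfolding b by (simp add: b0)
    then have "(\<lambda>n. C powr (1 - 1 / p) * (a * b n) powr (1 / p)) \<longlonglongrightarrow> C powr (1 - 1 / p) * (a * I) powr (1 / p)"
      using I0 a by (intro tendsto_intros) auto
    moreover have "norm (\<integral>z. u z * s n z \<partial>\<mu>) \<le> C powr (1 - 1 / p) * (a * b n) powr (1 / p)" if "b n > 0" for n
      unfolding u_def by (rule riesz_thorin_bilinear[OF f s(1) b a that p])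
    moreover have "eventually (\<lambda>n. b n > 0) sequentially"
      using \<open>(\<lambda>n. b n) \<longlonglongrightarrow> I\<close> I0 by (rule order_tendstoD)
    ultimately have "norm (\<integral>z. u z * G z \<partial>\<mu>) \<le> C powr (1 - 1 / p) * (a * I) powr (1 / p)"
      by (intro tendsto_le[OF _ _ tendsto_norm[OF lim_i]]) (auto elim: eventually_mono)
    then have le: "I \<le> C powr (1 / q) * (a powr (1 / p) * I powr (1 / p))"
    proof -
      assume "norm (\<integral>z. u z * G z \<partial>\<mu>) \<le> C powr (1 - 1 / p) * (a * I) powr (1 / p)"
      moreover have "1 - 1 / p = 1 / q" using p by (simp add: q field_simps)
      ultimately show ?thesis using I0 by (simp add: I_eq powr_mult)
    qed
    have "I powr (1 / q) * I powr (1 / p) = I"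
    proof -
      have "1 / q + 1 / p = 1" using p by (simp add: q field_simps)
      then show ?thesis using I0 by (simp flip: powr_add)
    qed
    then have "I powr (1 / q) * I powr (1 / p) \<le> (C powr (1 / q) * a powr (1 / p)) * I powr (1 / p)"
      using le by (simp add: mult.assoc)
    then have "I powr (1 / q) \<le> C powr (1 / q) * a powr (1 / p)"
      using I0 by simp
    then have "(I powr (1 / q)) powr q \<le> (C powr (1 / q) * a powr (1 / p)) powr q"
      using q0 by (intro powr_mono2) auto
    also have "\<dots> = C * a powr (q / p)"
      using q0 C_pos by (simp add: powr_mult powr_powr)
    also have "q / p = q - 1" using p by (simp add: q field_simps)
    finally have "I \<le> C * a powr (q - 1)" using I0 q0 by (simp add: powr_powr)
    then show ?thesis using I by (simp add: u_def ennreal_leI)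
  qed
qed

text \<open>Simple approximations dominated by 2 |f| give convergence of the p-th power integrals
  and, at every point of the half-plane, of the transforms; Fatou's lemma carries the bound
  over.\<close>

theorem riesz_thorin:
  assumes f: "integrable Rplus f" "powr_int p Rplus f = ennreal a" and a: "a \<ge> 0"
    and p: "1 < p" "p \<le> 2" and q: "q = p / (p - 1)"
  shows "powr_int q \<mu> (laplace f) \<le> ennreal (C * a powr (q - 1))"
proof -
  have p0: "p > 0" using p by simp
  have q2: "q \<ge> 2" and q0: "q > 0" using p by (simp_all add: q field_simps)
  have [measurable]: "f \<in> borel_measurable Rplus" using f by auto
  obtain s where s: "\<And>n. simple_function Rplus (s n)"
    "\<And>t. t \<in> space Rplus \<Longrightarrow> (\<lambda>n. s n t) \<longlonglongrightarrow> f t"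
    "\<And>n t. t \<in> space Rplus \<Longrightarrow> norm (s n t) \<le> 2 * norm (f t)"
    using simple_approx[of f Rplus] by auto
  have s_meas [measurable]: "s n \<in> borel_measurable Rplus" for n using s(1) by (rule borel_measurable_simple_function)
  have lim_a: "(\<lambda>n. powr_int p Rplus (s n)) \<longlonglongrightarrow> ennreal a"
    unfolding f(2)[symmetric]
    by (rule powr_int_dominated_convergence[where c = 2 and g = f]) (use s p0 f in auto)
  have int_s: "integrable Rplus (s n)" for n
    using f(1) s(3)[of _ n] by (intro Bochner_Integration.integrable_bound[OF integrable_mult_right[of 2, OF integrable_norm[OF f(1)]]] s_meas AE_I2) auto
  have lim_L: "(\<lambda>n. laplace (s n) z) \<longlonglongrightarrow> laplace f z" if "0 \<le> Re z" for z
    unfolding laplace_def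
  proof (rule integral_dominated_convergence[where w = "\<lambda>t. 2 * norm (f t)"])
    show "AE t in Rplus. (\<lambda>n. s n t * exp (- (z * of_real t))) \<longlonglongrightarrow> f t * exp (- (z * of_real t))"
      using s(2) by (intro AE_I2 tendsto_intros)
    show "AE t in Rplus. norm (s n t * exp (- (z * of_real t))) \<le> 2 * norm (f t)" for n
    proof (rule AE_I2)
      fix t assume t: "t \<in> space Rplus"
      have "norm (s n t * exp (- (z * of_real t))) \<le> norm (s n t) * 1"
        unfolding norm_mult using t that by (intro mult_left_mono) auto
      also have "\<dots> \<le> 2 * norm (f t)" using s(3)[OF t] by simp
      finally show "norm (s n t * exp (- (z * of_real t))) \<le> 2 * norm (f t)" .
    qed
  qed (use f(1) integrable_laplace_kernel[OF f(1) that] integrable_laplace_kernel[OF int_s that] in auto)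
  define b where "b n = enn2real (powr_int p Rplus (s n))" for n
  have b0: "b n \<ge> 0" for n by (simp add: b_def)
  have ev_fin: "eventually (\<lambda>n. powr_int p Rplus (s n) = ennreal (b n)) sequentially"
  proof -
    have "eventually (\<lambda>n. powr_int p Rplus (s n) < \<top>) sequentially"
      using lim_a by (rule order_tendstoD) simp
    then show ?thesis by eventually_elim (simp add: b_def)
  qed
  have lim_b: "b \<longlonglongrightarrow> a"
  proof -
    have "(\<lambda>n. ennreal (b n)) \<longlonglongrightarrow> ennreal a"
      using lim_a by (rule Lim_transform_eventually) (rule ev_fin)
    then show ?thesis using a b0 by simp
  qed
  \<comment> \<open>\<open>riesz_thorin_simple\<close> asks for a positive integral. If it is 0, the
    approximation vanishes almost everywhere and its transform is 0.\<close>
  have bound: "powr_int q \<mu> (laplace (s n)) \<le> ennreal (C * b n powr (q - 1))"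
    if eq: "powr_int p Rplus (s n) = ennreal (b n)" for n
  proof (cases "b n = 0")
    case True
    then have "(\<integral>\<^sup>+t. ennreal (norm (s n t) powr p) \<partial>Rplus) = 0"
      using eq by (simp add: powr_int_def)
    then have "AE t in Rplus. s n t = 0"
      by (subst (asm) nn_integral_0_iff_AE) (auto elim!: eventually_mono simp: ennreal_eq_0_iff)
    then have "laplace (s n) z = 0" for z
      unfolding laplace_def by (intro integral_eq_zero_AE) (auto elim: eventually_mono)
    then show ?thesis by (simp add: powr_int_def)
  next
    case False
    then show ?thesis using b0[of n] by (intro riesz_thorin_simple[OF s(1) eq _ p q]) auto
  qed
  have "powr_int q \<mu> (laplace f) \<le> liminf (\<lambda>n. powr_int q \<mu> (laplace (s n)))"
    using AE_Re by (intro powr_int_Fatou q0) (auto elim: eventually_mono intro: lim_L)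
  also have "\<dots> \<le> liminf (\<lambda>n. ennreal (C * b n powr (q - 1)))"
    by (rule Liminf_mono) (use ev_fin bound in \<open>auto elim: eventually_mono\<close>)
  also have "\<dots> = ennreal (C * a powr (q - 1))"
  proof (rule lim_imp_Liminf[OF trivial_limit_sequentially])
    show "(\<lambda>n. ennreal (C * b n powr (q - 1))) \<longlonglongrightarrow> ennreal (C * a powr (q - 1))"
      using lim_b b0 q2 by (intro tendsto_ennrealI tendsto_mult tendsto_powr' tendsto_const) auto
  qed
  finally show ?thesis .
qed

end

section \<open>Completeness\<close>

lemma tendsto_zero_ennreal_iff:
  fixes X :: "'a \<Rightarrow> ennreal"
  shows "(X \<longlongrightarrow> 0) F \<longleftrightarrow> (\<forall>\<epsilon>>0. \<forall>\<^sub>F n in F. X n \<le> ennreal \<epsilon>)"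
proof safe
  fix \<epsilon> :: real assume "(X \<longlongrightarrow> 0) F" "\<epsilon> > 0"
  then have "\<forall>\<^sub>F n in F. X n < ennreal \<epsilon>" by (intro order_tendstoD(2)) auto
  then show "\<forall>\<^sub>F n in F. X n \<le> ennreal \<epsilon>" by eventually_elim simp
next
  assume *: "\<forall>\<epsilon>>0. \<forall>\<^sub>F n in F. X n \<le> ennreal \<epsilon>"
  show "(X \<longlongrightarrow> 0) F"
  proof (rule order_tendstoI)
    fix a :: ennreal assume "0 < a"
    then obtain x where x: "0 < x" "x < a" using dense by blast
    then obtain \<epsilon> where \<epsilon>: "x = ennreal \<epsilon>" "\<epsilon> \<ge> 0" by (cases x) (auto simp: top_unique)
    with x have "\<forall>\<^sub>F n in F. X n \<le> ennreal \<epsilon>" using * by (auto simp: ennreal_less_zero_iff)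
    then show "\<forall>\<^sub>F n in F. X n < a" by eventually_elim (use x \<epsilon> in auto)
  qed simp
qed

lemma Lnorm_powr_int:
  assumes "r > 0"
  shows "Lnorm (ennreal r) M f = (if powr_int r M f = \<infinity> then \<infinity> else ennreal (enn2real (powr_int r M f) powr (1 / r)))"
  using assms by (simp add: Lnorm_def powr_int_def Let_def)

lemma Lnorm_le_iff:
  assumes r: "r > 0" and c: "c \<ge> 0"
  shows "Lnorm (ennreal r) M f \<le> ennreal c \<longleftrightarrow> powr_int r M f \<le> ennreal (c powr r)"
proof (cases "powr_int r M f")
  case (real a)
  have "a powr (1 / r) \<le> c \<longleftrightarrow> a \<le> c powr r"
  proof
    assume "a powr (1 / r) \<le> c"
    then have "(a powr (1 / r)) powr r \<le> c powr r" using r by (intro powr_mono2) auto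
    then show "a \<le> c powr r" using r real by (simp add: powr_powr)
  next
    assume "a \<le> c powr r"
    then have "a powr (1 / r) \<le> (c powr r) powr (1 / r)" using r real by (intro powr_mono2) auto
    then show "a powr (1 / r) \<le> c" using r c by (simp add: powr_powr)
  qed
  then show ?thesis using real r c by (simp add: Lnorm_powr_int)
next
  case top
  then show ?thesis using r by (simp add: Lnorm_powr_int top_unique)
qed

lemma Lnorm_finite_iff: "r > 0 \<Longrightarrow> Lnorm (ennreal r) M f < \<infinity> \<longleftrightarrow> powr_int r M f < \<infinity>"
  by (simp add: Lnorm_powr_int less_top)

lemma Lspace_iff: "r > 0 \<Longrightarrow> f \<in> Lspace (ennreal r) M \<longleftrightarrow> f \<in> borel_measurable M \<and> powr_int r M f < \<infinity>"
  using Lnorm_finite_iff by (auto simp: Lspace_def)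

lemma Lnorm_tendsto_0_iff:
  assumes r: "r > 0"
  shows "((\<lambda>n. Lnorm (ennreal r) M (f n)) \<longlongrightarrow> 0) F \<longleftrightarrow> ((\<lambda>n. powr_int r M (f n)) \<longlongrightarrow> 0) F"
  unfolding tendsto_zero_ennreal_iff
proof safe
  fix \<epsilon> :: real
  assume *: "\<forall>\<epsilon>>0. \<forall>\<^sub>F n in F. Lnorm (ennreal r) M (f n) \<le> ennreal \<epsilon>" and "\<epsilon> > 0"
  then have "\<forall>\<^sub>F n in F. Lnorm (ennreal r) M (f n) \<le> ennreal (\<epsilon> powr (1 / r))" by simp
  then show "\<forall>\<^sub>F n in F. powr_int r M (f n) \<le> ennreal \<epsilon>"
    using r \<open>\<epsilon> > 0\<close> by (simp add: Lnorm_le_iff powr_powr)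
next
  fix \<epsilon> :: real
  assume *: "\<forall>\<epsilon>>0. \<forall>\<^sub>F n in F. powr_int r M (f n) \<le> ennreal \<epsilon>" and "\<epsilon> > 0"
  then have "\<forall>\<^sub>F n in F. powr_int r M (f n) \<le> ennreal (\<epsilon> powr r)" by simp
  then show "\<forall>\<^sub>F n in F. Lnorm (ennreal r) M (f n) \<le> ennreal \<epsilon>"
    using r \<open>\<epsilon> > 0\<close> by (simp add: Lnorm_le_iff)
qed

text \<open>A substitute for Minkowski's inequality: |f + g| is at most twice the larger of |f| and
  |g|. The constant is harmless, since it only serves convergence and finiteness.\<close>

lemma powr_int_add_le:
  assumes r: "r > 0" and [measurable]: "f \<in> borel_measurable M" "g \<in> borel_measurable M"
  shows "powr_int r M (\<lambda>x. f x + g x) \<le> ennreal (2 powr r) * (powr_int r M f + powr_int r M g)"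
proof -
  have "powr_int r M (\<lambda>x. f x + g x) \<le> (\<integral>\<^sup>+x. ennreal (2 powr r) * (ennreal (norm (f x) powr r) + ennreal (norm (g x) powr r)) \<partial>M)"
    unfolding powr_int_def
  proof (rule nn_integral_mono)
    fix x
    define m where "m = max (norm (f x)) (norm (g x))"
    have "norm (f x + g x) \<le> 2 * m"
      using norm_triangle_ineq[of "f x" "g x"] by (simp add: m_def)
    then have "norm (f x + g x) powr r \<le> (2 * m) powr r" using r by (intro powr_mono2) auto
    also have "\<dots> = 2 powr r * m powr r" by (rule powr_mult)
    also have "\<dots> \<le> 2 powr r * (norm (f x) powr r + norm (g x) powr r)"
      by (intro mult_left_mono) (auto simp: m_def max_def)
    finally show "ennreal (norm (f x + g x) powr r) \<le> ennreal (2 powr r) * (ennreal (norm (f x) powr r) + ennreal (norm (g x) powr r))"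
      by (simp add: ennreal_leI flip: ennreal_mult ennreal_plus)
  qed
  also have "\<dots> = ennreal (2 powr r) * (powr_int r M f + powr_int r M g)"
    unfolding powr_int_def by (subst nn_integral_cmult) (auto simp: nn_integral_add)
  finally show ?thesis .
qed

lemma powr_int_minus_commute: "powr_int r M (\<lambda>x. f x - g x) = powr_int r M (\<lambda>x. g x - f x)"
  by (simp add: powr_int_def norm_minus_commute)

lemma powr_int_cmult:
  assumes [measurable]: "f \<in> borel_measurable M"
  shows "powr_int r M (\<lambda>x. c * f x) = ennreal (norm c powr r) * powr_int r M f"
proof -
  have "powr_int r M (\<lambda>x. c * f x) = (\<integral>\<^sup>+x. ennreal (norm c powr r) * ennreal (norm (f x) powr r) \<partial>M)"
    unfolding powr_int_def
    by (intro nn_integral_cong) (simp add: norm_mult powr_mult ennreal_mult)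
  then show ?thesis by (simp add: nn_integral_cmult powr_int_def)
qed

lemma powr_int_triangle:
  assumes r: "r > 0" and [measurable]: "f \<in> borel_measurable M" "g \<in> borel_measurable M" "h \<in> borel_measurable M"
  shows "powr_int r M (\<lambda>x. f x - h x)
    \<le> ennreal (2 powr r) * (powr_int r M (\<lambda>x. f x - g x) + powr_int r M (\<lambda>x. g x - h x))"
  using powr_int_add_le[OF r, of "\<lambda>x. f x - g x" M "\<lambda>x. g x - h x"] by simp

lemma powr_int_cong_AE:
  assumes "AE x in M. f x = g x"
  shows "powr_int r M f = powr_int r M g"
  unfolding powr_int_def using assms by (intro nn_integral_cong_AE) (auto elim: eventually_mono)

lemma powr_int_eq_0:
  assumes [measurable]: "f \<in> borel_measurable M" and "powr_int r M f = 0"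
  shows "AE x in M. f x = 0"
  using assms(2) unfolding powr_int_def
  by (subst (asm) nn_integral_0_iff_AE) (auto elim!: eventually_mono simp: ennreal_eq_0_iff)

lemma tendsto_0_ennreal_sum:
  fixes X Y Z :: "'a \<Rightarrow> ennreal"
  assumes "(X \<longlongrightarrow> 0) F" "(Y \<longlongrightarrow> 0) F" "\<And>n. Z n \<le> ennreal c * (X n + Y n)"
  shows "(Z \<longlongrightarrow> 0) F"
proof (rule tendsto_sandwich[of "\<lambda>_. 0" _ _ "\<lambda>n. ennreal c * (X n + Y n)"])
  have "((\<lambda>n. ennreal c * (X n + Y n)) \<longlongrightarrow> ennreal c * (0 + 0)) F"
    using assms(1,2) by (intro tendsto_mult_ennreal tendsto_add tendsto_const) auto
  then show "((\<lambda>n. ennreal c * (X n + Y n)) \<longlongrightarrow> 0) F" by simp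
qed (use assms(3) in auto)

lemma powr_int_limit_unique:
  assumes r: "r > 0" and u: "\<And>n::nat. u n \<in> borel_measurable M"
    and g: "g \<in> borel_measurable M" "h \<in> borel_measurable M"
    and lim: "(\<lambda>n. powr_int r M (\<lambda>x. u n x - g x)) \<longlonglongrightarrow> 0" "(\<lambda>n. powr_int r M (\<lambda>x. u n x - h x)) \<longlonglongrightarrow> 0"
  shows "AE x in M. g x = h x"
proof -
  have "powr_int r M (\<lambda>x. g x - h x) \<le> ennreal (2 powr r) *
      (powr_int r M (\<lambda>x. u n x - g x) + powr_int r M (\<lambda>x. u n x - h x))" for n
    using powr_int_triangle[OF r g(1) u[of n] g(2)] by (simp add: powr_int_minus_commute[of r M g "u n"])
  then have "(\<lambda>n::nat. powr_int r M (\<lambda>x. g x - h x)) \<longlonglongrightarrow> 0"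
    by (rule tendsto_0_ennreal_sum[OF lim])
  then have "powr_int r M (\<lambda>x. g x - h x) = 0"
    by (simp add: LIMSEQ_const_iff)
  then have "AE x in M. g x - h x = 0"
    using g by (intro powr_int_eq_0) auto
  then show ?thesis by eventually_elim simp
qed

text \<open>Riesz-Fischer. Along a fast subsequence the increments are summable at almost every
  point, which yields the limit; Fatou's lemma turns this into convergence of the whole sequence.
  The subsequence is returned because the norm bound of the limit is again an application of Fatou's
  lemma.\<close>

theorem powr_int_complete:
  assumes r: "r > 0" and u [measurable]: "\<And>n::nat. u n \<in> borel_measurable M"
    and cauchy: "\<And>\<epsilon>::real. \<epsilon> > 0 \<Longrightarrow> \<exists>N. \<forall>i\<ge>N. \<forall>j\<ge>N. powr_int r M (\<lambda>x. u i x - u j x) \<le> ennreal \<epsilon>"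
  obtains g m where "g \<in> borel_measurable M" "(\<lambda>n. powr_int r M (\<lambda>x. u n x - g x)) \<longlonglongrightarrow> 0"
    "AE x in M. (\<lambda>k. u (m k) x) \<longlonglongrightarrow> g x"
proof -
  \<comment> \<open>4^(-r k) beats the weight 2^(r k) in \<open>S\<close> by a geometric factor.
    Finiteness of \<open>S x\<close> then bounds the k-th increment by a constant times 2^(-k), for
    any r > 0.\<close>
  have "\<exists>N. \<forall>i\<ge>N. \<forall>j\<ge>N. powr_int r M (\<lambda>x. u i x - u j x) \<le> ennreal ((1 / 4) powr (r * real k))" for k :: nat
    by (rule cauchy) simp
  then obtain N where N: "\<And>k i j. i \<ge> N k \<Longrightarrow> j \<ge> N k \<Longrightarrow> powr_int r M (\<lambda>x. u i x - u j x) \<le> ennreal ((1 / 4) powr (r * real k))"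
    by metis
  \<comment> \<open>Partial sums make the index monotone, at least \<open>N k\<close>, and at least
    k.\<close>
  define m where "m k = (\<Sum>i\<le>k. N i + 1)" for k
  have m_ge: "N k \<le> m k" "k \<le> m k" for k
  proof -
    have "N k + 1 \<le> m k" unfolding m_def by (rule member_le_sum) auto
    then show "N k \<le> m k" by simp
    show "k \<le> m k" by (induction k) (auto simp: m_def)
  qed
  have m_Suc: "m k \<le> m (Suc k)" for k by (simp add: m_def)
  define d where "d k x = u (m (Suc k)) x - u (m k) x" for k x
  have [measurable]: "d k \<in> borel_measurable M" for k unfolding d_def by measurable
  define S where "S x = (\<Sum>k. ennreal (2 powr (r * real k)) * ennreal (norm (d k x) powr r))" for x
  have [measurable]: "S \<in> borel_measurable M" unfolding S_def by measurable
  have "(\<integral>\<^sup>+x. S x \<partial>M) = (\<Sum>k. ennreal (2 powr (r * real k)) * powr_int r M (d k))"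
    unfolding S_def powr_int_def by (simp add: nn_integral_suminf nn_integral_cmult)
  also have "\<dots> \<le> (\<Sum>k. ennreal ((1 / 2) powr r) ^ k)"
  proof (rule suminf_le)
    fix k
    have "powr_int r M (d k) \<le> ennreal ((1 / 4) powr (r * real k))"
      unfolding d_def using m_ge[of k] m_Suc[of k] by (intro N) auto
    then have "ennreal (2 powr (r * real k)) * powr_int r M (d k) \<le> ennreal (2 powr (r * real k)) * ennreal ((1 / 4) powr (r * real k))"
      by (rule mult_left_mono) simp
    also have "\<dots> = ennreal ((1 / 2) powr (r * real k))"
      by (simp flip: ennreal_mult powr_mult)
    also have "\<dots> = ennreal ((1 / 2) powr r) ^ k"
      by (simp add: ennreal_power powr_realpow[symmetric] powr_powr)
    finally show "ennreal (2 powr (r * real k)) * powr_int r M (d k) \<le> ennreal ((1 / 2) powr r) ^ k" .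
  qed auto
  also have "\<dots> < \<infinity>"
  proof -
    have "(1 / 2) powr r < (1 / 2 :: real) powr 0" using r by (intro powr_less_mono') auto
    then have "summable (\<lambda>k. ((1 / 2) powr r) ^ k)" by (intro summable_geometric) auto
    then have "(\<Sum>k. ennreal (((1 / 2) powr r) ^ k)) = ennreal (\<Sum>k. ((1 / 2) powr r) ^ k)"
      by (intro suminf_ennreal2) auto
    then show ?thesis by (simp add: ennreal_power)
  qed
  finally have "AE x in M. S x \<noteq> \<infinity>"
    by (intro nn_integral_noteq_infinite) auto
  then have conv: "AE x in M. convergent (\<lambda>k. u (m k) x)"
  proof eventually_elim
    case (elim x)
    then obtain s where s: "S x = ennreal s" "s \<ge> 0" by (cases "S x") auto
    have d_le: "norm (d k x) \<le> s powr (1 / r) * (1 / 2) ^ k" for k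
    proof -
      have "ennreal (2 powr (r * real k)) * ennreal (norm (d k x) powr r) \<le> S x"
        unfolding S_def by (rule sum_le_suminf[of _ "{k}", simplified]) auto
      then have "(2 powr real k * norm (d k x)) powr r \<le> s"
        using s by (simp add: powr_mult powr_powr mult.commute flip: ennreal_mult)
      then have "((2 powr real k * norm (d k x)) powr r) powr (1 / r) \<le> s powr (1 / r)"
        using r by (intro powr_mono2) auto
      then have "2 ^ k * norm (d k x) \<le> s powr (1 / r)"
        using r by (simp add: powr_powr powr_realpow)
      then show ?thesis by (simp add: field_simps power_one_over)
    qed
    have geo: "summable (\<lambda>k. s powr (1 / r) * (1 / 2) ^ k)"
      by (rule summable_mult, rule summable_geometric) simp
    have "summable (\<lambda>k. d k x)"
      by (rule summable_comparison_test'[OF geo, where N = 0]) (rule d_le)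
    then have "convergent (\<lambda>n. \<Sum>k<n. d k x)" by (simp only: summable_iff_convergent)
    then have "convergent (\<lambda>n. (\<Sum>k<n. d k x) + u (m 0) x)"
      by (rule convergent_add[OF _ convergent_const])
    moreover have "(\<Sum>k<n. d k x) + u (m 0) x = u (m n) x" for n
      unfolding d_def by (subst sum_lessThan_telescope[of "\<lambda>k. u (m k) x"]) simp
    ultimately show ?case by (simp only:)
  qed
  define g where "g x = lim (\<lambda>k. u (m k) x)" for x
  have [measurable]: "g \<in> borel_measurable M" unfolding g_def by measurable
  have AE_lim: "AE x in M. (\<lambda>k. u (m k) x) \<longlonglongrightarrow> g x"
    using conv by eventually_elim (simp add: g_def convergent_LIMSEQ_iff)
  have "(\<lambda>n. powr_int r M (\<lambda>x. u n x - g x)) \<longlonglongrightarrow> 0"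
    unfolding tendsto_zero_ennreal_iff
  proof safe
    fix \<epsilon> :: real assume "\<epsilon> > 0"
    then obtain N0 where N0: "\<And>i j. i \<ge> N0 \<Longrightarrow> j \<ge> N0 \<Longrightarrow> powr_int r M (\<lambda>x. u i x - u j x) \<le> ennreal \<epsilon>"
      using cauchy by metis
    have "powr_int r M (\<lambda>x. u n x - g x) \<le> ennreal \<epsilon>" if n: "n \<ge> N0" for n
    proof -
      have "AE x in M. (\<lambda>k. u n x - u (m k) x) \<longlonglongrightarrow> u n x - g x"
        using AE_lim by eventually_elim (intro tendsto_intros)
      then have "powr_int r M (\<lambda>x. u n x - g x) \<le> liminf (\<lambda>k. powr_int r M (\<lambda>x. u n x - u (m k) x))"
        by (intro powr_int_Fatou r) auto
      also have "\<dots> \<le> liminf (\<lambda>k. ennreal \<epsilon>)"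
      proof (rule Liminf_mono)
        show "\<forall>\<^sub>F k in sequentially. powr_int r M (\<lambda>x. u n x - u (m k) x) \<le> ennreal \<epsilon>"
          using eventually_ge_at_top[of N0]
        proof eventually_elim
          case (elim k)
          then show ?case using n m_ge(2)[of k] by (intro N0) auto
        qed
      qed
      finally show ?thesis by (simp add: Liminf_const)
    qed
    then show "\<forall>\<^sub>F n in sequentially. powr_int r M (\<lambda>x. u n x - g x) \<le> ennreal \<epsilon>"
      by (auto simp: eventually_sequentially)
  qed
  then show ?thesis using that[of g m] AE_lim by simp
qed

section \<open>Extension by continuity\<close>

lemma Lnorm_1: "Lnorm 1 M f = (\<integral>\<^sup>+x. norm (f x) \<partial>M)"
proof (cases "(\<integral>\<^sup>+x. ennreal (norm (f x)) \<partial>M)")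
  case (real a)
  then show ?thesis by (simp add: Lnorm_def Let_def)
next
  case top
  then show ?thesis by (simp add: Lnorm_def Let_def)
qed

lemma Lspace_1_iff: "f \<in> Lspace 1 M \<longleftrightarrow> integrable M f"
  by (auto simp: Lspace_def Lnorm_1 integrable_iff_bounded)

lemma laplace_diff:
  assumes "integrable Rplus f" "integrable Rplus g" "0 \<le> Re z"
  shows "laplace (\<lambda>t. f t - g t) z = laplace f z - laplace g z"
  unfolding laplace_def
  using integrable_laplace_kernel[OF assms(1,3)] integrable_laplace_kernel[OF assms(2,3)]
  by (simp add: left_diff_distrib)

lemma laplace_linear:
  assumes "integrable Rplus f" "integrable Rplus g" "0 \<le> Re z"
  shows "laplace (\<lambda>t. a * f t + b * g t) z = a * laplace f z + b * laplace g z"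
  unfolding laplace_def
  using integrable_laplace_kernel[OF assms(1,3)] integrable_laplace_kernel[OF assms(2,3)]
  by (simp add: distrib_right mult.assoc)

text \<open>Cutting off at n puts a function of L^p into L^1 as well, since |f| \<le> 1 + |f|^p on a
  bounded interval. The cut-off is linear in f, which later gives linearity of the
  extension.\<close>

definition truncate :: "(real \<Rightarrow> complex) \<Rightarrow> nat \<Rightarrow> real \<Rightarrow> complex" where
  "truncate f n t = (if t \<le> real n then f t else 0)"

text \<open>In terms of norms, the q-th power of the norm of the transform is at most K times the
  q-th power of the norm of f: \<open>a\<close> is the p-th power of the latter, and q / p = q -
  1.\<close>

locale laplace_Lp = half_plane_measure +
  fixes K p q :: real
  assumes p: "1 < p" and q: "q = p / (p - 1)" and K: "K \<ge> 0"
    and bound: "\<And>f a. integrable Rplus f \<Longrightarrow> powr_int p Rplus f = ennreal a \<Longrightarrow> a \<ge> 0 \<Longrightarrow>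
      powr_int q \<mu> (laplace f) \<le> ennreal (K * a powr (q - 1))"
begin

lemma p0: "p > 0" and q1: "q > 1" and q0: "q > 0"
  using p by (auto simp: q field_simps)

lemma domain_iff: "f \<in> Lspace 1 Rplus \<inter> Lspace (ennreal p) Rplus \<longleftrightarrow> integrable Rplus f \<and> powr_int p Rplus f < \<infinity>"
  using p0 by (auto simp: Lspace_1_iff Lspace_iff)

lemma truncate_domain:
  assumes f: "f \<in> borel_measurable Rplus" "powr_int p Rplus f < \<infinity>"
  shows "integrable Rplus (truncate f n)" "powr_int p Rplus (truncate f n) \<le> powr_int p Rplus f"
proof -
  note [measurable] = f(1)
  have [measurable]: "(\<lambda>t. t) \<in> borel_measurable Rplus" by (rule borel_measurable_Rplus) simp
  show le: "powr_int p Rplus (truncate f n) \<le> powr_int p Rplus f"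
    unfolding powr_int_def by (intro nn_integral_mono) (auto simp: truncate_def)
  show "integrable Rplus (truncate f n)"
  proof (rule integrableI_bounded)
    show "truncate f n \<in> borel_measurable Rplus" unfolding truncate_def[abs_def] by measurable
    have "(\<integral>\<^sup>+t. ennreal (norm (truncate f n t)) \<partial>Rplus)
        \<le> (\<integral>\<^sup>+t. indicator {0<..real n} t + ennreal (norm (f t) powr p) \<partial>Rplus)"
    proof (rule nn_integral_mono)
      fix t assume t: "t \<in> space Rplus"
      have "norm (f t) \<le> 1 + norm (f t) powr p"
      proof (cases "norm (f t) \<le> 1")
        case True
        then show ?thesis by (simp add: add_increasing2)
      next
        case False
        then have "norm (f t) powr 1 \<le> norm (f t) powr p" using p by (intro powr_mono) auto
        then show ?thesis using False by simp
      qed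
      then have "ennreal (norm (f t)) \<le> 1 + ennreal (norm (f t) powr p)"
        by (metis ennreal_1 ennreal_leI ennreal_plus powr_ge_zero zero_le_one)
      then show "ennreal (norm (truncate f n t)) \<le> indicator {0<..real n} t + ennreal (norm (f t) powr p)"
        using t by (auto simp: truncate_def indicator_def)
    qed
    also have "\<dots> = (\<integral>\<^sup>+t. indicator {0<..real n} t \<partial>Rplus) + powr_int p Rplus f"
      unfolding powr_int_def
      by (rule nn_integral_add) (auto intro!: borel_measurable_Rplus)
    also have "(\<integral>\<^sup>+t. indicator {0<..real n} t \<partial>Rplus) = (\<integral>\<^sup>+t. indicator {0<..real n} t \<partial>lborel)"
      unfolding Rplus_def
      by (subst nn_integral_restrict_space, simp, intro nn_integral_cong) (auto simp: indicator_def)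
    also have "\<dots> + powr_int p Rplus f < \<infinity>" using f(2) by simp
    finally show "(\<integral>\<^sup>+t. ennreal (norm (truncate f n t)) \<partial>Rplus) < \<infinity>" .
  qed
qed

lemma truncate_tendsto:
  assumes f: "f \<in> borel_measurable Rplus" "powr_int p Rplus f < \<infinity>"
  shows "(\<lambda>n. powr_int p Rplus (\<lambda>t. truncate f n t - f t)) \<longlonglongrightarrow> 0"
proof -
  note [measurable] = f(1)
  have [measurable]: "truncate f n \<in> borel_measurable Rplus" for n
    using truncate_domain(1)[OF f, of n] by auto
  have "(\<lambda>n. powr_int p Rplus (\<lambda>t. truncate f n t - f t)) \<longlonglongrightarrow> powr_int p Rplus (\<lambda>t. 0)"
  proof (rule powr_int_dominated_convergence[where g = f and c = 1])
    fix t :: real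
    obtain N where "t \<le> real N" using real_arch_simple by blast
    then have "\<forall>\<^sub>F n in sequentially. truncate f n t - f t = 0"
      by (intro eventually_sequentiallyI[of N]) (auto simp: truncate_def)
    then show "(\<lambda>n. truncate f n t - f t) \<longlonglongrightarrow> 0" by (rule tendsto_eventually)
    show "norm (truncate f n t - f t) \<le> 1 * norm (f t)" for n by (simp add: truncate_def)
  qed (use f p0 in auto)
  then show ?thesis by (simp add: powr_int_def)
qed

lemma bound_diff:
  assumes "integrable Rplus f" "integrable Rplus g" "powr_int p Rplus (\<lambda>t. f t - g t) \<le> ennreal a" "a \<ge> 0"
  shows "powr_int q \<mu> (\<lambda>z. laplace f z - laplace g z) \<le> ennreal (K * a powr (q - 1))"
proof -
  have "powr_int q \<mu> (\<lambda>z. laplace f z - laplace g z) = powr_int q \<mu> (laplace (\<lambda>t. f t - g t))"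
    using AE_Re by (intro powr_int_cong_AE) (auto elim!: eventually_mono simp: laplace_diff assms)
  also obtain b where b: "powr_int p Rplus (\<lambda>t. f t - g t) = ennreal b" "b \<ge> 0"
    using assms(3) by (cases "powr_int p Rplus (\<lambda>t. f t - g t)") (auto simp: top_unique)
  then have "powr_int q \<mu> (laplace (\<lambda>t. f t - g t)) \<le> ennreal (K * b powr (q - 1))"
    using assms by (intro bound) auto
  also have "\<dots> \<le> ennreal (K * a powr (q - 1))"
    using b assms K q1 by (intro ennreal_leI mult_left_mono powr_mono2) auto
  finally show ?thesis .
qed

lemma modulus:
  assumes "\<epsilon> > 0"
  obtains \<delta> where "\<delta> > 0" "K * \<delta> powr (q - 1) \<le> \<epsilon>"
proof
  define \<delta> where "\<delta> = (\<epsilon> / (K + 1)) powr (1 / (q - 1))"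
  show "\<delta> > 0" using assms K by (simp add: \<delta>_def)
  have "K * \<delta> powr (q - 1) \<le> (K + 1) * \<delta> powr (q - 1)" by (intro mult_right_mono) auto
  also have "\<dots> = \<epsilon>" using q1 assms K by (simp add: \<delta>_def powr_powr)
  finally show "K * \<delta> powr (q - 1) \<le> \<epsilon>" .
qed

lemma laplace_continuous:
  assumes f: "\<And>n. integrable Rplus (f n)" and g: "\<And>n. integrable Rplus (g n)"
    and lim: "(\<lambda>n. powr_int p Rplus (\<lambda>t. f n t - g n t)) \<longlonglongrightarrow> 0"
  shows "(\<lambda>n::nat. powr_int q \<mu> (\<lambda>z. laplace (f n) z - laplace (g n) z)) \<longlonglongrightarrow> 0"
  unfolding tendsto_zero_ennreal_iff
proof safe
  fix \<epsilon> :: real assume "\<epsilon> > 0"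
  then obtain \<delta> where \<delta>: "\<delta> > 0" and le: "K * \<delta> powr (q - 1) \<le> \<epsilon>" by (rule modulus)
  have "\<forall>\<^sub>F n in sequentially. powr_int p Rplus (\<lambda>t. f n t - g n t) \<le> ennreal \<delta>"
    using lim \<delta> unfolding tendsto_zero_ennreal_iff by blast
  then show "\<forall>\<^sub>F n in sequentially. powr_int q \<mu> (\<lambda>z. laplace (f n) z - laplace (g n) z) \<le> ennreal \<epsilon>"
  proof eventually_elim
    case (elim n)
    have "powr_int q \<mu> (\<lambda>z. laplace (f n) z - laplace (g n) z) \<le> ennreal (K * \<delta> powr (q - 1))"
      using \<delta> by (intro bound_diff f g elim) auto
    also have "\<dots> \<le> ennreal \<epsilon>" using le by (rule ennreal_leI)
    finally show ?case .
  qed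
qed

lemma is_laplace_ext_iff:
  "is_laplace_ext (ennreal p) (ennreal q) \<mu> f g \<longleftrightarrow> g \<in> borel_measurable \<mu> \<and> powr_int q \<mu> g < \<infinity> \<and>
     (\<forall>\<phi>. (\<forall>n. integrable Rplus (\<phi> n) \<and> powr_int p Rplus (\<phi> n) < \<infinity>) \<longrightarrow>
        (\<lambda>n. powr_int p Rplus (\<lambda>t. \<phi> n t - f t)) \<longlonglongrightarrow> 0 \<longrightarrow>
        (\<lambda>n. powr_int q \<mu> (\<lambda>z. laplace (\<phi> n) z - g z)) \<longlonglongrightarrow> 0)"
  unfolding is_laplace_ext_def domain_iff Lnorm_tendsto_0_iff[OF p0] Lnorm_tendsto_0_iff[OF q0] Lspace_iff[OF q0]
  by auto

text \<open>The transforms of the truncations form a Cauchy sequence, and their limit inherits the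
  bound. Any other admissible sequence differs from the truncations by a null sequence in L^p, so
  its transforms have the same limit.\<close>

lemma laplace_ext_exists:
  assumes f: "f \<in> borel_measurable Rplus" "powr_int p Rplus f = ennreal a" "a \<ge> 0"
  shows "\<exists>g. is_laplace_ext (ennreal p) (ennreal q) \<mu> f g \<and> powr_int q \<mu> g \<le> ennreal (K * a powr (q - 1))"
proof -
  have fin: "powr_int p Rplus f < \<infinity>" by (simp add: f)
  note [measurable] = f(1)
  note tr = truncate_domain[OF f(1) fin]
  note lim = truncate_tendsto[OF f(1) fin]
  have [measurable]: "truncate f n \<in> borel_measurable Rplus" for n using tr(1)[of n] by auto
  define u where "u n = laplace (truncate f n)" for n
  have u [measurable]: "u n \<in> borel_measurable \<mu>" for n unfolding u_def by measurable
  have u_le: "powr_int q \<mu> (u n) \<le> ennreal (K * a powr (q - 1))" for n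
  proof -
    obtain b where b: "powr_int p Rplus (truncate f n) = ennreal b" "b \<ge> 0"
      using tr(2)[of n] by (cases "powr_int p Rplus (truncate f n)") (auto simp: f top_unique)
    have "powr_int q \<mu> (u n) \<le> ennreal (K * b powr (q - 1))"
      unfolding u_def by (rule bound[OF tr(1) b])
    also have "\<dots> \<le> ennreal (K * a powr (q - 1))"
      using tr(2)[of n] b f K q1 by (intro ennreal_leI mult_left_mono powr_mono2) auto
    finally show ?thesis .
  qed
  have cauchy: "\<exists>N. \<forall>i\<ge>N. \<forall>j\<ge>N. powr_int q \<mu> (\<lambda>z. u i z - u j z) \<le> ennreal \<epsilon>" if e: "\<epsilon> > 0" for \<epsilon>
  proof -
    obtain \<delta> where \<delta>: "\<delta> > 0" and le: "K * \<delta> powr (q - 1) \<le> \<epsilon>"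
      using e by (rule modulus)
    \<comment> \<open>Two errors \<eta> are added and multiplied by the constant
      \<open>2 powr p\<close> of the triangle inequality.\<close>
    define \<eta> where "\<eta> = \<delta> / (2 * 2 powr p)"
    have \<eta>: "\<eta> > 0" using \<delta> by (simp add: \<eta>_def)
    obtain N where N: "\<And>n. n \<ge> N \<Longrightarrow> powr_int p Rplus (\<lambda>t. truncate f n t - f t) \<le> ennreal \<eta>"
      using lim \<eta> unfolding tendsto_zero_ennreal_iff eventually_sequentially by blast
    have "powr_int q \<mu> (\<lambda>z. u i z - u j z) \<le> ennreal \<epsilon>" if ij: "i \<ge> N" "j \<ge> N" for i j
    proof -
      have "powr_int p Rplus (\<lambda>t. truncate f i t - truncate f j t)
          \<le> ennreal (2 powr p) * (powr_int p Rplus (\<lambda>t. truncate f i t - f t) + powr_int p Rplus (\<lambda>t. f t - truncate f j t))"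
        using p0 by (intro powr_int_triangle) auto
      also have "\<dots> \<le> ennreal (2 powr p) * (ennreal \<eta> + ennreal \<eta>)"
        using N ij by (intro mult_left_mono add_mono) (auto simp: powr_int_minus_commute[of p Rplus f])
      also have "\<dots> = ennreal \<delta>"
        using \<eta> by (simp add: \<eta>_def field_simps flip: ennreal_plus ennreal_mult)
      finally have "powr_int q \<mu> (\<lambda>z. u i z - u j z) \<le> ennreal (K * \<delta> powr (q - 1))"
        unfolding u_def using \<delta> by (intro bound_diff tr) auto
      also have "\<dots> \<le> ennreal \<epsilon>" using le by (rule ennreal_leI)
      finally show ?thesis .
    qed
    then show ?thesis by blast
  qed
  obtain g m where g: "g \<in> borel_measurable \<mu>" "(\<lambda>n. powr_int q \<mu> (\<lambda>z. u n z - g z)) \<longlonglongrightarrow> 0"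
    "AE z in \<mu>. (\<lambda>k. u (m k) z) \<longlonglongrightarrow> g z"
    by (rule powr_int_complete[OF q0 u cauchy])
  note [measurable] = g(1)
  have g_le: "powr_int q \<mu> g \<le> ennreal (K * a powr (q - 1))"
  proof -
    have "powr_int q \<mu> g \<le> liminf (\<lambda>k. powr_int q \<mu> (u (m k)))"
      using g(3) by (intro powr_int_Fatou q0) auto
    also have "\<dots> \<le> liminf (\<lambda>k::nat. ennreal (K * a powr (q - 1)))"
      by (rule Liminf_mono) (simp add: u_le)
    finally show ?thesis by (simp add: Liminf_const)
  qed
  have "is_laplace_ext (ennreal p) (ennreal q) \<mu> f g"
    unfolding is_laplace_ext_iff
  proof (intro conjI allI impI)
    show "powr_int q \<mu> g < \<infinity>" using g_le by (rule le_less_trans) simp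
    fix \<phi> :: "nat \<Rightarrow> real \<Rightarrow> complex"
    assume \<phi>: "\<forall>n. integrable Rplus (\<phi> n) \<and> powr_int p Rplus (\<phi> n) < \<infinity>"
      and \<phi>_lim: "(\<lambda>n. powr_int p Rplus (\<lambda>t. \<phi> n t - f t)) \<longlonglongrightarrow> 0"
    have int: "integrable Rplus (\<phi> n)" for n using \<phi> by blast
    have [measurable]: "\<phi> n \<in> borel_measurable Rplus" for n using int[of n] by auto
    have "(\<lambda>n. powr_int p Rplus (\<lambda>t. \<phi> n t - truncate f n t)) \<longlonglongrightarrow> 0"
    proof (rule tendsto_0_ennreal_sum[OF \<phi>_lim lim])
      show "powr_int p Rplus (\<lambda>t. \<phi> n t - truncate f n t) \<le> ennreal (2 powr p) *
          (powr_int p Rplus (\<lambda>t. \<phi> n t - f t) + powr_int p Rplus (\<lambda>t. truncate f n t - f t))" for n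
        using powr_int_triangle[OF p0, of "\<phi> n" Rplus f "truncate f n"]
        by (simp add: powr_int_minus_commute[of p Rplus f])
    qed
    then have "(\<lambda>n. powr_int q \<mu> (\<lambda>z. laplace (\<phi> n) z - u n z)) \<longlonglongrightarrow> 0"
      unfolding u_def by (rule laplace_continuous[OF int tr(1)])
    then show "(\<lambda>n. powr_int q \<mu> (\<lambda>z. laplace (\<phi> n) z - g z)) \<longlonglongrightarrow> 0"
      using g(2)
    proof (rule tendsto_0_ennreal_sum)
      show "powr_int q \<mu> (\<lambda>z. laplace (\<phi> n) z - g z) \<le> ennreal (2 powr q) *
          (powr_int q \<mu> (\<lambda>z. laplace (\<phi> n) z - u n z) + powr_int q \<mu> (\<lambda>z. u n z - g z))" for n
        using q0 by (intro powr_int_triangle) auto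
    qed
  qed measurable
  with g_le show ?thesis by blast
qed

text \<open>Both functions are limits of the transforms of the truncations. As
  \<open>laplace_ext\<close> is a choice, norm bounds reach it through this uniqueness.\<close>

lemma is_laplace_ext_unique:
  assumes f: "f \<in> borel_measurable Rplus" "powr_int p Rplus f < \<infinity>"
    and g: "is_laplace_ext (ennreal p) (ennreal q) \<mu> f g" "is_laplace_ext (ennreal p) (ennreal q) \<mu> f h"
  shows "AE z in \<mu>. g z = h z"
proof (rule powr_int_limit_unique[OF q0])
  note tr = truncate_domain[OF f]
  have dom: "\<forall>n. integrable Rplus (truncate f n) \<and> powr_int p Rplus (truncate f n) < \<infinity>"
    using tr f(2) by (auto intro: le_less_trans)
  show "laplace (truncate f n) \<in> borel_measurable \<mu>" for n using tr(1)[of n] by (intro measurable_laplace_\<mu>) auto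
  show "g \<in> borel_measurable \<mu>" "h \<in> borel_measurable \<mu>" using g by (auto simp: is_laplace_ext_iff)
  show "(\<lambda>n. powr_int q \<mu> (\<lambda>z. laplace (truncate f n) z - g z)) \<longlonglongrightarrow> 0"
    "(\<lambda>n. powr_int q \<mu> (\<lambda>z. laplace (truncate f n) z - h z)) \<longlonglongrightarrow> 0"
    using g dom truncate_tendsto[OF f] unfolding is_laplace_ext_iff by blast+
qed

lemma is_laplace_ext_laplace_ext:
  assumes "f \<in> borel_measurable Rplus" "powr_int p Rplus f < \<infinity>"
  shows "is_laplace_ext (ennreal p) (ennreal q) \<mu> f (laplace_ext (ennreal p) (ennreal q) \<mu> f)"
proof -
  obtain a where a: "powr_int p Rplus f = ennreal a" "a \<ge> 0"
    using assms(2) by (cases "powr_int p Rplus f") auto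
  obtain g where "is_laplace_ext (ennreal p) (ennreal q) \<mu> f g"
    using laplace_ext_exists[OF assms(1) a] by blast
  then show ?thesis
    unfolding laplace_ext_def by (rule someI[of "is_laplace_ext (ennreal p) (ennreal q) \<mu> f"])
qed

lemma Lnorm_laplace_ext_le:
  assumes f: "f \<in> Lspace (ennreal p) Rplus"
  shows "Lnorm (ennreal q) \<mu> (laplace_ext (ennreal p) (ennreal q) \<mu> f) \<le> ennreal (K powr (1 / q)) * Lnorm (ennreal p) Rplus f"
proof -
  have f': "f \<in> borel_measurable Rplus" "powr_int p Rplus f < \<infinity>" using f p0 by (auto simp: Lspace_iff)
  obtain a where a: "powr_int p Rplus f = ennreal a" "a \<ge> 0"
    using f'(2) by (cases "powr_int p Rplus f") auto
  obtain g where g: "is_laplace_ext (ennreal p) (ennreal q) \<mu> f g" "powr_int q \<mu> g \<le> ennreal (K * a powr (q - 1))"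
    using laplace_ext_exists[OF f'(1) a] by blast
  have "powr_int q \<mu> (laplace_ext (ennreal p) (ennreal q) \<mu> f) = powr_int q \<mu> g"
    by (intro powr_int_cong_AE is_laplace_ext_unique[OF f' is_laplace_ext_laplace_ext[OF f'] g(1)])
  also have "\<dots> \<le> ennreal ((K powr (1 / q) * a powr (1 / p)) powr q)"
  proof -
    have "q / p = q - 1" using p by (simp add: q field_simps)
    then have "(K powr (1 / q) * a powr (1 / p)) powr q = K * a powr (q - 1)"
      using q0 K by (simp add: powr_mult powr_powr)
    then show ?thesis using g(2) by simp
  qed
  finally have "Lnorm (ennreal q) \<mu> (laplace_ext (ennreal p) (ennreal q) \<mu> f) \<le> ennreal (K powr (1 / q) * a powr (1 / p))"
    by (subst Lnorm_le_iff[OF q0]) auto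
  also have "\<dots> = ennreal (K powr (1 / q)) * Lnorm (ennreal p) Rplus f"
    using a p0 by (simp add: Lnorm_powr_int ennreal_mult)
  finally show ?thesis .
qed

text \<open>Truncation is linear, and so is \<open>laplace\<close> on L^1. The three choices hidden
  in \<open>laplace_ext\<close> are compared only through L^q limits, hence the identity holds
  almost everywhere.\<close>

lemma laplace_ext_linear:
  assumes f: "f \<in> Lspace (ennreal p) Rplus" and h: "h \<in> Lspace (ennreal p) Rplus"
  shows "AE z in \<mu>. laplace_ext (ennreal p) (ennreal q) \<mu> (\<lambda>t. a * f t + b * h t) z =
    a * laplace_ext (ennreal p) (ennreal q) \<mu> f z + b * laplace_ext (ennreal p) (ennreal q) \<mu> h z"
proof -
  have f': "f \<in> borel_measurable Rplus" "powr_int p Rplus f < \<infinity>"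
    and h': "h \<in> borel_measurable Rplus" "powr_int p Rplus h < \<infinity>"
    using f h p0 by (auto simp: Lspace_iff)
  note [measurable] = f'(1) h'(1)
  define L where "L = laplace_ext (ennreal p) (ennreal q) \<mu>"
  define w where "w t = a * f t + b * h t" for t
  have w: "w \<in> borel_measurable Rplus" "powr_int p Rplus w < \<infinity>"
  proof -
    show "w \<in> borel_measurable Rplus" unfolding w_def by measurable
    have "powr_int p Rplus w \<le> ennreal (2 powr p) * (powr_int p Rplus (\<lambda>t. a * f t) + powr_int p Rplus (\<lambda>t. b * h t))"
      unfolding w_def using p0 by (intro powr_int_add_le) auto
    also have "\<dots> < \<infinity>"
      using f' h' by (simp add: powr_int_cmult ennreal_mult_less_top)
    finally show "powr_int p Rplus w < \<infinity>" .
  qed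
  note tr_f = truncate_domain[OF f'] and tr_h = truncate_domain[OF h'] and tr_w = truncate_domain[OF w]
  have dom: "\<forall>n. integrable Rplus (truncate k n) \<and> powr_int p Rplus (truncate k n) < \<infinity>"
    if "k \<in> borel_measurable Rplus" "powr_int p Rplus k < \<infinity>" for k
    using truncate_domain[OF that] that(2) by (auto intro: le_less_trans)
  have conv: "(\<lambda>n. powr_int q \<mu> (\<lambda>z. laplace (truncate k n) z - L k z)) \<longlonglongrightarrow> 0" and L_meas: "L k \<in> borel_measurable \<mu>"
    if k: "k \<in> borel_measurable Rplus" "powr_int p Rplus k < \<infinity>" for k
    using is_laplace_ext_laplace_ext[OF k] dom[OF k] truncate_tendsto[OF k]
    unfolding L_def is_laplace_ext_iff by blast+
  note [measurable] = L_meas[OF f'] L_meas[OF h'] L_meas[OF w]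
  have [measurable]: "laplace (truncate f n) \<in> borel_measurable \<mu>" "laplace (truncate h n) \<in> borel_measurable \<mu>"
    "laplace (truncate w n) \<in> borel_measurable \<mu>" for n
    using tr_f(1)[of n] tr_h(1)[of n] tr_w(1)[of n] by (auto intro!: measurable_laplace_\<mu>)
  have "AE z in \<mu>. L w z = a * L f z + b * L h z"
  proof (rule powr_int_limit_unique[OF q0])
    show "laplace (truncate w n) \<in> borel_measurable \<mu>" for n by measurable
    show "(\<lambda>n. powr_int q \<mu> (\<lambda>z. laplace (truncate w n) z - L w z)) \<longlonglongrightarrow> 0" by (rule conv[OF w])
    define X where "X k n = powr_int q \<mu> (\<lambda>z. laplace (truncate k n) z - L k z)" for k n
    have "(\<lambda>n. ennreal (norm a powr q) * X f n) \<longlonglongrightarrow> ennreal (norm a powr q) * 0"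
      "(\<lambda>n. ennreal (norm b powr q) * X h n) \<longlonglongrightarrow> ennreal (norm b powr q) * 0"
      unfolding X_def using conv[OF f'] conv[OF h'] by (intro tendsto_mult_ennreal tendsto_const; simp)+
    then have lims: "(\<lambda>n. ennreal (norm a powr q) * X f n) \<longlonglongrightarrow> 0" "(\<lambda>n. ennreal (norm b powr q) * X h n) \<longlonglongrightarrow> 0"
      by simp_all
    show "(\<lambda>n. powr_int q \<mu> (\<lambda>z. laplace (truncate w n) z - (a * L f z + b * L h z))) \<longlonglongrightarrow> 0"
    proof (rule tendsto_0_ennreal_sum[OF lims])
      fix n
      have tr_lin: "truncate w n = (\<lambda>t. a * truncate f n t + b * truncate h n t)"
        by (auto simp: truncate_def w_def fun_eq_iff)
      have "powr_int q \<mu> (\<lambda>z. laplace (truncate w n) z - (a * L f z + b * L h z))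
          = powr_int q \<mu> (\<lambda>z. a * (laplace (truncate f n) z - L f z) + b * (laplace (truncate h n) z - L h z))"
      proof (rule powr_int_cong_AE)
        show "AE z in \<mu>. laplace (truncate w n) z - (a * L f z + b * L h z)
            = a * (laplace (truncate f n) z - L f z) + b * (laplace (truncate h n) z - L h z)"
          using AE_Re
        proof eventually_elim
          case (elim z)
          then show ?case
            unfolding tr_lin by (subst laplace_linear[OF tr_f(1) tr_h(1)]) (auto simp: algebra_simps)
        qed
      qed
      also have "\<dots> \<le> ennreal (2 powr q) * (powr_int q \<mu> (\<lambda>z. a * (laplace (truncate f n) z - L f z))
          + powr_int q \<mu> (\<lambda>z. b * (laplace (truncate h n) z - L h z)))"
        using q0 by (intro powr_int_add_le) auto
      also have "\<dots> = ennreal (2 powr q) * (ennreal (norm a powr q) * X f n + ennreal (norm b powr q) * X h n)"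
        unfolding X_def by (subst (1 2) powr_int_cmult) auto
      finally show "powr_int q \<mu> (\<lambda>z. laplace (truncate w n) z - (a * L f z + b * L h z))
          \<le> ennreal (2 powr q) * (ennreal (norm a powr q) * X f n + ennreal (norm b powr q) * X h n)" .
    qed
  qed measurable
  then show ?thesis by (simp add: L_def w_def[abs_def])
qed

theorem laplace_bounded_Lp: "laplace_bounded (ennreal p) (ennreal q) \<mu>"
  unfolding laplace_bounded_def bounded_Lp_operator_def
proof (intro conjI ballI allI)
  fix f assume f: "f \<in> Lspace (ennreal p) Rplus"
  then have "is_laplace_ext (ennreal p) (ennreal q) \<mu> f (laplace_ext (ennreal p) (ennreal q) \<mu> f)"
    using p0 by (intro is_laplace_ext_laplace_ext) (auto simp: Lspace_iff)
  then show "is_laplace_ext (ennreal p) (ennreal q) \<mu> f (laplace_ext (ennreal p) (ennreal q) \<mu> f)"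
    "laplace_ext (ennreal p) (ennreal q) \<mu> f \<in> Lspace (ennreal q) \<mu>"
    by (auto simp: is_laplace_ext_def)
next
  show "\<exists>C::real. \<forall>f\<in>Lspace (ennreal p) Rplus.
      Lnorm (ennreal q) \<mu> (laplace_ext (ennreal p) (ennreal q) \<mu> f) \<le> ennreal C * Lnorm (ennreal p) Rplus f"
    using Lnorm_laplace_ext_le by blast
qed (rule laplace_ext_linear)

theorem laplace_norm_Lp_le: "laplace_norm (ennreal p) (ennreal q) \<mu> \<le> ennreal (K powr (1 / q))"
  unfolding laplace_norm_def Lp_operator_norm_def
proof (rule SUP_least)
  fix f assume f: "f \<in> {f \<in> Lspace (ennreal p) Rplus. Lnorm (ennreal p) Rplus f \<le> 1}"
  have "Lnorm (ennreal q) \<mu> (laplace_ext (ennreal p) (ennreal q) \<mu> f) \<le> ennreal (K powr (1 / q)) * Lnorm (ennreal p) Rplus f"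
    using f by (intro Lnorm_laplace_ext_le) auto
  also have "\<dots> \<le> ennreal (K powr (1 / q)) * 1"
    using f by (intro mult_left_mono) auto
  finally show "Lnorm (ennreal q) \<mu> (laplace_ext (ennreal p) (ennreal q) \<mu> f) \<le> ennreal (K powr (1 / q))" by simp
qed

end

section \<open>The end point p = 1\<close>

context half_plane_measure
begin

lemma Lnorm_top: "Lnorm \<infinity> M f = esssup M (\<lambda>x. ennreal (norm (f x)))"
  by (simp add: Lnorm_def)

lemma Lnorm_top_laplace_le:
  assumes f: "integrable Rplus f"
  shows "Lnorm \<infinity> \<mu> (laplace f) \<le> Lnorm 1 Rplus f"
proof -
  have [measurable]: "f \<in> borel_measurable Rplus" using f by auto
  show ?thesis
    unfolding Lnorm_top Lnorm_1
  proof (rule esssup_I)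
    show "AE z in \<mu>. ennreal (norm (laplace f z)) \<le> (\<integral>\<^sup>+t. norm (f t) \<partial>Rplus)"
      using AE_Re
    proof eventually_elim
      case (elim z)
      have "ennreal (norm (laplace f z)) \<le> ennreal (\<integral>t. norm (f t) \<partial>Rplus)"
        by (intro ennreal_leI norm_laplace_le_L1[OF f elim])
      also have "\<dots> = (\<integral>\<^sup>+t. norm (f t) \<partial>Rplus)"
        using f by (subst nn_integral_eq_integral) auto
      finally show ?case .
    qed
  qed measurable
qed

lemma Lnorm_top_cong:
  assumes "AE x in M. f x = g x" "f \<in> borel_measurable M" "g \<in> borel_measurable M"
  shows "Lnorm \<infinity> M f = Lnorm \<infinity> M g"
  unfolding Lnorm_top
proof (rule antisym)
  show "esssup M (\<lambda>x. ennreal (norm (f x))) \<le> esssup M (\<lambda>x. ennreal (norm (g x)))"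
    using assms by (intro esssup_AE_mono) (auto elim: eventually_mono)
  show "esssup M (\<lambda>x. ennreal (norm (g x))) \<le> esssup M (\<lambda>x. ennreal (norm (f x)))"
    using assms by (intro esssup_AE_mono) (auto elim: eventually_mono)
qed

text \<open>For p = 1 the transform is already defined on the whole space, and the trivial bound
  applied to differences makes it an extension of itself.\<close>

lemma is_laplace_ext_laplace:
  assumes f: "integrable Rplus f"
  shows "is_laplace_ext 1 \<infinity> \<mu> f (laplace f)"
  unfolding is_laplace_ext_def
proof (intro conjI allI impI)
  have [measurable]: "f \<in> borel_measurable Rplus" using f by auto
  have "Lnorm 1 Rplus f < \<infinity>" using f by (simp add: Lnorm_1 integrable_iff_bounded)
  then show "laplace f \<in> Lspace \<infinity> \<mu>"
    unfolding Lspace_def using Lnorm_top_laplace_le[OF f] by (auto intro: le_less_trans)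
  fix \<phi> :: "nat \<Rightarrow> real \<Rightarrow> complex"
  assume \<phi>: "\<forall>n. \<phi> n \<in> Lspace 1 Rplus \<inter> Lspace 1 Rplus"
    and lim: "(\<lambda>n. Lnorm 1 Rplus (\<lambda>t. \<phi> n t - f t)) \<longlonglongrightarrow> 0"
  have int: "integrable Rplus (\<phi> n)" for n using \<phi> by (simp add: Lspace_1_iff)
  have [measurable]: "\<phi> n \<in> borel_measurable Rplus" for n using int[of n] by auto
  have "Lnorm \<infinity> \<mu> (\<lambda>z. laplace (\<phi> n) z - laplace f z) \<le> Lnorm 1 Rplus (\<lambda>t. \<phi> n t - f t)" for n
  proof -
    have "Lnorm \<infinity> \<mu> (\<lambda>z. laplace (\<phi> n) z - laplace f z) = Lnorm \<infinity> \<mu> (laplace (\<lambda>t. \<phi> n t - f t))"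
      using AE_Re by (intro Lnorm_top_cong) (auto elim!: eventually_mono simp: laplace_diff int f)
    also have "\<dots> \<le> Lnorm 1 Rplus (\<lambda>t. \<phi> n t - f t)"
      using int f by (intro Lnorm_top_laplace_le) auto
    finally show ?thesis .
  qed
  then show "(\<lambda>n. Lnorm \<infinity> \<mu> (\<lambda>z. laplace (\<phi> n) z - laplace f z)) \<longlonglongrightarrow> 0"
    by (intro tendsto_sandwich[OF _ _ tendsto_const lim]) auto
qed

lemma laplace_ext_AE:
  assumes f: "integrable Rplus f"
  shows "is_laplace_ext 1 \<infinity> \<mu> f (laplace_ext 1 \<infinity> \<mu> f)" "AE z in \<mu>. laplace_ext 1 \<infinity> \<mu> f z = laplace f z"
proof -
  define g where "g = laplace_ext 1 \<infinity> \<mu> f"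
  show ext: "is_laplace_ext 1 \<infinity> \<mu> f (laplace_ext 1 \<infinity> \<mu> f)"
    unfolding laplace_ext_def using is_laplace_ext_laplace[OF f] by (rule someI[of "is_laplace_ext 1 \<infinity> \<mu> f"])
  have [measurable]: "f \<in> borel_measurable Rplus" using f by auto
  have [measurable]: "g \<in> borel_measurable \<mu>" using ext by (simp add: is_laplace_ext_def Lspace_def g_def)
  \<comment> \<open>The constant sequence \<open>f\<close> is admissible and identifies whatever
    extension was chosen.\<close>
  have "(\<lambda>n::nat. Lnorm 1 Rplus (\<lambda>t. f t - f t)) \<longlonglongrightarrow> 0" by (simp add: Lnorm_1)
  then have "(\<lambda>n::nat. Lnorm \<infinity> \<mu> (\<lambda>z. laplace f z - g z)) \<longlonglongrightarrow> 0"
    using ext f unfolding is_laplace_ext_def g_def[symmetric] by (auto simp: Lspace_1_iff dest!: conjunct2 spec[of _ "\<lambda>_. f"])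
  then have "Lnorm \<infinity> \<mu> (\<lambda>z. laplace f z - g z) = 0" by (simp add: LIMSEQ_const_iff)
  then have "esssup \<mu> (\<lambda>z. ennreal (norm (laplace f z - g z))) = 0"
    unfolding Lnorm_top .
  then have "AE z in \<mu>. ennreal (norm (laplace f z - g z)) \<le> 0"
    using esssup_AE[where M = \<mu> and f = "\<lambda>z. ennreal (norm (laplace f z - g z))"] by simp
  then show "AE z in \<mu>. laplace_ext 1 \<infinity> \<mu> f z = laplace f z"
    unfolding g_def[symmetric] by eventually_elim simp
qed

lemma Lnorm_top_laplace_ext_le:
  assumes f: "integrable Rplus f"
  shows "Lnorm \<infinity> \<mu> (laplace_ext 1 \<infinity> \<mu> f) \<le> Lnorm 1 Rplus f"
proof -
  have "laplace_ext 1 \<infinity> \<mu> f \<in> borel_measurable \<mu>" "laplace f \<in> borel_measurable \<mu>"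
    using laplace_ext_AE(1)[OF f] f by (auto simp: is_laplace_ext_def Lspace_def)
  then have "Lnorm \<infinity> \<mu> (laplace_ext 1 \<infinity> \<mu> f) = Lnorm \<infinity> \<mu> (laplace f)"
    using laplace_ext_AE(2)[OF f] by (intro Lnorm_top_cong) auto
  then show ?thesis using Lnorm_top_laplace_le[OF f] by simp
qed

theorem laplace_bounded_L1: "laplace_bounded 1 \<infinity> \<mu>"
  unfolding laplace_bounded_def bounded_Lp_operator_def Lspace_1_iff
proof (intro conjI ballI allI)
  fix f assume "f \<in> Lspace 1 Rplus"
  then have f: "integrable Rplus f" by (simp add: Lspace_1_iff)
  then show "is_laplace_ext 1 \<infinity> \<mu> f (laplace_ext 1 \<infinity> \<mu> f)" "laplace_ext 1 \<infinity> \<mu> f \<in> Lspace \<infinity> \<mu>"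
    using laplace_ext_AE(1)[OF f] by (auto simp: is_laplace_ext_def)
  fix g a b assume "g \<in> Lspace 1 Rplus"
  then have g: "integrable Rplus g" by (simp add: Lspace_1_iff)
  have "integrable Rplus (\<lambda>t. a * f t + b * g t)" using f g by simp
  from laplace_ext_AE(2)[OF this] laplace_ext_AE(2)[OF f] laplace_ext_AE(2)[OF g] AE_Re
  show "AE z in \<mu>. laplace_ext 1 \<infinity> \<mu> (\<lambda>t. a * f t + b * g t) z =
      a * laplace_ext 1 \<infinity> \<mu> f z + b * laplace_ext 1 \<infinity> \<mu> g z"
    by eventually_elim (simp add: laplace_linear[OF f g])
next
  show "\<exists>C::real. \<forall>f\<in>Lspace 1 Rplus. Lnorm \<infinity> \<mu> (laplace_ext 1 \<infinity> \<mu> f) \<le> ennreal C * Lnorm 1 Rplus f"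
    using Lnorm_top_laplace_ext_le by (intro exI[of _ 1]) (auto simp: Lspace_1_iff)
qed

theorem laplace_norm_L1_le: "laplace_norm 1 \<infinity> \<mu> \<le> 1"
  unfolding laplace_norm_def Lp_operator_norm_def
  using Lnorm_top_laplace_ext_le by (intro SUP_least) (auto simp: Lspace_1_iff intro: order_trans)

end

section \<open>Application to the classes of measures\<close>

lemma laplace_L2_bound_Rplus:
  assumes ab: "- pi / 2 \<le> \<alpha>" "\<alpha> < \<beta>" "\<beta> \<le> pi / 2" and \<mu>: "\<mu> \<in> W2 \<alpha> \<beta> k k' l l'"
    and k: "0 \<le> k" "0 \<le> k'" "0 \<le> l" "0 \<le> l'" and f: "integrable Rplus f"
  shows "(\<integral>\<^sup>+z. (ennreal (norm (laplace f z)))\<^sup>2 \<partial>\<mu>)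
    \<le> ennreal (8 * pi * (sqrt (6 * k + k') + sqrt (6 * l + l'))\<^sup>2) * (\<integral>\<^sup>+t. ennreal ((norm (f t))\<^sup>2) \<partial>Rplus)"
proof -
  define f' where "f' t = indicator {0<..} t *\<^sub>R f t" for t
  have f': "integrable lborel f'"
    using f unfolding f'_def Rplus_def by (subst (asm) integrable_restrict_space) auto
  have "laplace f z = laplace f' z" for z
    unfolding laplace_def by (intro Bochner_Integration.integral_cong) (auto simp: f'_def)
  moreover have "(\<integral>\<^sup>+t. ennreal ((norm (f' t))\<^sup>2) \<partial>lborel) = (\<integral>\<^sup>+t. ennreal ((norm (f t))\<^sup>2) \<partial>Rplus)"
    unfolding Rplus_def by (subst nn_integral_restrict_space) (auto intro!: nn_integral_cong simp: f'_def indicator_def)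
  ultimately show ?thesis
    using laplace_L2_bound[OF ab \<mu> k f'] by (simp add: f'_def)
qed

lemma W2_half_plane_measure:
  assumes ab: "- pi / 2 \<le> \<alpha>" "\<alpha> < \<beta>" "\<beta> \<le> pi / 2" and \<mu>: "\<mu> \<in> W2 \<alpha> \<beta> k k' l l'"
  shows "half_plane_measure \<mu>"
proof
  show "sets \<mu> = sets borel" using \<mu> by (simp add: W2_def W1_def)
  show "AE z in \<mu>. 0 \<le> Re z"
    using W2_AE[OF ab \<mu>] unfolding sector_eq[OF ab] by eventually_elim simp
qed

text \<open>The constant vanishes when all four projection constants do, whereas the interpolation
  asks for a positive one. It is applied with every C > K, and C tends to K.\<close>

lemma W2_laplace_Lp:
  assumes ab: "- pi / 2 \<le> \<alpha>" "\<alpha> < \<beta>" "\<beta> \<le> pi / 2" and \<mu>: "\<mu> \<in> W2 \<alpha> \<beta> k k' l l'"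
    and k: "0 \<le> k" "0 \<le> k'" "0 \<le> l" "0 \<le> l'" and p: "1 < p" "p \<le> 2" and q: "q = p / (p - 1)"
  shows "laplace_Lp \<mu> (8 * pi * (sqrt (6 * k + k') + sqrt (6 * l + l'))\<^sup>2) p q"
proof -
  define K where "K = 8 * pi * (sqrt (6 * k + k') + sqrt (6 * l + l'))\<^sup>2"
  have K: "K \<ge> 0" by (simp add: K_def)
  interpret hp: half_plane_measure \<mu> by (rule W2_half_plane_measure[OF ab \<mu>])
  show ?thesis
    unfolding K_def[symmetric]
  proof
    fix f :: "real \<Rightarrow> complex" and a
    assume f: "integrable Rplus f" and a: "powr_int p Rplus f = ennreal a" "a \<ge> 0"
    have C: "powr_int q \<mu> (laplace f) \<le> ennreal (C * a powr (q - 1))" if "C > K" for C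
    proof -
      interpret laplace_measure \<mu> C
      proof
        fix f :: "real \<Rightarrow> complex" assume "integrable Rplus f"
        then have "(\<integral>\<^sup>+z. (ennreal (norm (laplace f z)))\<^sup>2 \<partial>\<mu>) \<le> ennreal K * (\<integral>\<^sup>+t. ennreal ((norm (f t))\<^sup>2) \<partial>Rplus)"
          unfolding K_def by (rule laplace_L2_bound_Rplus[OF ab \<mu> k])
        also have "\<dots> \<le> ennreal C * (\<integral>\<^sup>+t. ennreal ((norm (f t))\<^sup>2) \<partial>Rplus)"
          using that by (intro mult_right_mono ennreal_leI) auto
        finally show "(\<integral>\<^sup>+z. (ennreal (norm (laplace f z)))\<^sup>2 \<partial>\<mu>) \<le> ennreal C * (\<integral>\<^sup>+t. ennreal ((norm (f t))\<^sup>2) \<partial>Rplus)" .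
      qed (use K that in auto)
      show ?thesis by (rule riesz_thorin[OF f a p q])
    qed
    have "(\<lambda>n. ennreal ((K + 1 / real (Suc n)) * a powr (q - 1))) \<longlonglongrightarrow> ennreal ((K + 0) * a powr (q - 1))"
      using LIMSEQ_inverse_real_of_nat
      by (intro tendsto_ennrealI tendsto_mult tendsto_add tendsto_const) (simp add: inverse_eq_divide)
    then have "powr_int q \<mu> (laplace f) \<le> ennreal ((K + 0) * a powr (q - 1))"
      by (rule LIMSEQ_le_const) (auto intro!: exI[of _ 0] C)
    then show "powr_int q \<mu> (laplace f) \<le> ennreal (K * a powr (q - 1))" by simp
  qed (use K p q in auto)
qed

lemma conjugate_exponent_cases:
  fixes p :: real and p' :: ennreal
  assumes p: "1 \<le> p" and conj: "inverse (ennreal p) + inverse p' = 1"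
  obtains "p = 1" "p' = \<infinity>" | q where "1 < p" "q = p / (p - 1)" "p' = ennreal q"
proof (cases "p' = \<infinity>")
  case True
  then have "ennreal (1 / p) = ennreal 1"
    using conj p by (simp add: inverse_ennreal inverse_eq_divide)
  then have "p = 1" using p by (subst (asm) ennreal_inj) auto
  then show ?thesis using True that(1) by blast
next
  case False
  then obtain q where q: "p' = ennreal q" "q \<ge> 0" by (cases p') auto
  have "q \<noteq> 0"
  proof
    assume "q = 0"
    then show False using conj q by simp
  qed
  then have q0: "q > 0" using q by simp
  have "ennreal (1 / p + 1 / q) = ennreal 1"
    using conj p q q0 by (simp add: inverse_ennreal inverse_eq_divide ennreal_plus)
  then have eq: "1 / p + 1 / q = 1" using p q0 by (subst (asm) ennreal_inj) auto
  then have p1: "p \<noteq> 1" using q0 by auto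
  then have "q = p / (p - 1)" using eq p q0 by (simp add: field_simps)
  then show ?thesis using that(2) p p1 q(1) by simp
qed

theorem theorem6:
  fixes k k' l l' p :: real and p' :: ennreal
  assumes "k \<ge> 0" and "k' \<ge> 0" and "l \<ge> 0" and "l' \<ge> 0"
    and "1 \<le> p" and "p \<le> 2"
    and "inverse (ennreal p) + inverse p' = 1"
  shows "(\<forall>\<alpha> \<beta> \<mu>. - pi / 2 \<le> \<alpha> \<longrightarrow> \<alpha> < \<beta> \<longrightarrow> \<beta> \<le> pi / 2 \<longrightarrow>
            \<mu> \<in> W2 \<alpha> \<beta> k k' l l' \<longrightarrow> laplace_bounded (ennreal p) p' \<mu>) \<and>
         K5 (ennreal p) p' k k' l l' \<le>
           ennreal (rpow (8 * pi) (enn2real (inverse p')) *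
                    rpow (sqrt (6 * k + k') + sqrt (6 * l + l')) (2 * enn2real (inverse p')))"
  using assms(5,7)
proof (cases rule: conjugate_exponent_cases)
  case 1
  have b: "laplace_bounded (ennreal p) p' \<mu> \<and> laplace_norm (ennreal p) p' \<mu> \<le> 1"
    if "- pi / 2 \<le> \<alpha>" "\<alpha> < \<beta>" "\<beta> \<le> pi / 2" "\<mu> \<in> W2 \<alpha> \<beta> k k' l l'" for \<alpha> \<beta> \<mu>
  proof -
    interpret half_plane_measure \<mu> by (rule W2_half_plane_measure[OF that])
    show ?thesis using laplace_bounded_L1 laplace_norm_L1_le 1 by simp
  qed
  have "K5 (ennreal p) p' k k' l l' \<le> 1"
    unfolding K5_def using b by (auto intro!: SUP_least)
  \<comment> \<open>Both exponents are 0 at p = 1, and \<open>rpow\<close> makes the right-hand side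
    1 even if all projection constants vanish.\<close>
  then show ?thesis using b 1 by (auto simp: rpow_def)
next
  case (2 q)
  define s where "s = sqrt (6 * k + k') + sqrt (6 * l + l')"
  have s0: "s \<ge> 0" using assms by (simp add: s_def)
  have q0: "q > 0" using 2 by simp
  have b: "laplace_bounded (ennreal p) p' \<mu> \<and> laplace_norm (ennreal p) p' \<mu> \<le> ennreal ((8 * pi * s\<^sup>2) powr (1 / q))"
    if "- pi / 2 \<le> \<alpha>" "\<alpha> < \<beta>" "\<beta> \<le> pi / 2" "\<mu> \<in> W2 \<alpha> \<beta> k k' l l'" for \<alpha> \<beta> \<mu>
  proof -
    interpret laplace_Lp \<mu> "8 * pi * s\<^sup>2" p q
      unfolding s_def by (rule W2_laplace_Lp[OF that assms(1-4) 2(1) assms(6) 2(2)])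
    show ?thesis using laplace_bounded_Lp laplace_norm_Lp_le 2(3) by simp
  qed
  have "enn2real (inverse p') = 1 / q"
    using q0 2(3) by (simp add: inverse_ennreal inverse_eq_divide)
  moreover have "(8 * pi * s\<^sup>2) powr (1 / q) = (8 * pi) powr (1 / q) * s powr (2 * (1 / q))"
  proof (cases "s = 0")
    case False
    then have "s\<^sup>2 = s powr 2" using s0 by simp
    then have "(8 * pi * s\<^sup>2) powr (1 / q) = (8 * pi) powr (1 / q) * (s powr 2) powr (1 / q)"
      by (simp only: powr_mult)
    then show ?thesis by (simp only: powr_powr)
  qed simp
  ultimately have eq: "rpow (8 * pi) (enn2real (inverse p')) * rpow s (2 * enn2real (inverse p'))
      = (8 * pi * s\<^sup>2) powr (1 / q)"
    using q0 by (simp add: rpow_def)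
  have "K5 (ennreal p) p' k k' l l' \<le> ennreal ((8 * pi * s\<^sup>2) powr (1 / q))"
    unfolding K5_def using b by (auto intro!: SUP_least)
  then show ?thesis using b unfolding s_def[symmetric] eq by auto
qed

end
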